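(* Let $p$ be a prime, let $0\le a_1\le a_2\le a_3$ be integers, and $T=\mathrm{diag}(p^{a_1},p^{a_2},p^{a_3})\in\mathfrak J(\mathbb Z_p)$. Then: (1) if $a_1=a_2=a_3$, $\beta_p(T)=p^{27a_1}(1-p^{-2})(1-p^{-6})(1-p^{-8})(1-p^{-12})$; (2) if $a_1=a_2<a_3$, $\beta_p(T)=p^{26a_1+a_3}(1-p^{-2})(1-p^{-4})(1-p^{-6})(1-p^{-8})$; (3) if $a_1<a_2=a_3$, $\beta_p(T)=p^{17a_1+10a_3}(1-p^{-2})(1-p^{-4})(1-p^{-6})(1-p^{-8})$; (4) if $a_1<a_2<a_3$, $\beta_p(T)=p^{17a_1+9a_2+a_3}(1-p^{-2})(1-p^{-4})^2(1-p^{-6})$.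
   Context: $\mathfrak o$ is the ring of integral Cayley numbers in the rational octonion algebra (conjugation $\bar x$, $N(x)=x\bar x$, $\mathrm{Tr}(x)=x+\bar x$), $\mathfrak C(R)=\mathfrak o\otimes R$. $\mathfrak J(R)$ is the rank-27 $R$-module of matrices $\begin{pmatrix}a&x&y\\ \bar x&b&z\\ \bar y&\bar z&c\end{pmatrix}$, $a,b,c\in R$, $x,y,z\in\mathfrak C(R)$, $\det X=abc-aN(z)-bN(y)-cN(x)+\mathrm{Tr}((xz)\bar y)$; $\mathcal M(R)$ is the group of $R$-linear automorphisms $g$ of $\mathfrak J(R)$ with $\det(gX)=\nu(g)\det X$ for some $\nu(g)\in R^\times$. Let $\delta_p=(1-p^{-2})(1-p^{-5})(1-p^{-6})(1-p^{-8})(1-p^{-9})(1-p^{-12})$, $d\sigma$ the Haar measure on $\mathfrak J(\mathbb Q_p)$ with $\mathrm{vol}(\mathfrak J(\mathbb Z_p))=1$, and for $T\in\mathfrak J(\mathbb Z_p)$ with $\det T\ne0$, $\beta_p(T)=(1-p^{-1})\delta_p/\mathrm{vol}_{d\sigma}(\mathcal M(\mathbb Z_p)\cdot T)$. *)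

theory Defs
  imports
    "HOL-Analysis.Analysis"
    "HOL-Computational_Algebra.Fraction_Field"
    "Berlekamp_Zassenhaus.Finite_Field"
begin

section \<open>The \<open>p\<close>-adic integers\<close>

text \<open>
  The prime is \<open>p = CARD('p)\<close>.  A \<open>p\<close>-adic integer is a compatible system of residues
  \<open>x n\<close> modulo \<open>p ^ n\<close>; the equation below also forces \<open>0 \<le> x n < p ^ n\<close>.
\<close>

typedef ('p::prime_card) zp =
  "{x :: nat \<Rightarrow> int. \<forall>n. x n = x (Suc n) mod int CARD('p) ^ n}"
  by (rule exI[of _ "\<lambda>_. 0"]) simp

setup_lifting type_definition_zp

lemma Rep_zp_step: "Rep_zp (x :: 'p::prime_card zp) (Suc n) mod int CARD('p) ^ n = Rep_zp x n"
  by (rule sym, rule spec[OF CollectD[OF Rep_zp[of x]]])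

lemma Rep_zp_mod_self [simp]: "Rep_zp (x :: 'p::prime_card zp) n mod int CARD('p) ^ n = Rep_zp x n"
  by (subst (1 2) Rep_zp_step[symmetric]) (rule mod_mod_trivial)

lemma mod_power_Suc_mod: "(a mod (p::int) ^ Suc n) mod p ^ n = a mod p ^ n"
  by (rule mod_mod_cancel) simp

context
  fixes x y :: "nat \<Rightarrow> int" and p :: int
  assumes x: "\<And>n. x n = x (Suc n) mod p ^ n" and y: "\<And>n. y n = y (Suc n) mod p ^ n"
begin

lemma zp_closed_add:
  "(x n + y n) mod p ^ n = (x (Suc n) + y (Suc n)) mod p ^ Suc n mod p ^ n"
  by (subst x, subst y) (simp only: mod_power_Suc_mod mod_add_eq)

lemma zp_closed_diff:
  "(x n - y n) mod p ^ n = (x (Suc n) - y (Suc n)) mod p ^ Suc n mod p ^ n"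
  by (subst x, subst y) (simp only: mod_power_Suc_mod mod_diff_eq)

lemma zp_closed_mult:
  "(x n * y n) mod p ^ n = (x (Suc n) * y (Suc n)) mod p ^ Suc n mod p ^ n"
  by (subst x, subst y) (simp only: mod_power_Suc_mod mod_mult_eq)

lemma zp_closed_minus:
  "(- x n) mod p ^ n = (- x (Suc n)) mod p ^ Suc n mod p ^ n"
  by (subst x) (simp only: mod_power_Suc_mod mod_minus_eq)

end

lemma zp_eqI: "(\<And>n. Rep_zp x n = Rep_zp y n) \<Longrightarrow> x = y"
  by (rule iffD1[OF Rep_zp_inject]) (rule ext)

instantiation zp :: (prime_card) comm_ring_1
begin

lift_definition zero_zp :: "'a zp" is "\<lambda>_. 0" by simp

lift_definition one_zp :: "'a zp" is "\<lambda>n. 1 mod int CARD('a) ^ n"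
  by (simp only: mod_power_Suc_mod simp_thms)

lift_definition plus_zp :: "'a zp \<Rightarrow> 'a zp \<Rightarrow> 'a zp" is
  "\<lambda>x y n. (x n + y n) mod int CARD('a) ^ n"
  by (rule zp_closed_add)

lift_definition minus_zp :: "'a zp \<Rightarrow> 'a zp \<Rightarrow> 'a zp" is
  "\<lambda>x y n. (x n - y n) mod int CARD('a) ^ n"
  by (rule zp_closed_diff)

lift_definition uminus_zp :: "'a zp \<Rightarrow> 'a zp" is
  "\<lambda>x n. (- x n) mod int CARD('a) ^ n"
  by (rule zp_closed_minus)

lift_definition times_zp :: "'a zp \<Rightarrow> 'a zp \<Rightarrow> 'a zp" is
  "\<lambda>x y n. (x n * y n) mod int CARD('a) ^ n"
  by (rule zp_closed_mult)

lemmas zp_rep_eqs = zero_zp.rep_eq one_zp.rep_eq plus_zp.rep_eq minus_zp.rep_eq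
  uminus_zp.rep_eq times_zp.rep_eq

instance
proof
  fix a b c :: "'a zp"
  show "a * b * c = a * (b * c)"
    by (rule zp_eqI) (simp only: zp_rep_eqs mod_mult_left_eq mod_mult_right_eq mult.assoc)
  show "a * b = b * a"
    by (rule zp_eqI) (simp only: zp_rep_eqs mult.commute)
  show "1 * a = a"
    by (rule zp_eqI) (simp only: zp_rep_eqs mod_mult_left_eq mult_1_left Rep_zp_mod_self)
  show "a + b + c = a + (b + c)"
    by (rule zp_eqI) (simp only: zp_rep_eqs mod_add_left_eq mod_add_right_eq add.assoc)
  show "a + b = b + a"
    by (rule zp_eqI) (simp only: zp_rep_eqs add.commute)
  show "0 + a = a"
    by (rule zp_eqI) (simp only: zp_rep_eqs add_0_left Rep_zp_mod_self)
  show "- a + a = 0"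
    by (rule zp_eqI) (simp only: zp_rep_eqs mod_add_left_eq left_minus mod_0)
  show "a - b = a + - b"
    by (rule zp_eqI) (simp only: zp_rep_eqs mod_add_right_eq diff_conv_add_uminus)
  show "(a + b) * c = a * c + b * c"
    by (rule zp_eqI)
      (simp only: zp_rep_eqs mod_mult_left_eq mod_add_left_eq mod_add_right_eq distrib_right)
  have "1 mod int CARD('a) ^ 1 = 1"
    using prime_gt_1_nat[OF prime_card[where 'a = 'a]] by simp
  then have "Rep_zp (0 :: 'a zp) 1 \<noteq> Rep_zp 1 1"
    by (simp only: zp_rep_eqs)
  then show "(0 :: 'a zp) \<noteq> 1" by metis
qed

end

lemma Rep_zp_mod: "m \<le> n \<Longrightarrow> Rep_zp (x :: 'p::prime_card zp) n mod int CARD('p) ^ m = Rep_zp x m"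
proof (induction n rule: dec_induct)
  case base
  show ?case by simp
next
  case (step n)
  have "Rep_zp x (Suc n) mod int CARD('p) ^ m
      = (Rep_zp x (Suc n) mod int CARD('p) ^ n) mod int CARD('p) ^ m"
    by (rule mod_mod_cancel[symmetric]) (rule le_imp_power_dvd[OF step(1)])
  then show ?case by (simp only: Rep_zp_step step.IH)
qed

instance zp :: (prime_card) idom
proof
  fix a b :: "'a zp"
  let ?p = "int CARD('a)"
  assume "a \<noteq> 0" "b \<noteq> 0"
  then obtain m n where mn: "Rep_zp a m \<noteq> 0" "Rep_zp b n \<noteq> 0"
    by (metis Rep_zp_inject zero_zp.rep_eq ext)
  have p: "prime_elem ?p"
    using prime_card[where 'a = 'a] by simp
  have nd: "\<not> ?p ^ m dvd Rep_zp a (m + n)" "\<not> ?p ^ n dvd Rep_zp b (m + n)"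
    using Rep_zp_mod[of m "m + n" a] Rep_zp_mod[of n "m + n" b] mn
    by (simp_all add: dvd_eq_mod_eq_0)
  then have nz: "Rep_zp a (m + n) \<noteq> 0" "Rep_zp b (m + n) \<noteq> 0" by (metis dvd_0_right)+
  have lt: "multiplicity ?p (Rep_zp a (m + n)) < m" "multiplicity ?p (Rep_zp b (m + n)) < n"
    using nd by (metis linorder_not_le multiplicity_dvd')+
  have "multiplicity ?p (Rep_zp a (m + n) * Rep_zp b (m + n)) < m + n"
    using lt by (simp add: prime_elem_multiplicity_mult_distrib[OF p nz])
  then have "\<not> ?p ^ (m + n) dvd Rep_zp a (m + n) * Rep_zp b (m + n)"
    using nz p by (subst power_dvd_iff_le_multiplicity) (auto simp: prime_elem_def)
  then have "Rep_zp (a * b) (m + n) \<noteq> 0"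
    by (simp add: times_zp.rep_eq dvd_eq_mod_eq_0)
  then show "a * b \<noteq> 0"
    by (metis zero_zp.rep_eq)
qed


section \<open>The field of \<open>p\<close>-adic numbers and its topology\<close>

typedef ('p::prime_card) qp = "UNIV :: 'p zp fract set" ..

setup_lifting type_definition_qp

instantiation qp :: (prime_card) field
begin

lift_definition zero_qp :: "'a qp" is 0 .
lift_definition one_qp :: "'a qp" is 1 .
lift_definition plus_qp :: "'a qp \<Rightarrow> 'a qp \<Rightarrow> 'a qp" is "(+)" .
lift_definition minus_qp :: "'a qp \<Rightarrow> 'a qp \<Rightarrow> 'a qp" is "(-)" .
lift_definition uminus_qp :: "'a qp \<Rightarrow> 'a qp" is "uminus" .
lift_definition times_qp :: "'a qp \<Rightarrow> 'a qp \<Rightarrow> 'a qp" is "(*)" .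
lift_definition inverse_qp :: "'a qp \<Rightarrow> 'a qp" is "inverse" .
lift_definition divide_qp :: "'a qp \<Rightarrow> 'a qp \<Rightarrow> 'a qp" is "(/)" .

instance
  by standard (transfer; simp add: algebra_simps divide_inverse)+

end

definition qp_of_zp :: "'p::prime_card zp \<Rightarrow> 'p qp" where
  "qp_of_zp x = Abs_qp (Fract x 1)"

lemma qp_of_zp_add: "qp_of_zp (x + y) = qp_of_zp x + qp_of_zp y"
  by (simp add: qp_of_zp_def plus_qp.abs_eq)

lemma qp_of_zp_mult: "qp_of_zp (x * y) = qp_of_zp x * qp_of_zp y"
  by (simp add: qp_of_zp_def times_qp.abs_eq)

text \<open>The \<open>p\<close>-adic topology: the sets \<open>x + p ^ n \<int>\<^sub>p\<close> are a neighbourhood base at \<open>x\<close>.\<close>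

instantiation qp :: (prime_card) topological_space
begin

definition open_qp :: "'a qp set \<Rightarrow> bool" where
  "open_qp S \<longleftrightarrow>
     (\<forall>x\<in>S. \<exists>n::nat. \<forall>t::'a zp. x + qp_of_zp (of_nat CARD('a) ^ n * t) \<in> S)"

instance
proof
  show "open (UNIV :: 'a qp set)" by (simp add: open_qp_def)
next
  fix S T :: "'a qp set"
  assume S: "open S" and T: "open T"
  show "open (S \<inter> T)"
    unfolding open_qp_def
  proof
    fix x assume "x \<in> S \<inter> T"
    then obtain m n where
      m: "\<And>t. x + qp_of_zp (of_nat CARD('a) ^ m * t) \<in> S" and
      n: "\<And>t. x + qp_of_zp (of_nat CARD('a) ^ n * t) \<in> T"
      using S T unfolding open_qp_def by blast
    have "x + qp_of_zp (of_nat CARD('a) ^ (m + n) * t) \<in> S \<inter> T" for t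
      using m[of "of_nat CARD('a) ^ n * t"] n[of "of_nat CARD('a) ^ m * t"]
      by (simp add: power_add mult.assoc mult.left_commute)
    then show "\<exists>n. \<forall>t. x + qp_of_zp (of_nat CARD('a) ^ n * t) \<in> S \<inter> T" by blast
  qed
next
  fix K :: "'a qp set set"
  assume "\<forall>S\<in>K. open S"
  then show "open (\<Union>K)" unfolding open_qp_def by (meson Union_iff)
qed

end


section \<open>Integral Cayley numbers\<close>

text \<open>
  The rational octonion algebra has basis \<open>e\<^sub>0 = 1, e\<^sub>1, \<dots>, e\<^sub>7\<close> with \<open>e\<^sub>i\<^sup>2 = -1\<close> and
  \<open>e\<^sub>i e\<^sub>j = e\<^sub>k = - e\<^sub>j e\<^sub>i\<close> for each cyclic rotation \<open>(i, j, k)\<close> of one of the triples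
  listed in \<open>oct_cross\<close>.
\<close>

abbreviation oct_e :: "8 \<Rightarrow> rat ^ 8" where
  "oct_e i \<equiv> axis i 1"

definition oct_cross :: "rat ^ 8 \<Rightarrow> rat ^ 8 \<Rightarrow> rat ^ 8" where
  "oct_cross x y =
     (\<Sum>(i, j, k) \<leftarrow> [(1,2,4), (2,3,5), (3,4,6), (4,5,7), (5,6,1), (6,7,2), (7,1,3)].
        (x $ i * y $ j - x $ j * y $ i) *s oct_e k +
        (x $ j * y $ k - x $ k * y $ j) *s oct_e i +
        (x $ k * y $ i - x $ i * y $ k) *s oct_e j)"

definition oct_mult :: "rat ^ 8 \<Rightarrow> rat ^ 8 \<Rightarrow> rat ^ 8" where
  "oct_mult x y =
     x $ 0 *s y + y $ 0 *s x - (\<Sum>i\<in>UNIV. x $ i * y $ i) *s oct_e 0 + oct_cross x y"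

definition oct_conj :: "rat ^ 8 \<Rightarrow> rat ^ 8" where
  "oct_conj x = (\<chi> k. if k = 0 then x $ k else - x $ k)"

text \<open>Coxeter's \<open>\<int>\<close>-basis of the ring of integral Cayley numbers; note \<open>\<alpha>\<^sub>0 = 1\<close>.\<close>

definition cayley_basis :: "8 \<Rightarrow> rat ^ 8" where
  "cayley_basis i =
     (if i = 0 then oct_e 0
      else if i = 1 then oct_e 1
      else if i = 2 then oct_e 2
      else if i = 3 then - oct_e 4
      else if i = 4 then (1/2) *s (oct_e 1 + oct_e 2 + oct_e 3 - oct_e 4)
      else if i = 5 then (1/2) *s (- oct_e 0 - oct_e 1 - oct_e 4 + oct_e 5)
      else if i = 6 then (1/2) *s (- oct_e 0 + oct_e 1 - oct_e 2 + oct_e 6)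
      else (1/2) *s (- oct_e 0 + oct_e 2 + oct_e 4 + oct_e 7))"

definition cayley_comb :: "int ^ 8 \<Rightarrow> rat ^ 8" where
  "cayley_comb c = (\<Sum>k\<in>UNIV. of_int (c $ k) *s cayley_basis k)"

definition integral_cayley :: "(rat ^ 8) set" where
  "integral_cayley = range cayley_comb"

text \<open>
  Structure constants of the integral Cayley numbers with respect to \<open>cayley_basis\<close>; that
  they exist and are unique is shown in \<open>cayley_mult_const\<close>, \<open>cayley_conj_const\<close> and
  \<open>inj_cayley_comb\<close>.
\<close>

definition mult_const :: "8 \<Rightarrow> 8 \<Rightarrow> int ^ 8" where
  "mult_const i j = (THE c. oct_mult (cayley_basis i) (cayley_basis j) = cayley_comb c)"

definition conj_const :: "8 \<Rightarrow> int ^ 8" where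
  "conj_const i = (THE c. oct_conj (cayley_basis i) = cayley_comb c)"


lemma UNIV_index8: "(UNIV :: 8 set) = {0, 1, 2, 3, 4, 5, 6, 7}"
proof -
  have "card {0::8, 1, 2, 3, 4, 5, 6, 7} = CARD(8)" by simp
  then show ?thesis by (metis card_subset_eq finite top_greatest)
qed

lemma sum_index8: "(\<Sum>i\<in>(UNIV :: 8 set). f i) = f 0 + f 1 + f 2 + f 3 + f 4 + f 5 + f 6 + f 7"
  unfolding UNIV_index8 by (simp add: add.assoc)

lemma forall_index8: "(\<forall>i::8. P i) \<longleftrightarrow> P 0 \<and> P 1 \<and> P 2 \<and> P 3 \<and> P 4 \<and> P 5 \<and> P 6 \<and> P 7"
  by (metis UNIV_I UNIV_index8 empty_iff insert_iff)

lemma cayley_comb_nth: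
  "cayley_comb c $ 0 = of_int (c $ 0) - (of_int (c $ 5) + of_int (c $ 6) + of_int (c $ 7)) / 2"
  "cayley_comb c $ 1 = of_int (c $ 1) + (of_int (c $ 4) - of_int (c $ 5) + of_int (c $ 6)) / 2"
  "cayley_comb c $ 2 = of_int (c $ 2) + (of_int (c $ 4) - of_int (c $ 6) + of_int (c $ 7)) / 2"
  "cayley_comb c $ 3 = of_int (c $ 4) / 2"
  "cayley_comb c $ 4 = - of_int (c $ 3) + (- of_int (c $ 4) - of_int (c $ 5) + of_int (c $ 7)) / 2"
  "cayley_comb c $ 5 = of_int (c $ 5) / 2"
  "cayley_comb c $ 6 = of_int (c $ 6) / 2"
  "cayley_comb c $ 7 = of_int (c $ 7) / 2"
  by (simp_all add: cayley_comb_def sum_index8 cayley_basis_def axis_def field_simps)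

lemma inj_cayley_comb: "inj cayley_comb"
proof (rule injI)
  fix c d assume "cayley_comb c = cayley_comb d"
  then have *: "\<And>i. cayley_comb c $ i = cayley_comb d $ i" by simp
  show "c = d"
    using *[of 0] *[of 1] *[of 2] *[of 3] *[of 4] *[of 5] *[of 6] *[of 7]
    by (simp add: cayley_comb_nth vec_eq_iff forall_index8)
qed

text \<open>The coordinates of a rational octonion with respect to \<open>cayley_basis\<close>.\<close>

definition cayley_coord :: "rat ^ 8 \<Rightarrow> rat ^ 8" where
  "cayley_coord v = (\<chi> k.
     if k = 0 then v $ 0 + v $ 5 + v $ 6 + v $ 7
     else if k = 1 then v $ 1 - v $ 3 + v $ 5 - v $ 6
     else if k = 2 then v $ 2 - v $ 3 + v $ 6 - v $ 7
     else if k = 3 then - v $ 3 - v $ 4 - v $ 5 + v $ 7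
     else if k = 4 then 2 * v $ 3
     else if k = 5 then 2 * v $ 5
     else if k = 6 then 2 * v $ 6
     else 2 * v $ 7)"

lemma integral_cayleyI:
  assumes "\<And>k. cayley_coord v $ k \<in> \<int>"
  shows "v \<in> integral_cayley"
proof -
  have f: "rat_of_int \<lfloor>cayley_coord v $ k\<rfloor> = cayley_coord v $ k" for k
    using assms[of k] by simp
  have "v = cayley_comb (\<chi> k. \<lfloor>cayley_coord v $ k\<rfloor>)"
    by (simp add: vec_eq_iff forall_index8 cayley_comb_nth f)
       (simp add: cayley_coord_def field_simps)
  then show ?thesis unfolding integral_cayley_def by blast
qed



lemma cayley_basis_nth:
  "cayley_basis 0 $ 0 = 1" "cayley_basis 0 $ 1 = 0" "cayley_basis 0 $ 2 = 0" "cayley_basis 0 $ 3 = 0" "cayley_basis 0 $ 4 = 0" "cayley_basis 0 $ 5 = 0" "cayley_basis 0 $ 6 = 0" "cayley_basis 0 $ 7 = 0"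
  "cayley_basis 1 $ 0 = 0" "cayley_basis 1 $ 1 = 1" "cayley_basis 1 $ 2 = 0" "cayley_basis 1 $ 3 = 0" "cayley_basis 1 $ 4 = 0" "cayley_basis 1 $ 5 = 0" "cayley_basis 1 $ 6 = 0" "cayley_basis 1 $ 7 = 0"
  "cayley_basis 2 $ 0 = 0" "cayley_basis 2 $ 1 = 0" "cayley_basis 2 $ 2 = 1" "cayley_basis 2 $ 3 = 0" "cayley_basis 2 $ 4 = 0" "cayley_basis 2 $ 5 = 0" "cayley_basis 2 $ 6 = 0" "cayley_basis 2 $ 7 = 0"
  "cayley_basis 3 $ 0 = 0" "cayley_basis 3 $ 1 = 0" "cayley_basis 3 $ 2 = 0" "cayley_basis 3 $ 3 = 0" "cayley_basis 3 $ 4 = - 1" "cayley_basis 3 $ 5 = 0" "cayley_basis 3 $ 6 = 0" "cayley_basis 3 $ 7 = 0"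
  "cayley_basis 4 $ 0 = 0" "cayley_basis 4 $ 1 = 1/2" "cayley_basis 4 $ 2 = 1/2" "cayley_basis 4 $ 3 = 1/2" "cayley_basis 4 $ 4 = - 1/2" "cayley_basis 4 $ 5 = 0" "cayley_basis 4 $ 6 = 0" "cayley_basis 4 $ 7 = 0"
  "cayley_basis 5 $ 0 = - 1/2" "cayley_basis 5 $ 1 = - 1/2" "cayley_basis 5 $ 2 = 0" "cayley_basis 5 $ 3 = 0" "cayley_basis 5 $ 4 = - 1/2" "cayley_basis 5 $ 5 = 1/2" "cayley_basis 5 $ 6 = 0" "cayley_basis 5 $ 7 = 0"
  "cayley_basis 6 $ 0 = - 1/2" "cayley_basis 6 $ 1 = 1/2" "cayley_basis 6 $ 2 = - 1/2" "cayley_basis 6 $ 3 = 0" "cayley_basis 6 $ 4 = 0" "cayley_basis 6 $ 5 = 0" "cayley_basis 6 $ 6 = 1/2" "cayley_basis 6 $ 7 = 0"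
  "cayley_basis 7 $ 0 = - 1/2" "cayley_basis 7 $ 1 = 0" "cayley_basis 7 $ 2 = 1/2" "cayley_basis 7 $ 3 = 0" "cayley_basis 7 $ 4 = 1/2" "cayley_basis 7 $ 5 = 0" "cayley_basis 7 $ 6 = 0" "cayley_basis 7 $ 7 = 1/2"
  by (simp_all add: cayley_basis_def axis_def)

lemma oct_mult_nth:
  "oct_mult x y $ 0 = x$0*y$0 - x$1*y$1 - x$2*y$2 - x$3*y$3 - x$4*y$4 - x$5*y$5 - x$6*y$6 - x$7*y$7"
  "oct_mult x y $ 1 = x$0*y$1 + x$1*y$0 + x$2*y$4 + x$3*y$7 - x$4*y$2 + x$5*y$6 - x$6*y$5 - x$7*y$3"
  "oct_mult x y $ 2 = x$0*y$2 - x$1*y$4 + x$2*y$0 + x$3*y$5 + x$4*y$1 - x$5*y$3 + x$6*y$7 - x$7*y$6"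
  "oct_mult x y $ 3 = x$0*y$3 - x$1*y$7 - x$2*y$5 + x$3*y$0 + x$4*y$6 + x$5*y$2 - x$6*y$4 + x$7*y$1"
  "oct_mult x y $ 4 = x$0*y$4 + x$1*y$2 - x$2*y$1 - x$3*y$6 + x$4*y$0 + x$5*y$7 + x$6*y$3 - x$7*y$5"
  "oct_mult x y $ 5 = x$0*y$5 - x$1*y$6 + x$2*y$3 - x$3*y$2 - x$4*y$7 + x$5*y$0 + x$6*y$1 + x$7*y$4"
  "oct_mult x y $ 6 = x$0*y$6 + x$1*y$5 - x$2*y$7 + x$3*y$4 - x$4*y$3 - x$5*y$1 + x$6*y$0 + x$7*y$2"
  "oct_mult x y $ 7 = x$0*y$7 + x$1*y$3 + x$2*y$6 - x$3*y$1 + x$4*y$5 - x$5*y$4 - x$6*y$2 + x$7*y$0"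
  by (simp_all add: oct_mult_def oct_cross_def sum_index8 axis_def)

lemma oct_mult_basis:
  "oct_mult (cayley_basis i) (cayley_basis j) \<in> integral_cayley"
proof -
  have "\<forall>i j k. cayley_coord (oct_mult (cayley_basis i) (cayley_basis j)) $ k \<in> \<int>"
    unfolding forall_index8
    by (simp add: cayley_coord_def oct_mult_nth cayley_basis_nth)
  then show ?thesis by (intro integral_cayleyI) auto
qed

lemma oct_conj_basis: "oct_conj (cayley_basis i) \<in> integral_cayley"
proof -
  have "\<forall>i k. cayley_coord (oct_conj (cayley_basis i)) $ k \<in> \<int>"
    unfolding forall_index8
    by (simp add: cayley_coord_def oct_conj_def cayley_basis_nth)
  then show ?thesis by (intro integral_cayleyI) auto
qed

lemma cayley_mult_const:
  "oct_mult (cayley_basis i) (cayley_basis j) = cayley_comb (mult_const i j)"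
  unfolding mult_const_def
  by (rule theI') (use oct_mult_basis inj_cayley_comb in \<open>auto simp: integral_cayley_def inj_eq\<close>)

lemma cayley_conj_const: "oct_conj (cayley_basis i) = cayley_comb (conj_const i)"
  unfolding conj_const_def
  by (rule theI') (use oct_conj_basis inj_cayley_comb in \<open>auto simp: integral_cayley_def inj_eq\<close>)


section \<open>The Cayley algebra over a commutative ring\<close>

text \<open>
  An element of \<open>\<CC>(R) = \<oo> \<otimes> R\<close> is the vector of its coordinates with respect to
  \<open>cayley_basis\<close>.  The scalar \<open>r \<in> R\<close> is the vector with coordinate \<open>r\<close> at index \<open>0\<close> and
  \<open>0\<close> elsewhere.  Norm and trace are scalars; they are returned as elements of \<open>R\<close>.
\<close>

type_synonym 'a cayley = "'a ^ 8"

definition cayley_mult :: "'a::comm_ring_1 cayley \<Rightarrow> 'a cayley \<Rightarrow> 'a cayley" where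
  "cayley_mult x y =
     (\<chi> k. \<Sum>i\<in>UNIV. \<Sum>j\<in>UNIV. of_int (mult_const i j $ k) * (x $ i * y $ j))"

definition cayley_conj :: "'a::comm_ring_1 cayley \<Rightarrow> 'a cayley" where
  "cayley_conj x = (\<chi> k. \<Sum>i\<in>UNIV. of_int (conj_const i $ k) * x $ i)"

definition cayley_norm :: "'a::comm_ring_1 cayley \<Rightarrow> 'a" where
  "cayley_norm x = cayley_mult x (cayley_conj x) $ 0"

definition cayley_trace :: "'a::comm_ring_1 cayley \<Rightarrow> 'a" where
  "cayley_trace x = (x + cayley_conj x) $ 0"


section \<open>The exceptional Jordan module and its structure group\<close>

text \<open>
  \<open>(a, b, c, x, y, z)\<close> stands for the matrix with rows
  \<open>(a, x, y)\<close>, \<open>(x', b, z)\<close>, \<open>(y', z', c)\<close>, where \<open>'\<close> denotes conjugation.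
\<close>

type_synonym 'a jordan = "'a \<times> 'a \<times> 'a \<times> 'a cayley \<times> 'a cayley \<times> 'a cayley"

definition jordan_diag :: "'a::comm_ring_1 \<Rightarrow> 'a \<Rightarrow> 'a \<Rightarrow> 'a jordan" where
  "jordan_diag a b c = (a, b, c, 0, 0, 0)"

fun jordan_scale :: "'a::comm_ring_1 \<Rightarrow> 'a jordan \<Rightarrow> 'a jordan" where
  "jordan_scale r (a, b, c, x, y, z) = (r * a, r * b, r * c, r *s x, r *s y, r *s z)"

fun jordan_det :: "'a::comm_ring_1 jordan \<Rightarrow> 'a" where
  "jordan_det (a, b, c, x, y, z) =
     a * b * c - a * cayley_norm z - b * cayley_norm y - c * cayley_norm x
       + cayley_trace (cayley_mult (cayley_mult x z) (cayley_conj y))"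

lemma module_jordan_scale: "Modules.module jordan_scale"
proof
  fix r s :: 'a and X Y :: "'a jordan"
  show "jordan_scale r (X + Y) = jordan_scale r X + jordan_scale r Y"
    by (cases X rule: prod_cases6; cases Y rule: prod_cases6)
      (simp add: vec_eq_iff distrib_left)
  show "jordan_scale (r + s) X = jordan_scale r X + jordan_scale s X"
    by (cases X rule: prod_cases6) (simp add: vec_eq_iff distrib_right)
  show "jordan_scale r (jordan_scale s X) = jordan_scale (r * s) X"
    by (cases X rule: prod_cases6) (simp add: vec_eq_iff mult.assoc)
  show "jordan_scale 1 X = X"
    by (cases X rule: prod_cases6) (simp add: vec_eq_iff)
qed

definition jordan_group :: "('a::comm_ring_1 jordan \<Rightarrow> 'a jordan) set" where
  "jordan_group = {g. Modules.module_hom jordan_scale jordan_scale g \<and> bij g \<and>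
     (\<exists>\<nu>. \<nu> dvd 1 \<and> (\<forall>X. jordan_det (g X) = \<nu> * jordan_det X))}"

fun jordan_of_zp :: "'p::prime_card zp jordan \<Rightarrow> 'p qp jordan" where
  "jordan_of_zp (a, b, c, x, y, z) =
     (qp_of_zp a, qp_of_zp b, qp_of_zp c,
      (\<chi> i. qp_of_zp (x $ i)), (\<chi> i. qp_of_zp (y $ i)), (\<chi> i. qp_of_zp (z $ i)))"


section \<open>Haar measure and local density\<close>

text \<open>
  Haar measures on a second countable locally compact abelian group; the sigma-algebra
  is Borel, so regularity is automatic and is not required separately.
\<close>

definition haar_measure :: "'a::{topological_space, ab_group_add} measure \<Rightarrow> bool" where
  "haar_measure M \<longleftrightarrow>
     sets M = sets borel \<and>
     (\<forall>x. \<forall>A\<in>sets borel. emeasure M ((+) x ` A) = emeasure M A) \<and>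
     (\<forall>K. compact K \<longrightarrow> emeasure M K < \<infinity>) \<and>
     (\<forall>U. open U \<and> U \<noteq> {} \<longrightarrow> emeasure M U > 0)"

definition delta :: "nat \<Rightarrow> real" where
  "delta p = (1 - 1 / real p ^ 2) * (1 - 1 / real p ^ 5) * (1 - 1 / real p ^ 6) *
     (1 - 1 / real p ^ 8) * (1 - 1 / real p ^ 9) * (1 - 1 / real p ^ 12)"

definition beta :: "'p::prime_card qp jordan measure \<Rightarrow> 'p zp jordan \<Rightarrow> real" where
  "beta \<sigma> T = (1 - 1 / real CARD('p)) * delta CARD('p) /
     measure \<sigma> (jordan_of_zp ` {g T | g. g \<in> jordan_group})"

end

theory Submission
  imports Defs
begin

text \<open>
  Every matrix over \<open>\<int>\<^sub>p\<close> of nonzero determinant is equivalent to some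
  \<open>diag(p\<^sup>i, p\<^sup>j, p\<^sup>k)\<close> with \<open>i \<le> j \<le> k\<close>: shears, permutations and one similitude suffice,
  because the norm form of the Cayley algebra is unimodular and represents all of \<open>\<int>\<^sub>p\<close>.
  The exponents are read off from the contents of the matrix and of its adjoint and from the
  valuation of the determinant, so that an orbit is described by congruences.  After scaling,
  \<open>i = 0\<close>, and the volume of the orbit splits over the reduction modulo \<open>p\<close> according to its rank.
  In rank at least \<open>2\<close> the determinant is a submersion, hence equidistributed on a residue class.  In rank \<open>1\<close>
  a Schur complement reduces the question to the 10-dimensional quadratic form \<open>b c - N z\<close>.
  What remains is to count the elements of each rank over \<open>\<bbbF>\<^sub>p\<close>, which rests on the number of
  isotropic Cayley numbers.
\<close>

section \<open>The Cayley algebra\<close>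

text \<open>The structure group enters from two sides: a few explicit elements bring a matrix to
  normal form, while the invariance of the determinant and of its differential separates the normal
  forms. Octonions are not associative, so there is no matrix product to appeal to; each element is
  a formula on entries, and its effect on the determinant follows from the alternative law. To treat
  p = 2 on the same footing, everything is phrased with the norm and its polar form, never with half
  of it. All sets to be measured are unions of residue classes modulo a power of p, so volumes are
  counts, and two volumes are compared by maps in both directions that keep residue classes apart.
  As for the exponents: the first row of a matrix has 17 coordinates and the remaining block 10.
  Near a residue of rank 1 the block is p^j times a primitive one, which costs q^(10 j), and the
  quadratic form then takes a value of valuation k - j, hence 9 j + k; a scalar p^i costs q^(27
  i).\<close>

lemma cayley_coord_comb: "cayley_coord (cayley_comb c) $ k = of_int (c $ k)"
proof -
  have "\<forall>k. cayley_coord (cayley_comb c) $ k = of_int (c $ k)"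
    unfolding forall_index8 by (simp add: cayley_coord_def cayley_comb_nth field_simps)
  then show ?thesis ..
qed

lemma floor_neg_one: "\<lfloor>- 1 :: rat\<rfloor> = - 1"
  by (rule floor_unique) auto

text \<open>The structure constants are given by a definite description. As integers they equal the
  floors of rational coordinates, and in this form the multiplication table can be evaluated by
  rewriting.\<close>

lemma mult_const_nth:
  "mult_const i j $ k = \<lfloor>cayley_coord (oct_mult (cayley_basis i) (cayley_basis j)) $ k\<rfloor>"
  by (simp add: cayley_mult_const cayley_coord_comb)

lemma conj_const_nth: "conj_const i $ k = \<lfloor>cayley_coord (oct_conj (cayley_basis i)) $ k\<rfloor>"
  by (simp add: cayley_conj_const cayley_coord_comb)

text \<open>With the explicit table, identities for Cayley numbers become polynomial identities in
  coordinates, valid over every commutative ring.\<close>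

lemma cayley_mult_nth:
  fixes x y :: "'a::comm_ring_1 cayley"
  shows
  "cayley_mult x y $ 0 = x$0*y$0 - x$1*y$1 + x$1*y$5 - x$1*y$6 - x$2*y$2 + x$2*y$6 - x$2*y$7 - x$3*y$3 - x$3*y$5 + x$3*y$7 - x$4*y$1 - x$4*y$2 - x$4*y$3 - x$4*y$4 - x$5*y$5 - x$6*y$6 - x$7*y$7"
  "cayley_mult x y $ 1 = x$0*y$1 + x$1*y$0 - x$1*y$5 - x$1*y$6 - x$2*y$3 + x$2*y$7 + x$3*y$2 + x$3*y$7 + x$4*y$7 + x$5*y$6 - x$6*y$5 - x$7*y$1 - x$7*y$2 - x$7*y$3 - x$7*y$4"
  "cayley_mult x y $ 2 = x$0*y$2 + x$1*y$3 + x$1*y$5 + x$2*y$0 - x$2*y$6 - x$2*y$7 - x$3*y$1 + x$3*y$5 + x$4*y$5 - x$5*y$1 - x$5*y$2 - x$5*y$3 - x$5*y$4 + x$6*y$7 - x$7*y$6"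
  "cayley_mult x y $ 3 = x$0*y$3 - x$1*y$2 + x$1*y$6 + x$2*y$1 + x$2*y$6 + x$3*y$0 - x$3*y$5 - x$3*y$7 + x$4*y$6 - x$5*y$7 - x$6*y$1 - x$6*y$2 - x$6*y$3 - x$6*y$4 + x$7*y$5"
  "cayley_mult x y $ 4 = x$0*y$4 - x$1*y$7 - x$2*y$5 - x$3*y$6 + x$4*y$0 - x$4*y$5 - x$4*y$6 - x$4*y$7 + x$5*y$2 - x$5*y$6 + x$5*y$7 + x$6*y$3 + x$6*y$5 - x$6*y$7 + x$7*y$1 - x$7*y$5 + x$7*y$6"
  "cayley_mult x y $ 5 = x$0*y$5 - x$1*y$6 + x$2*y$4 + x$3*y$7 - x$4*y$2 + x$5*y$0 - x$5*y$5 + x$6*y$1 - x$6*y$5 - x$7*y$3 - x$7*y$5"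
  "cayley_mult x y $ 6 = x$0*y$6 + x$1*y$5 - x$2*y$7 + x$3*y$4 - x$4*y$3 - x$5*y$1 - x$5*y$6 + x$6*y$0 - x$6*y$6 + x$7*y$2 - x$7*y$6"
  "cayley_mult x y $ 7 = x$0*y$7 + x$1*y$4 + x$2*y$6 - x$3*y$5 - x$4*y$1 + x$5*y$3 - x$5*y$7 - x$6*y$2 - x$6*y$7 + x$7*y$0 - x$7*y$7"
  by (simp_all add: cayley_mult_def sum_index8 mult_const_nth cayley_coord_def oct_mult_nth cayley_basis_nth floor_neg_one)

lemma cayley_conj_nth:
  fixes x :: "'a::comm_ring_1 cayley"
  shows
  "cayley_conj x $ 0 = x$0 - x$5 - x$6 - x$7"
  "cayley_conj x $ 1 = - x$1"
  "cayley_conj x $ 2 = - x$2"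
  "cayley_conj x $ 3 = - x$3"
  "cayley_conj x $ 4 = - x$4"
  "cayley_conj x $ 5 = - x$5"
  "cayley_conj x $ 6 = - x$6"
  "cayley_conj x $ 7 = - x$7"
  by (simp_all add: cayley_conj_def sum_index8 conj_const_nth cayley_coord_def oct_conj_def cayley_basis_nth floor_neg_one)

text \<open>All basis vectors have norm 1 and their mutual inner products are 0, 1 or -1: this is
  the E8 form written in a basis of roots.\<close>

lemma cayley_norm_eq:
  fixes x :: "'a::comm_ring_1 cayley"
  shows "cayley_norm x = x$0*x$0 + x$1*x$1 + x$2*x$2 + x$3*x$3 + x$4*x$4 + x$5*x$5 + x$6*x$6 + x$7*x$7
    + x$1*x$4 + x$2*x$4 + x$3*x$4 + x$3*x$5 - x$3*x$7 + x$1*x$6 - x$1*x$5 + x$2*x$7 - x$2*x$6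
    - x$0*x$5 - x$0*x$6 - x$0*x$7"
  by (simp add: cayley_norm_def cayley_mult_nth cayley_conj_nth algebra_simps)

lemma cayley_trace_eq:
  fixes x :: "'a::comm_ring_1 cayley"
  shows "cayley_trace x = x$0 + (x$0 - x$5 - x$6 - x$7)"
  by (simp add: cayley_trace_def cayley_conj_nth)

lemma cayley_conj_mult:
  fixes x y :: "'a::comm_ring_1 cayley"
  shows "cayley_conj (cayley_mult x y) = cayley_mult (cayley_conj y) (cayley_conj x)"
  by (simp add: vec_eq_iff forall_index8 cayley_mult_nth cayley_conj_nth algebra_simps)

lemma cayley_conj_conj [simp]:
  fixes x :: "'a::comm_ring_1 cayley"
  shows "cayley_conj (cayley_conj x) = x"
  by (simp add: vec_eq_iff forall_index8 cayley_conj_nth)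

lemma cayley_trace_commute:
  fixes x y :: "'a::comm_ring_1 cayley"
  shows "cayley_trace (cayley_mult x y) = cayley_trace (cayley_mult y x)"
  by (simp add: cayley_trace_eq cayley_mult_nth algebra_simps)

text \<open>The alternative law takes the place of associativity. The rules for norms of products,
  for adjoints of multiplications and for the shears come from it by conjugation and
  polarization.\<close>

lemma cayley_mult_conj_right:
  fixes x y :: "'a::comm_ring_1 cayley"
  shows "cayley_mult (cayley_mult x y) (cayley_conj y) = cayley_norm y *s x"
  unfolding vec_eq_iff forall_index8 vector_smult_component cayley_norm_eq cayley_mult_nth cayley_conj_nth
  by (intro conjI; simp add: algebra_simps)

lemma cayley_mult_add_left: "cayley_mult (x + y) z = cayley_mult x z + cayley_mult y z"
  and cayley_mult_add_right: "cayley_mult z (x + y) = cayley_mult z x + cayley_mult z y"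
  and cayley_mult_scale_left: "cayley_mult (r *s x) z = r *s cayley_mult x z"
  and cayley_mult_scale_right: "cayley_mult z (r *s x) = r *s cayley_mult z x"
  by (simp_all add: cayley_mult_def vec_eq_iff algebra_simps sum.distrib sum_distrib_left)

lemma cayley_mult_0 [simp]: "cayley_mult 0 x = 0" "cayley_mult x 0 = 0"
  by (simp_all add: cayley_mult_def vec_eq_iff)

lemma cayley_mult_minus [simp]:
  "cayley_mult (- x) y = - cayley_mult x y" "cayley_mult x (- y) = - cayley_mult x y"
  by (simp_all add: cayley_mult_def vec_eq_iff sum_negf)

lemma cayley_mult_diff_right: "cayley_mult z (x - y) = cayley_mult z x - cayley_mult z y"
  using cayley_mult_add_right[of z x "- y"] by simp

lemma cayley_conj_linear:
  "cayley_conj (x + y) = cayley_conj x + cayley_conj y"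
  "cayley_conj (x - y) = cayley_conj x - cayley_conj y"
  "cayley_conj (r *s x) = r *s cayley_conj x"
  "cayley_conj (- x) = - cayley_conj x"
  by (simp_all add: vec_eq_iff forall_index8 cayley_conj_nth algebra_simps)

lemma cayley_conj_0 [simp]: "cayley_conj 0 = 0"
  by (simp add: cayley_conj_def vec_eq_iff)

lemma cayley_conj_eq_0_iff [simp]: "cayley_conj x = 0 \<longleftrightarrow> x = 0"
  by (metis cayley_conj_conj cayley_conj_0)

lemma cayley_norm_conj [simp]: "cayley_norm (cayley_conj x) = cayley_norm x"
  by (simp add: cayley_norm_eq cayley_conj_nth algebra_simps)

lemma cayley_norm_0 [simp]: "cayley_norm 0 = 0"
  by (simp add: cayley_norm_eq)

lemma cayley_norm_scale: "cayley_norm (r *s x) = r ^ 2 * cayley_norm x"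
  by (simp add: cayley_norm_eq algebra_simps power2_eq_square)

lemma cayley_norm_minus [simp]: "cayley_norm (- x) = cayley_norm x"
  by (simp add: cayley_norm_eq)

lemma cayley_trace_linear:
  "cayley_trace (x + y) = cayley_trace x + cayley_trace y"
  "cayley_trace (r *s x) = r * cayley_trace x"
  by (simp_all add: cayley_trace_eq algebra_simps)

lemma cayley_mult_one_right [simp]: "cayley_mult x (axis 0 1) = x"
  by (simp add: vec_eq_iff forall_index8 cayley_mult_nth axis_def)

lemma cayley_conj_eq: "cayley_conj x = cayley_trace x *s axis 0 1 - x"
  by (simp add: vec_eq_iff forall_index8 cayley_conj_nth cayley_trace_eq axis_def)

text \<open>This is the polar form N(x + y) - N(x) - N(y), without a factor 1/2, so that it stays
  nondegenerate for p = 2.\<close>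

definition cayley_inner :: "'a::comm_ring_1 cayley \<Rightarrow> 'a cayley \<Rightarrow> 'a" where
  "cayley_inner x y = cayley_trace (cayley_mult x (cayley_conj y))"

lemma cayley_inner_eq:
  fixes x y :: "'a::comm_ring_1 cayley"
  shows "cayley_inner x y =
    x$0 * (2*y$0 - y$5 - y$6 - y$7) + x$1 * (2*y$1 + y$4 - y$5 + y$6) + x$2 * (2*y$2 + y$4 - y$6 + y$7)
    + x$3 * (2*y$3 + y$4 + y$5 - y$7) + x$4 * (2*y$4 + y$1 + y$2 + y$3) + x$5 * (2*y$5 - y$0 - y$1 + y$3)
    + x$6 * (2*y$6 - y$0 + y$1 - y$2) + x$7 * (2*y$7 - y$0 + y$2 - y$3)"
  by (simp add: cayley_inner_def cayley_trace_eq cayley_mult_nth cayley_conj_nth algebra_simps)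

lemma cayley_inner_linear:
  "cayley_inner (x + y) z = cayley_inner x z + cayley_inner y z"
  "cayley_inner z (x + y) = cayley_inner z x + cayley_inner z y"
  "cayley_inner (x - y) z = cayley_inner x z - cayley_inner y z"
  "cayley_inner z (x - y) = cayley_inner z x - cayley_inner z y"
  "cayley_inner (r *s x) z = r * cayley_inner x z"
  "cayley_inner z (r *s x) = r * cayley_inner z x"
  "cayley_inner (- x) z = - cayley_inner x z"
  "cayley_inner z (- x) = - cayley_inner z x"
  by (simp_all add: cayley_inner_eq algebra_simps)

lemma cayley_inner_0 [simp]: "cayley_inner 0 x = 0" "cayley_inner x 0 = 0"
  by (simp_all add: cayley_inner_eq)

lemma cayley_inner_commute: "cayley_inner x y = cayley_inner y x"
  by (simp add: cayley_inner_eq algebra_simps)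

lemma cayley_inner_self: "cayley_inner x x = 2 * cayley_norm x"
  by (simp add: cayley_inner_eq cayley_norm_eq algebra_simps)

lemma cayley_norm_add: "cayley_norm (x + y) = cayley_norm x + cayley_inner x y + cayley_norm y"
  by (simp add: cayley_inner_eq cayley_norm_eq algebra_simps)

lemma cayley_inner_conj: "cayley_inner (cayley_conj x) (cayley_conj y) = cayley_inner x y"
  by (simp add: cayley_inner_eq cayley_conj_nth algebra_simps)

lemma cayley_mult_conj_right': "cayley_mult (cayley_mult x (cayley_conj y)) y = cayley_norm y *s x"
  using cayley_mult_conj_right[of x "cayley_conj y"] by simp

lemma cayley_mult_conj_left: "cayley_mult x (cayley_mult (cayley_conj x) y) = cayley_norm x *s y"
proof -
  have "cayley_conj (cayley_mult x (cayley_mult (cayley_conj x) y)) = cayley_conj (cayley_norm x *s y)"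
    by (simp add: cayley_conj_mult cayley_mult_conj_right cayley_conj_linear)
  then show ?thesis by (metis cayley_conj_conj)
qed

lemma cayley_mult_conj_left': "cayley_mult (cayley_conj x) (cayley_mult x y) = cayley_norm x *s y"
  using cayley_mult_conj_left[of "cayley_conj x" y] by simp

text \<open>Put w = x y and write ' for conjugation. Then w' (w y') is N(w) y' on the one hand, and
  on the other w y' reduces to N(y) x, which leads to N(x) N(y) y'. A nonzero coordinate of y' is
  cancelled, which is where the absence of zero divisors enters.\<close>

lemma cayley_norm_mult:
  fixes x y :: "'a::idom cayley"
  shows "cayley_norm (cayley_mult x y) = cayley_norm x * cayley_norm y"
proof (cases "y = 0")
  case False
  let ?w = "cayley_mult x y"
  have "cayley_norm ?w *s cayley_conj y = cayley_mult (cayley_conj ?w) (cayley_mult ?w (cayley_conj y))"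
    by (rule cayley_mult_conj_left'[symmetric])
  also have "\<dots> = (cayley_norm x * cayley_norm y) *s cayley_conj y"
    by (simp add: cayley_mult_conj_right cayley_mult_scale_right cayley_conj_mult cayley_mult_conj_right'
        vector_smult_assoc mult.commute)
  finally have "\<forall>i. cayley_norm ?w * cayley_conj y $ i = (cayley_norm x * cayley_norm y) * cayley_conj y $ i"
    by (metis vector_smult_component)
  moreover obtain i where "cayley_conj y $ i \<noteq> 0" using False by (metis cayley_conj_eq_0_iff vec_eq_iff zero_index)
  ultimately show ?thesis by (metis mult_right_cancel)
qed simp

lemma cayley_mult_conj_left_polar:
  "cayley_mult (cayley_conj x) (cayley_mult z y) + cayley_mult (cayley_conj z) (cayley_mult x y) = cayley_inner x z *s y"
proof -
  have "cayley_mult (cayley_conj (x + z)) (cayley_mult (x + z) y) = cayley_norm (x + z) *s y"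
    by (rule cayley_mult_conj_left')
  then show ?thesis
    by (simp add: cayley_conj_linear cayley_mult_add_left cayley_mult_add_right cayley_mult_conj_left'
        cayley_norm_add vector_sadd_rdistrib algebra_simps)
qed

text \<open>The trace of the polarized alternative law shows that the adjoint of right
  multiplication by y is right multiplication by Tr(y) - y, which is the conjugate of y.\<close>

lemma cayley_inner_mult_right: "cayley_inner (cayley_mult x y) z = cayley_inner x (cayley_mult z (cayley_conj y))"
proof -
  have "cayley_trace (cayley_mult (cayley_conj u) v) = cayley_inner v u" for u v :: "'a cayley"
    unfolding cayley_inner_def by (rule cayley_trace_commute)
  then have "cayley_inner (cayley_mult z y) x + cayley_inner (cayley_mult x y) z = cayley_inner x z * cayley_trace y"
    using arg_cong[OF cayley_mult_conj_left_polar[of x z y], of cayley_trace]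
    by (simp add: cayley_trace_linear)
  moreover have "cayley_inner (cayley_mult z y) x + cayley_inner x (cayley_mult z (cayley_conj y))
      = cayley_inner x z * cayley_trace y"
    by (simp add: cayley_conj_eq[of y] cayley_mult_diff_right cayley_mult_scale_right cayley_inner_linear
        cayley_inner_commute[of x "cayley_mult z y"])
  ultimately show ?thesis by (metis add_left_cancel)
qed

lemma cayley_inner_mult_left: "cayley_inner (cayley_mult x y) z = cayley_inner y (cayley_mult (cayley_conj x) z)"
proof -
  have "cayley_inner (cayley_mult x y) z = cayley_inner (cayley_mult (cayley_conj y) (cayley_conj x)) (cayley_conj z)"
    by (simp flip: cayley_conj_mult add: cayley_inner_conj)
  also have "\<dots> = cayley_inner (cayley_conj y) (cayley_conj (cayley_mult (cayley_conj x) z))"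
    by (simp add: cayley_inner_mult_right cayley_conj_mult)
  finally show ?thesis by (simp add: cayley_inner_conj)
qed

text \<open>The lattice is unimodular: it is isometric to \<open>E\<^sub>8\<close>. The witness is the dual basis.\<close>

lemma cayley_dual_basis:
  "\<exists>d :: 'a::comm_ring_1 cayley. \<forall>x. cayley_inner x d = x $ i"
proof -
  have w: "\<exists>d :: 'a cayley. \<forall>x. cayley_inner x d = f x" if "\<forall>x. cayley_inner x d = f x" for d and f :: "'a cayley \<Rightarrow> 'a"
    using that by blast
  have "\<forall>i. \<exists>d :: 'a cayley. \<forall>x. cayley_inner x d = x $ i"
    unfolding forall_index8
    apply (intro conjI)
    apply (rule w[of "2 *s axis 0 1 + axis 5 1 + axis 6 1 + axis 7 1"], simp add: cayley_inner_eq axis_def algebra_simps)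
    apply (rule w[of "2 *s axis 1 1 - axis 4 1 + axis 5 1 - axis 6 1"], simp add: cayley_inner_eq axis_def algebra_simps)
    apply (rule w[of "2 *s axis 2 1 - axis 4 1 + axis 6 1 - axis 7 1"], simp add: cayley_inner_eq axis_def algebra_simps)
    apply (rule w[of "2 *s axis 3 1 - axis 4 1 - axis 5 1 + axis 7 1"], simp add: cayley_inner_eq axis_def algebra_simps)
    apply (rule w[of "2 *s axis 4 1 - axis 1 1 - axis 2 1 - axis 3 1"], simp add: cayley_inner_eq axis_def algebra_simps)
    apply (rule w[of "2 *s axis 5 1 + axis 0 1 + axis 1 1 - axis 3 1"], simp add: cayley_inner_eq axis_def algebra_simps)
    apply (rule w[of "2 *s axis 6 1 + axis 0 1 - axis 1 1 + axis 2 1"], simp add: cayley_inner_eq axis_def algebra_simps)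
    apply (rule w[of "2 *s axis 7 1 + axis 0 1 - axis 2 1 + axis 3 1"], simp add: cayley_inner_eq axis_def algebra_simps)
    done
  then show ?thesis ..
qed

section \<open>The structure group\<close>

lemma jordan_groupI:
  fixes g h :: "'a::comm_ring_1 jordan \<Rightarrow> 'a jordan"
  assumes "\<And>X Y. g (X + Y) = g X + g Y" "\<And>r X. g (jordan_scale r X) = jordan_scale r (g X)"
    and "\<And>X. h (g X) = X" "\<And>X. g (h X) = X"
    and "\<nu> dvd 1" "\<And>X. jordan_det (g X) = \<nu> * jordan_det X"
  shows "g \<in> jordan_group"
proof -
  have "Modules.module_hom jordan_scale jordan_scale g"
    by (intro module_hom.intro module_hom_axioms.intro assms module_jordan_scale)
  moreover have "bij g" by (rule bij_betw_byWitness[where f' = h]) (use assms in auto)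
  ultimately show ?thesis unfolding jordan_group_def using assms by blast
qed

lemma jordan_groupD:
  assumes "g \<in> jordan_group"
  shows "g (X + Y) = g X + g Y" "g (jordan_scale r X) = jordan_scale r (g X)" "g 0 = 0"
    "g (X - Y) = g X - g Y" "bij g"
    "\<exists>\<nu>. \<nu> dvd 1 \<and> (\<forall>X. jordan_det (g X) = \<nu> * jordan_det X)"
proof -
  interpret module_hom jordan_scale jordan_scale g
    using assms by (simp add: jordan_group_def)
  show "g (X + Y) = g X + g Y" "g (jordan_scale r X) = jordan_scale r (g X)" "g 0 = 0"
    "g (X - Y) = g X - g Y"
    by (rule add scale zero diff)+
  show "bij g" "\<exists>\<nu>. \<nu> dvd 1 \<and> (\<forall>X. jordan_det (g X) = \<nu> * jordan_det X)"
    using assms by (auto simp: jordan_group_def)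
qed

lemma id_jordan_group: "id \<in> jordan_group"
  by (rule jordan_groupI[where h = id and \<nu> = 1]) auto

lemma comp_jordan_group:
  assumes g: "g \<in> jordan_group" and h: "h \<in> jordan_group"
  shows "g \<circ> h \<in> jordan_group"
proof -
  obtain \<nu> \<mu> where \<nu>: "\<nu> dvd 1" "\<And>X. jordan_det (g X) = \<nu> * jordan_det X"
    and \<mu>: "\<mu> dvd 1" "\<And>X. jordan_det (h X) = \<mu> * jordan_det X"
    using jordan_groupD(6)[OF g] jordan_groupD(6)[OF h] by blast
  have b: "bij (g \<circ> h)" by (rule bij_comp[OF jordan_groupD(5)[OF h] jordan_groupD(5)[OF g]])
  show ?thesis
  proof (rule jordan_groupI[where h = "inv_into UNIV (g \<circ> h)" and \<nu> = "\<nu> * \<mu>"])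
    show "inv_into UNIV (g \<circ> h) ((g \<circ> h) X) = X" for X
      by (rule inv_f_f[OF bij_is_inj[OF b]])
    show "(g \<circ> h) (inv_into UNIV (g \<circ> h) X) = X" for X
      by (rule surj_f_inv_f[OF bij_is_surj[OF b]])
    show "\<nu> * \<mu> dvd 1" using \<nu>(1) \<mu>(1) by (simp add: is_unit_mult_iff)
  qed (simp_all add: jordan_groupD(1,2)[OF g] jordan_groupD(1,2)[OF h] \<nu>(2) \<mu>(2) mult.assoc)
qed

lemma inv_jordan_group:
  assumes g: "g \<in> jordan_group"
  shows "inv_into UNIV g \<in> jordan_group"
proof -
  obtain \<nu> where \<nu>: "\<nu> dvd 1" "\<And>X. jordan_det (g X) = \<nu> * jordan_det X"
    using jordan_groupD(6)[OF g] by blast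
  then obtain \<nu>' where \<nu>': "\<nu>' * \<nu> = 1" by (metis dvd_def mult.commute)
  have b: "bij g" using g by (rule jordan_groupD)
  then have i: "inv_into UNIV g (g X) = X" "g (inv_into UNIV g X) = X" for X
    by (simp_all add: bij_is_inj bij_is_surj surj_f_inv_f)
  show ?thesis
  proof (rule jordan_groupI[where h = g and \<nu> = \<nu>'])
    show "inv_into UNIV g (X + Y) = inv_into UNIV g X + inv_into UNIV g Y" for X Y
      by (metis i jordan_groupD(1)[OF g])
    show "inv_into UNIV g (jordan_scale r X) = jordan_scale r (inv_into UNIV g X)" for r X
      by (metis i jordan_groupD(2)[OF g])
    show "\<nu>' dvd 1" using \<nu>' by (metis dvd_triv_left)
    show "jordan_det (inv_into UNIV g X) = \<nu>' * jordan_det X" for X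
      using \<nu>(2)[of "inv_into UNIV g X"] \<nu>' i by (simp add: mult.assoc[symmetric])
  qed (use i in auto)
qed

section \<open>Equivalence of matrices and explicit group elements\<close>

definition jordan_equiv :: "'a::comm_ring_1 jordan \<Rightarrow> 'a jordan \<Rightarrow> bool" (infix "\<sim>\<^sub>J" 50) where
  "X \<sim>\<^sub>J Y \<longleftrightarrow> (\<exists>g\<in>jordan_group. g X = Y)"

lemma jordan_equiv_refl [simp]: "X \<sim>\<^sub>J X"
  unfolding jordan_equiv_def by (rule bexI[OF _ id_jordan_group]) simp

lemma jordan_equiv_sym: "X \<sim>\<^sub>J Y \<Longrightarrow> Y \<sim>\<^sub>J X"
  unfolding jordan_equiv_def
  using inv_jordan_group jordan_groupD(5) by (metis bij_betw_imp_inj_on inv_f_f)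

lemma jordan_equiv_trans [trans]: "X \<sim>\<^sub>J Y \<Longrightarrow> Y \<sim>\<^sub>J Z \<Longrightarrow> X \<sim>\<^sub>J Z"
  unfolding jordan_equiv_def using comp_jordan_group by (metis comp_apply)

text \<open>In an associative setting this is X going to U' X U, where U is the identity plus u at
  position (1, 2) and U' its conjugate transpose. Here the resulting entries serve as the
  definition.\<close>

fun jordan_shear :: "'a::comm_ring_1 cayley \<Rightarrow> 'a jordan \<Rightarrow> 'a jordan" where
  "jordan_shear u (a, b, c, x, y, z) =
     (a, b + cayley_inner x u + a * cayley_norm u, c, x + a *s u, y, z + cayley_mult (cayley_conj u) y)"

fun jordan_swap12 :: "'a::comm_ring_1 jordan \<Rightarrow> 'a jordan" where
  "jordan_swap12 (a, b, c, x, y, z) = (b, a, c, cayley_conj x, z, y)"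

fun jordan_swap23 :: "'a::comm_ring_1 jordan \<Rightarrow> 'a jordan" where
  "jordan_swap23 (a, b, c, x, y, z) = (a, c, b, y, x, cayley_conj z)"

text \<open>Formally this is D X D for D = diag(r, r, 1/r) with r^2 = s, when s t = 1; the formula
  makes sense without a square root of s. Of the explicit group elements it is the one whose
  multiplier can differ from 1.\<close>

fun jordan_similitude :: "'a::comm_ring_1 \<Rightarrow> 'a \<Rightarrow> 'a jordan \<Rightarrow> 'a jordan" where
  "jordan_similitude s t (a, b, c, x, y, z) = (s * a, s * b, t * c, s *s x, y, z)"

lemma jordan_det_eq:
  "jordan_det (a, b, c, x, y, z) =
     a * b * c - a * cayley_norm z - b * cayley_norm y - c * cayley_norm x + cayley_inner (cayley_mult x z) y"
  by (simp add: cayley_inner_def)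

text \<open>Adjointness moves one factor to the other side of the inner product, where the
  alternative law turns a double product into a norm. Once the mixed terms have collapsed in this
  way, a commutative polynomial identity remains.\<close>

lemma jordan_det_shear:
  fixes X :: "'a::idom jordan"
  shows "jordan_det (jordan_shear u X) = jordan_det X"
proof -
  obtain a b c x y z where X: "X = (a, b, c, x, y, z)" by (cases X)
  let ?w = "cayley_mult (cayley_conj u) y"
  have 1: "cayley_inner (cayley_mult x ?w) y = cayley_norm y * cayley_inner x u"
    by (simp add: cayley_inner_mult_right[of x] cayley_conj_mult cayley_mult_conj_left cayley_inner_linear)
  have 2: "cayley_inner (cayley_mult u z) y = cayley_inner z ?w"
    by (simp add: cayley_inner_mult_left)
  have 3: "cayley_inner (cayley_mult u ?w) y = cayley_norm u * (2 * cayley_norm y)"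
    by (simp add: cayley_mult_conj_left cayley_inner_linear cayley_inner_self)
  have 4: "cayley_norm (x + a *s u) = cayley_norm x + a * cayley_inner x u + a ^ 2 * cayley_norm u"
    by (simp add: cayley_norm_add cayley_norm_scale cayley_inner_linear)
  have 5: "cayley_norm (z + ?w) = cayley_norm z + cayley_inner z ?w + cayley_norm u * cayley_norm y"
    by (simp add: cayley_norm_add cayley_norm_mult)
  have 6: "cayley_inner (cayley_mult (x + a *s u) (z + ?w)) y
      = cayley_inner (cayley_mult x z) y + cayley_norm y * cayley_inner x u + a * cayley_inner z ?w
        + a * (cayley_norm u * (2 * cayley_norm y))"
    by (simp only: cayley_mult_add_left cayley_mult_add_right cayley_mult_scale_left
        cayley_inner_linear 1 2 3) (simp add: algebra_simps)
  show ?thesis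
    unfolding X jordan_shear.simps jordan_det_eq 4 5 6 by (simp add: algebra_simps power2_eq_square)
qed

lemma jordan_shear_group:
  fixes u :: "'a::idom cayley"
  shows "jordan_shear u \<in> jordan_group"
proof (rule jordan_groupI[where h = "jordan_shear (- u)" and \<nu> = 1])
  show "jordan_shear u (X + Y) = jordan_shear u X + jordan_shear u Y" for X Y
    by (cases X; cases Y)
      (simp add: cayley_inner_linear cayley_mult_add_right algebra_simps vec_eq_iff)
  show "jordan_shear u (jordan_scale r X) = jordan_scale r (jordan_shear u X)" for r X
    by (cases X)
      (simp add: cayley_inner_linear cayley_mult_scale_right algebra_simps vec_eq_iff)
  have *: "jordan_shear (- v) (jordan_shear v X) = X" for v and X :: "'a jordan"
    by (cases X) (simp add: cayley_inner_linear cayley_inner_self cayley_conj_linear algebra_simps vec_eq_iff)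
  show "jordan_shear (- u) (jordan_shear u X) = X" for X by (rule *)
  show "jordan_shear u (jordan_shear (- u) X) = X" for X using *[of "- u" X] by simp
qed (simp_all add: jordan_det_shear)

lemma jordan_swap12_group: "jordan_swap12 \<in> jordan_group"
proof (rule jordan_groupI[where h = jordan_swap12 and \<nu> = 1])
  fix X :: "'a jordan"
  obtain a b c x y z where X: "X = (a, b, c, x, y, z)" by (cases X)
  show "jordan_det (jordan_swap12 X) = 1 * jordan_det X"
    using cayley_inner_mult_left[of "cayley_conj x" y z] cayley_inner_commute[of y "cayley_mult x z"]
    by (simp add: X jordan_det_eq algebra_simps del: jordan_det.simps)
qed (auto simp: cayley_conj_linear)

lemma jordan_swap23_group: "jordan_swap23 \<in> jordan_group"
proof (rule jordan_groupI[where h = jordan_swap23 and \<nu> = 1])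
  fix X :: "'a jordan"
  obtain a b c x y z where X: "X = (a, b, c, x, y, z)" by (cases X)
  show "jordan_det (jordan_swap23 X) = 1 * jordan_det X"
    using cayley_inner_mult_right[of y "cayley_conj z" x] cayley_inner_commute[of y "cayley_mult x z"]
    by (simp add: X jordan_det_eq algebra_simps del: jordan_det.simps)
qed (auto simp: cayley_conj_linear)

lemma jordan_similitude_group:
  assumes "s * t = 1"
  shows "jordan_similitude s t \<in> jordan_group"
proof (rule jordan_groupI[where h = "jordan_similitude t s" and \<nu> = s])
  have ts: "t * s = 1" using assms by (simp add: mult.commute)
  have *: "s * (t * w) = w" "t * (s * w) = w" for w using assms ts by (simp_all flip: mult.assoc)
  show "jordan_similitude t s (jordan_similitude s t X) = X" for X
    by (cases X) (simp add: vec_eq_iff ts assms flip: mult.assoc)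
  show "jordan_similitude s t (jordan_similitude t s X) = X" for X
    by (cases X) (simp add: * vec_eq_iff ts assms flip: mult.assoc)
  show "jordan_similitude s t (X + Y) = jordan_similitude s t X + jordan_similitude s t Y" for X Y
    by (cases X; cases Y) (simp add: vec_eq_iff algebra_simps)
  show "jordan_similitude s t (jordan_scale r X) = jordan_scale r (jordan_similitude s t X)" for r X
    by (cases X) (simp add: vec_eq_iff algebra_simps)
  show "s dvd 1" using assms by (metis dvd_triv_left)
  have **: "s * (s * t) = s" using assms by simp
  show "jordan_det (jordan_similitude s t X) = s * jordan_det X" for X
    by (cases X) (simp add: jordan_det_eq * ** cayley_norm_scale cayley_mult_scale_left cayley_inner_linear
        algebra_simps power2_eq_square del: jordan_det.simps)
qed

lemma jordan_equiv_moves: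
  fixes X :: "'a::idom jordan"
  shows "X \<sim>\<^sub>J jordan_shear u X" "X \<sim>\<^sub>J jordan_swap12 X" "X \<sim>\<^sub>J jordan_swap23 X"
  "s * t = 1 \<Longrightarrow> X \<sim>\<^sub>J jordan_similitude s t X"
  unfolding jordan_equiv_def
  using jordan_shear_group jordan_swap12_group jordan_swap23_group jordan_similitude_group by blast+

section \<open>Arithmetic of the \<open>p\<close>-adic integers\<close>

abbreviation zp_prime :: "'p::prime_card zp" ("\<pi>") where
  "\<pi> \<equiv> of_nat CARD('p)"

lemma prime_card_int: "prime (int CARD('p::prime_card))"
  using prime_card[where 'a = 'p] by simp

lemma card_gt_1: "int CARD('p::prime_card) > 1"
  using prime_gt_1_int[OF prime_card_int[where 'p = 'p]] .

lemma Rep_zp_of_nat: "Rep_zp (of_nat k :: 'p::prime_card zp) n = int k mod int CARD('p) ^ n"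
  by (induction k) (simp_all add: zero_zp.rep_eq one_zp.rep_eq plus_zp.rep_eq mod_simps add.commute)

lemma Rep_zp_of_int: "Rep_zp (of_int k :: 'p::prime_card zp) n = k mod int CARD('p) ^ n"
  by (cases k rule: int_cases2) (simp_all add: Rep_zp_of_nat uminus_zp.rep_eq mod_simps)

lemma Rep_zp_bounds: "0 \<le> Rep_zp (x :: 'p::prime_card zp) n" "Rep_zp x n < int CARD('p) ^ n"
proof -
  have "int CARD('p) ^ n > 0" using card_gt_1[where 'p = 'p] by simp
  then show "0 \<le> Rep_zp x n" "Rep_zp x n < int CARD('p) ^ n"
    using pos_mod_sign[of "int CARD('p) ^ n" "Rep_zp x n"] pos_mod_bound[of "int CARD('p) ^ n" "Rep_zp x n"]
    by simp_all
qed

lemma zp_dvd_iff: "\<pi> ^ n dvd (x :: 'p::prime_card zp) \<longleftrightarrow> Rep_zp x n = 0"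
proof
  assume "\<pi> ^ n dvd x"
  then obtain y where x: "x = of_nat (CARD('p) ^ n) * y" by (auto simp: dvd_def)
  show "Rep_zp x n = 0" unfolding x times_zp.rep_eq Rep_zp_of_nat by simp
next
  let ?p = "int CARD('p)"
  assume x: "Rep_zp x n = 0"
  have dv: "?p ^ n dvd Rep_zp x (m + n)" for m
    using Rep_zp_mod[of n "m + n" x] x by (simp add: dvd_eq_mod_eq_0)
  \<comment> \<open>The residue of x / p^n modulo p^m is visible only in x modulo p^(m + n), hence
    the shifted index.\<close>
  define f where "f m = Rep_zp x (m + n) div ?p ^ n" for m
  have fm: "?p ^ n * f m = Rep_zp x (m + n)" for m
    using dv[of m] by (simp add: f_def)
  have p0: "?p ^ n > 0" using card_gt_1[where 'p = 'p] by simp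
  have "f m = f (Suc m) mod ?p ^ m" for m
  proof -
    have "?p ^ n * f m = (?p ^ n * f (Suc m)) mod ?p ^ (m + n)"
      unfolding fm using Rep_zp_step[of x "m + n"] by simp
    also have "\<dots> = ?p ^ n * (f (Suc m) mod ?p ^ m)"
      unfolding mult_mod_right power_add mult.commute[of "?p ^ m" "?p ^ n"] ..
    finally show ?thesis using p0 by simp
  qed
  then have Rep: "Rep_zp (Abs_zp f :: 'p zp) = f" by (intro Abs_zp_inverse) blast
  have "x = of_nat (CARD('p) ^ n) * Abs_zp f"
  proof (rule zp_eqI)
    fix m
    have "Rep_zp (of_nat (CARD('p) ^ n) * Abs_zp f :: 'p zp) m = ?p ^ n * f m mod ?p ^ m"
      by (simp add: times_zp.rep_eq Rep_zp_of_nat Rep mod_simps del: of_nat_power) simp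
    also have "\<dots> = Rep_zp x m" unfolding fm by (rule Rep_zp_mod) simp
    finally show "Rep_zp x m = Rep_zp (of_nat (CARD('p) ^ n) * Abs_zp f :: 'p zp) m" by simp
  qed
  then show "\<pi> ^ n dvd x" by simp
qed

lemma zp_eq_0I: "(\<And>n. \<pi> ^ n dvd (x :: 'p::prime_card zp)) \<Longrightarrow> x = 0"
  by (rule zp_eqI) (simp add: zp_dvd_iff zero_zp.rep_eq)

lemma zp_prime_nonzero [simp]: "(\<pi> :: 'p::prime_card zp) \<noteq> 0"
proof
  assume "(\<pi> :: 'p zp) = 0"
  \<comment> \<open>Modulo p the element \<open>\<pi>\<close> is zero, so the second level is the
    first one that detects it.\<close>
  then have "Rep_zp (\<pi> :: 'p zp) 2 = 0" by (simp add: zero_zp.rep_eq)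
  then have "int CARD('p) * int CARD('p) dvd int CARD('p) * 1"
    by (simp add: Rep_zp_of_nat dvd_eq_mod_eq_0 power2_eq_square)
  then have "int CARD('p) dvd 1" by (subst (asm) dvd_mult_cancel_left) auto
  then show False using prime_card_int[where 'p = 'p] not_prime_unit by blast
qed

text \<open>The residues of s n modulo p^n, taken along the diagonal, are compatible with each
  other; the p-adic integer they define is the limit.\<close>

lemma zp_complete:
  fixes s :: "nat \<Rightarrow> 'p::prime_card zp"
  assumes "\<And>n. \<pi> ^ n dvd s (Suc n) - s n"
  obtains x where "\<And>n. \<pi> ^ n dvd x - s n"
proof -
  let ?p = "int CARD('p)"
  define f where "f n = Rep_zp (s n) n" for n
  have eq: "Rep_zp a n = Rep_zp b n" if "\<pi> ^ n dvd a - b" for a b :: "'p zp" and n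
  proof -
    have "(Rep_zp a n - Rep_zp b n) mod ?p ^ n = 0" using that by (simp add: zp_dvd_iff minus_zp.rep_eq)
    then have "Rep_zp a n mod ?p ^ n = Rep_zp b n mod ?p ^ n"
      unfolding mod_eq_dvd_iff dvd_eq_mod_eq_0 .
    then show ?thesis by simp
  qed
  have "f n = f (Suc n) mod ?p ^ n" for n
    unfolding f_def Rep_zp_step by (rule eq[symmetric]) (rule assms)
  then have "Rep_zp (Abs_zp f :: 'p zp) = f" by (intro Abs_zp_inverse) blast
  then have "\<pi> ^ n dvd Abs_zp f - s n" for n
    by (simp add: zp_dvd_iff minus_zp.rep_eq f_def)
  then show thesis by (rule that)
qed

lemma zp_inverse_exists:
  fixes x :: "'p::prime_card zp"
  assumes "\<not> \<pi> dvd x"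
  obtains y where "x * y = 1"
proof -
  let ?p = "int CARD('p)"
  have "Rep_zp x 1 \<noteq> 0" using assms zp_dvd_iff[of 1 x] by simp
  then have "\<not> ?p dvd Rep_zp x 1"
    using Rep_zp_bounds[of x 1] by (auto dest!: zdvd_imp_le)
  then have "coprime (Rep_zp x 1) ?p"
    by (metis prime_card_int coprime_commute prime_imp_coprime)
  then obtain k where k: "[Rep_zp x 1 * k = 1] (mod ?p)"
    by (metis coprime_iff_invertible_int)
  have "Rep_zp (1 - x * of_int k) 1 = (1 - Rep_zp x 1 * k) mod ?p"
    by (simp add: minus_zp.rep_eq one_zp.rep_eq times_zp.rep_eq Rep_zp_of_int mod_simps)
  also have "\<dots> = 0" using k by (simp add: cong_iff_dvd_diff dvd_diff_commute flip: dvd_eq_mod_eq_0)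
  finally have k': "\<pi> dvd 1 - x * of_int k" using zp_dvd_iff[of 1 "1 - x * of_int k"] by (simp only: power_one_right)
  \<comment> \<open>Newton's iteration for the reciprocal of x. The error 1 - x y is squared at each
    step, so an inverse modulo p gains at least one power of p every time.\<close>
  define s where "s = rec_nat (of_int k) (\<lambda>_ y. y * (2 - x * y))"
  have s_simps: "s 0 = of_int k" "s (Suc n) = s n * (2 - x * s n)" for n
    by (simp_all add: s_def)
  have s: "\<pi> ^ Suc n dvd 1 - x * s n" for n
  proof (induction n)
    case 0 then show ?case using k' by (simp add: s_simps)
  next
    case (Suc n)
    have "1 - x * s (Suc n) = (1 - x * s n) * (1 - x * s n)"
      by (simp add: s_simps algebra_simps)
    moreover have "\<pi> dvd 1 - x * s n" using Suc.IH by (rule dvd_trans[rotated]) simp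
    ultimately show ?case using mult_dvd_mono[OF _ Suc.IH] by simp
  qed
  have "\<pi> ^ n dvd s (Suc n) - s n" for n
  proof -
    have "s (Suc n) - s n = s n * (1 - x * s n)" by (simp add: s_simps algebra_simps)
    moreover have "\<pi> ^ n dvd 1 - x * s n" using s[of n] by (rule dvd_trans[rotated]) simp
    ultimately show ?thesis by simp
  qed
  then obtain y where y: "\<And>n. \<pi> ^ n dvd y - s n" using zp_complete[of s] by blast
  have "\<pi> ^ n dvd 1 - x * y" for n
  proof -
    have eq: "1 - x * y = (1 - x * s n) - x * (y - s n)" by (simp add: algebra_simps)
    have "\<pi> ^ n dvd 1 - x * s n" using s[of n] by (rule dvd_trans[rotated]) simp
    then show ?thesis unfolding eq by (rule dvd_diff[OF _ dvd_mult[OF y]])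
  qed
  then have "1 - x * y = 0" by (rule zp_eq_0I)
  then show thesis using that by simp
qed

lemma zp_prime_not_unit: "\<not> (\<pi> :: 'p::prime_card zp) dvd 1"
  using zp_dvd_iff[of 1 "1 :: 'p zp"] card_gt_1[where 'p = 'p] by (simp add: one_zp.rep_eq)

lemma zp_unit_iff: "(x :: 'p::prime_card zp) dvd 1 \<longleftrightarrow> \<not> \<pi> dvd x"
proof
  assume "x dvd 1"
  then show "\<not> \<pi> dvd x" using zp_prime_not_unit dvd_trans by blast
next
  assume "\<not> \<pi> dvd x"
  then obtain y where "x * y = 1" by (rule zp_inverse_exists)
  then show "x dvd 1" by (metis dvd_triv_left)
qed

lemma zp_prime_dvd_mult_iff: "\<pi> dvd x * y \<longleftrightarrow> \<pi> dvd x \<or> \<pi> dvd (y :: 'p::prime_card zp)"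
  using zp_unit_iff[of "x * y"] zp_unit_iff[of x] zp_unit_iff[of y] is_unit_mult_iff[of x y] by blast

lemma zp_unit_decomp:
  fixes x :: "'p::prime_card zp"
  assumes "x \<noteq> 0"
  obtains k u where "x = \<pi> ^ k * u" "\<not> \<pi> dvd u"
proof -
  have "\<exists>n. \<not> \<pi> ^ n dvd x" using assms zp_eq_0I by blast
  then obtain n where n: "\<not> \<pi> ^ Suc n dvd x" "\<pi> ^ n dvd x"
    using exists_least_lemma[of "\<lambda>n. \<not> \<pi> ^ n dvd x"] by auto
  then obtain u where u: "x = \<pi> ^ n * u" by (auto simp: dvd_def)
  then have "\<not> \<pi> dvd u" using n(1) by auto
  then show thesis using that u by blast
qed

lemma zp_power_dvd_mult_unit:
  assumes "\<not> \<pi> dvd (u :: 'p::prime_card zp)"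
  shows "\<pi> ^ n dvd u * x \<longleftrightarrow> \<pi> ^ n dvd x" "\<pi> ^ n dvd x * u \<longleftrightarrow> \<pi> ^ n dvd x"
  using assms by (simp_all add: zp_unit_iff[symmetric] dvd_mult_unit_iff' dvd_mult_unit_iff)

lemma zp_power_dvd_power_iff:
  "\<pi> ^ m dvd (\<pi> ^ n * u :: 'p::prime_card zp) \<longleftrightarrow> m \<le> n" if "\<not> \<pi> dvd u"
proof
  assume d: "\<pi> ^ m dvd \<pi> ^ n * u"
  show "m \<le> n"
  proof (rule ccontr)
    assume "\<not> m \<le> n"
    then have "\<pi> ^ n * \<pi> dvd \<pi> ^ n * u"
      using d dvd_trans[OF le_imp_power_dvd[of "Suc n" m \<pi>] d] by (simp add: mult.commute)
    then show False using that by simp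
  qed
qed (simp add: le_imp_power_dvd dvd_mult2)

text \<open>With \<delta> the inverse of \<beta>, a root is a fixed point of s going to - \<delta>
  (\<alpha> + \<gamma> s^2). The iterates from 0 stay among the multiples of p because p divides
  \<alpha>, and there the map contracts, since s^2 - t^2 contains the factor s + t.\<close>

lemma zp_hensel_quadratic:
  fixes \<alpha> \<beta> \<gamma> :: "'p::prime_card zp"
  assumes "\<pi> dvd \<alpha>" "\<not> \<pi> dvd \<beta>"
  obtains s where "\<alpha> + \<beta> * s + \<gamma> * s ^ 2 = 0"
proof -
  obtain \<delta> where \<delta>: "\<beta> * \<delta> = 1" using zp_inverse_exists assms(2) by blast
  define t where "t = rec_nat 0 (\<lambda>_ s. - \<delta> * (\<alpha> + \<gamma> * s ^ 2))"
  have t_simps: "t 0 = 0" "t (Suc n) = - \<delta> * (\<alpha> + \<gamma> * t n ^ 2)" for n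
    by (simp_all add: t_def)
  have t1: "\<pi> dvd t n" for n
    by (induction n) (use assms(1) in \<open>auto simp: t_simps power2_eq_square\<close>)
  have t: "\<pi> ^ n dvd t (Suc n) - t n" for n
  proof (induction n)
    case (Suc n)
    have "t (Suc (Suc n)) - t (Suc n) = - \<delta> * \<gamma> * ((t (Suc n) + t n) * (t (Suc n) - t n))"
      unfolding t_simps(2)[of "Suc n"] t_simps(2)[of n]
      by (simp add: algebra_simps power2_eq_square)
    moreover have "\<pi> ^ Suc n dvd (t (Suc n) + t n) * (t (Suc n) - t n)"
      using mult_dvd_mono[OF dvd_add[OF t1 t1] Suc.IH] by simp
    ultimately show ?case by (metis dvd_mult)
  qed simp
  then obtain s where s: "\<And>n. \<pi> ^ n dvd s - t n" using zp_complete[of t] by blast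
  have "\<pi> ^ n dvd \<alpha> + \<beta> * s + \<gamma> * s ^ 2" for n
  proof -
    have "\<beta> * t (Suc n) = - (\<alpha> + \<gamma> * t n ^ 2)"
      unfolding t_simps using \<delta> by (simp add: mult.assoc[symmetric])
    then have eq: "\<alpha> + \<beta> * s + \<gamma> * s ^ 2
        = \<beta> * ((s - t n) - (t (Suc n) - t n)) + \<gamma> * ((s + t n) * (s - t n))"
      by (simp add: algebra_simps power2_eq_square)
    show ?thesis unfolding eq
      by (rule dvd_add[OF dvd_mult[OF dvd_diff[OF s t]] dvd_mult[OF dvd_mult[OF s]]])
  qed
  then show thesis using that zp_eq_0I by blast
qed

section \<open>The residue field and systems of residues\<close>

definition zp_red :: "'p::prime_card zp \<Rightarrow> 'p mod_ring" where
  "zp_red x = of_int (Rep_zp x 1)"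

lemma of_int_mod_ring_eq_0_iff: "(of_int k :: 'p::prime_card mod_ring) = 0 \<longleftrightarrow> int CARD('p) dvd k"
  unfolding of_int_of_int_mod_ring dvd_eq_mod_eq_0 by transfer rule

lemma of_int_mod_card: "(of_int (k mod int CARD('p)) :: 'p::prime_card mod_ring) = of_int k"
proof -
  have "(of_int (k mod int CARD('p) - k) :: 'p mod_ring) = 0"
    unfolding of_int_mod_ring_eq_0_iff by (rule mod_eq_dvd_iff[THEN iffD1]) (rule mod_mod_trivial)
  then show ?thesis by simp
qed

lemma zp_red_hom:
  "zp_red (x + y) = zp_red x + zp_red y" "zp_red (x * y) = zp_red x * zp_red y"
  "zp_red (x - y) = zp_red x - zp_red y" "zp_red (- x) = - zp_red x"
  "zp_red 0 = 0" "zp_red 1 = 1"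
  by (simp_all add: zp_red_def zp_rep_eqs of_int_mod_card)

lemma zp_red_of_int: "zp_red (of_int k) = of_int k"
  by (simp add: zp_red_def Rep_zp_of_int of_int_mod_card)

lemma zp_red_of_nat: "zp_red (of_nat k) = of_nat k"
  using zp_red_of_int[of "int k"] by simp

lemma zp_red_eq_0_iff: "zp_red x = 0 \<longleftrightarrow> \<pi> dvd (x :: 'p::prime_card zp)"
proof -
  have "zp_red x = 0 \<longleftrightarrow> int CARD('p) dvd Rep_zp x 1"
    by (simp add: zp_red_def of_int_mod_ring_eq_0_iff)
  also have "\<dots> \<longleftrightarrow> Rep_zp x 1 = 0"
    using Rep_zp_bounds[of x 1] by (auto dest: zdvd_imp_le)
  finally show ?thesis using zp_dvd_iff[of 1 x] by simp
qed

lemma zp_red_eq_iff: "zp_red x = zp_red y \<longleftrightarrow> \<pi> dvd x - (y :: 'p::prime_card zp)"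
  using zp_red_eq_0_iff[of "x - y"] by (simp add: zp_red_hom)

lemma zp_red_surj: "\<exists>x. zp_red x = (y :: 'p::prime_card mod_ring)"
proof -
  have "zp_red (of_int (to_int_mod_ring y)) = y"
    by (simp add: zp_red_of_int of_int_of_int_mod_ring)
  then show ?thesis ..
qed

definition zp_residues :: "nat \<Rightarrow> 'p::prime_card zp set" where
  "zp_residues n = of_nat ` {..<CARD('p) ^ n}"

lemma zp_residues:
  shows "card (zp_residues n :: 'p::prime_card zp set) = CARD('p) ^ n"
    and "finite (zp_residues n :: 'p zp set)"
    and "\<exists>!r\<in>zp_residues n. \<pi> ^ n dvd (x :: 'p zp) - r"
proof -
  let ?p = "int CARD('p)"
  have iff: "\<pi> ^ n dvd x - of_nat k \<longleftrightarrow> Rep_zp x n = int k" if "k < CARD('p) ^ n" for k and x :: "'p zp"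
  proof -
    have "int k < int (CARD('p) ^ n)" using that by (simp only: of_nat_less_iff)
    then have "int k mod ?p ^ n = int k" by simp
    then have "\<pi> ^ n dvd x - of_nat k \<longleftrightarrow> (Rep_zp x n - int k) mod ?p ^ n = 0"
      by (simp add: zp_dvd_iff minus_zp.rep_eq Rep_zp_of_nat)
    also have "\<dots> \<longleftrightarrow> Rep_zp x n mod ?p ^ n = int k mod ?p ^ n"
      unfolding mod_eq_dvd_iff dvd_eq_mod_eq_0 ..
    finally show ?thesis using \<open>int k mod ?p ^ n = int k\<close> by simp
  qed
  have "inj_on (of_nat :: nat \<Rightarrow> 'p zp) {..<CARD('p) ^ n}"
  proof (rule inj_onI)
    fix k l assume kl: "k \<in> {..<CARD('p) ^ n}" "l \<in> {..<CARD('p) ^ n}" "(of_nat k :: 'p zp) = of_nat l"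
    then have "Rep_zp (of_nat l :: 'p zp) n = int k" using iff[of k "of_nat l"] by simp
    moreover have "Rep_zp (of_nat l :: 'p zp) n = int l" using iff[of l "of_nat l"] kl by simp
    ultimately show "k = l" by simp
  qed
  then show "card (zp_residues n :: 'p zp set) = CARD('p) ^ n"
    by (simp add: zp_residues_def card_image)
  show "finite (zp_residues n :: 'p zp set)" by (simp add: zp_residues_def)
  have k: "nat (Rep_zp x n) < CARD('p) ^ n" "int (nat (Rep_zp x n)) = Rep_zp x n"
    using Rep_zp_bounds[of x n] by (simp_all add: nat_less_iff)
  show "\<exists>!r\<in>zp_residues n. \<pi> ^ n dvd x - r"
  proof (rule ex1I[of _ "of_nat (nat (Rep_zp x n))"])
    show "(of_nat (nat (Rep_zp x n)) :: 'p zp) \<in> zp_residues n \<and> \<pi> ^ n dvd x - of_nat (nat (Rep_zp x n))"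
      using k iff[of "nat (Rep_zp x n)" x] by (auto simp: zp_residues_def)
  next
    fix r :: "'p zp"
    assume "r \<in> zp_residues n \<and> \<pi> ^ n dvd x - r"
    then obtain k where "k < CARD('p) ^ n" "r = of_nat k" "\<pi> ^ n dvd x - of_nat k"
      by (auto simp: zp_residues_def)
    then show "r = of_nat (nat (Rep_zp x n))" using iff[of k x] by simp
  qed
qed

declare split_paired_All [simp del] split_paired_Ex [simp del]

section \<open>Diagonalization over the \<open>p\<close>-adic integers\<close>

text \<open>Pigeonhole: a nonzero square has at most two roots, so the set S of squares contains
  more than half of the field and must meet t - S. The bound on the number of roots also covers
  characteristic 2.\<close>

lemma finite_field_sum_two_squares:
  fixes t :: "'a::{finite, field}"
  obtains x y where "x ^ 2 + y ^ 2 = t"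
proof -
  let ?S = "range (\<lambda>x :: 'a. x ^ 2)"
  let ?B = "(\<lambda>s. t - s) ` ?S"
  have "card (UNIV - {0 :: 'a}) \<le> (\<Sum>s\<in>?S - {0}. card {x :: 'a. x ^ 2 = s})"
  proof -
    have "UNIV - {0 :: 'a} \<subseteq> (\<Union>s\<in>?S - {0}. {x. x ^ 2 = s})" by auto
    then have "card (UNIV - {0 :: 'a}) \<le> card (\<Union>s\<in>?S - {0}. {x :: 'a. x ^ 2 = s})"
      by (intro card_mono) auto
    also have "\<dots> \<le> (\<Sum>s\<in>?S - {0}. card {x :: 'a. x ^ 2 = s})"
      by (rule card_UN_le) simp
    finally show ?thesis .
  qed
  also have "\<dots> \<le> (\<Sum>s\<in>?S - {0}. 2)"
  proof (rule sum_mono)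
    fix s assume "s \<in> ?S - {0}"
    then obtain r where r: "s = r ^ 2" by auto
    have "{x :: 'a. x ^ 2 = s} \<subseteq> {r, - r}" by (auto simp: r power2_eq_iff)
    then have "card {x :: 'a. x ^ 2 = s} \<le> card {r, - r}" by (intro card_mono) auto
    also have "\<dots> \<le> 2" by (simp add: card_insert_if)
    finally show "card {x :: 'a. x ^ 2 = s} \<le> 2" .
  qed
  finally have "CARD('a) - 1 \<le> 2 * (card ?S - 1)"
    by (simp add: card_Diff_singleton image_iff mult.commute)
  moreover have "card ?S > 0" "CARD('a) > 0" by (simp_all add: card_gt_0_iff)
  moreover have "card ?B = card ?S" by (rule card_image) (auto intro: inj_onI)
  ultimately have "card ?S + card ?B > CARD('a)" by linarith
  then have "?S \<inter> ?B \<noteq> {}"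
    using card_Un_disjoint[of ?S ?B] card_mono[of "UNIV :: 'a set" "?S \<union> ?B"] by fastforce
  then obtain x y :: 'a where "x ^ 2 = t - y ^ 2" by auto
  then show thesis using that[of x y] by (simp add: algebra_simps)
qed

definition vec_red :: "'p::prime_card zp ^ 'n \<Rightarrow> 'p mod_ring ^ 'n" where
  "vec_red v = (\<chi> i. zp_red (v $ i))"

lemma vec_red_nth [simp]: "vec_red v $ i = zp_red (v $ i)"
  by (simp add: vec_red_def)

lemma vec_red_hom:
  "vec_red (v + w) = vec_red v + vec_red w" "vec_red (v - w) = vec_red v - vec_red w"
  "vec_red (r *s v) = zp_red r *s vec_red v" "vec_red 0 = 0"
  by (simp_all add: vec_eq_iff zp_red_hom)

lemma vec_red_surj: "\<exists>v. vec_red v = w"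
proof -
  have "\<exists>v. \<forall>i. zp_red (v i) = w $ i" using zp_red_surj by (intro choice) blast
  then obtain v where "\<And>i. zp_red (v i) = w $ i" by blast
  then have "vec_red (\<chi> i. v i) = w" by (simp add: vec_eq_iff)
  then show ?thesis ..
qed

lemma zp_red_numeral: "zp_red (numeral k) = numeral k"
  using zp_red_of_nat[of "numeral k"] by simp

lemma cayley_norm_red: "cayley_norm (vec_red x) = zp_red (cayley_norm x)"
  by (simp add: cayley_norm_eq zp_red_hom)

lemma cayley_inner_red: "cayley_inner (vec_red x) (vec_red y) = zp_red (cayley_inner x y)"
  by (simp add: cayley_inner_eq zp_red_hom zp_red_numeral)

lemma cayley_mult_red: "cayley_mult (vec_red x) (vec_red y) = vec_red (cayley_mult x y)"
  by (simp add: vec_eq_iff forall_index8 cayley_mult_nth zp_red_hom)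

lemma cayley_conj_red: "cayley_conj (vec_red x) = vec_red (cayley_conj x)"
  by (simp add: vec_eq_iff forall_index8 cayley_conj_nth zp_red_hom)

text \<open>On the first three coordinates the norm is a sum of three squares. One of them is fixed
  at 1, so that there is a direction with nonzero derivative when the solution is lifted.\<close>

lemma cayley_norm_field_surj:
  fixes t :: "'a::{finite, field}"
  obtains w where "cayley_norm w = t" "w $ 2 = 1"
proof -
  obtain x y :: 'a where xy: "x ^ 2 + y ^ 2 = t - 1" by (rule finite_field_sum_two_squares)
  let ?w = "\<chi> i :: 8. if i = 0 then x else if i = 1 then y else if i = 2 then 1 else 0"
  have "cayley_norm ?w = x ^ 2 + y ^ 2 + 1" by (simp add: cayley_norm_eq power2_eq_square)
  then show thesis using that[of ?w] xy by simp
qed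

text \<open>A solution modulo p is corrected along the line w + s d, with d dual to the coordinate
  2. The coefficient of s is that coordinate, which is 1 modulo p, so Hensel's lemma
  applies.\<close>

lemma cayley_norm_zp_surj:
  fixes t :: "'p::prime_card zp"
  obtains w where "cayley_norm w = t"
proof -
  obtain w0 where w0: "cayley_norm w0 = zp_red t" "w0 $ 2 = 1"
    by (rule cayley_norm_field_surj)
  obtain w where w: "vec_red w = w0" using vec_red_surj by blast
  obtain d :: "'p zp cayley" where d: "\<forall>x. cayley_inner x d = x $ 2" using cayley_dual_basis by blast
  have "zp_red (w $ 2) = 1" using w w0(2) by (metis vec_red_nth)
  then have "\<not> \<pi> dvd cayley_inner w d" using d zp_red_eq_0_iff[of "w $ 2"] by simp
  moreover have "\<pi> dvd cayley_norm w - t"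
    using w0(1) unfolding w[symmetric] cayley_norm_red by (simp add: zp_red_eq_iff)
  ultimately obtain s where s: "(cayley_norm w - t) + cayley_inner w d * s + cayley_norm d * s ^ 2 = 0"
    using zp_hensel_quadratic by blast
  have "cayley_norm (w + s *s d) = t"
    using s by (simp add: cayley_norm_add cayley_norm_scale cayley_inner_linear algebra_simps)
  then show thesis by (rule that)
qed

section \<open>Divisibility of matrices and reduction to diagonal form\<close>

fun jordan_dvd :: "nat \<Rightarrow> 'p::prime_card zp jordan \<Rightarrow> bool" where
  "jordan_dvd n (a, b, c, x, y, z) \<longleftrightarrow> \<pi> ^ n dvd a \<and> \<pi> ^ n dvd b \<and> \<pi> ^ n dvd c \<and>
     (\<forall>i. \<pi> ^ n dvd x $ i) \<and> (\<forall>i. \<pi> ^ n dvd y $ i) \<and> (\<forall>i. \<pi> ^ n dvd z $ i)"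

lemma vec_dvd_iff: "(\<forall>i. (r::'a::comm_ring_1) dvd v $ i) \<longleftrightarrow> (\<exists>w. v = r *s w)"
proof
  assume "\<forall>i. r dvd v $ i"
  then have "\<forall>i. \<exists>w. v $ i = r * w" by (simp add: dvd_def)
  from choice[OF this] obtain w where "\<forall>i. v $ i = r * w i" by blast
  then have "v = r *s (\<chi> i. w i)" by (simp add: vec_eq_iff)
  then show "\<exists>w. v = r *s w" ..
qed auto

lemma jordan_dvd_iff: "jordan_dvd n X \<longleftrightarrow> (\<exists>Y. X = jordan_scale (\<pi> ^ n) Y)"
proof
  assume "jordan_dvd n X"
  moreover obtain a b c x y z where X: "X = (a, b, c, x, y, z)" by (cases X)
  ultimately obtain a' b' c' x' y' z' where "a = \<pi> ^ n * a'" "b = \<pi> ^ n * b'" "c = \<pi> ^ n * c'"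
      "x = \<pi> ^ n *s x'" "y = \<pi> ^ n *s y'" "z = \<pi> ^ n *s z'"
    unfolding X jordan_dvd.simps vec_dvd_iff by (auto simp: dvd_def)
  then have "X = jordan_scale (\<pi> ^ n) (a', b', c', x', y', z')" by (simp add: X)
  then show "\<exists>Y. X = jordan_scale (\<pi> ^ n) Y" ..
next
  assume "\<exists>Y. X = jordan_scale (\<pi> ^ n) Y"
  then show "jordan_dvd n X" by (auto elim!: jordan_scale.elims)
qed

lemma jordan_dvd_equiv:
  fixes X Y :: "'p::prime_card zp jordan"
  shows "X \<sim>\<^sub>J Y \<Longrightarrow> jordan_dvd n X \<longleftrightarrow> jordan_dvd n Y"
proof -
  have "jordan_dvd n Y" if "X \<sim>\<^sub>J Y" "jordan_dvd n X" for X Y :: "'p zp jordan"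
    using that unfolding jordan_equiv_def jordan_dvd_iff by (metis jordan_groupD(2))
  then show "X \<sim>\<^sub>J Y \<Longrightarrow> jordan_dvd n X \<longleftrightarrow> jordan_dvd n Y"
    using jordan_equiv_sym by blast
qed

lemma jordan_scale_equiv: "X \<sim>\<^sub>J Y \<Longrightarrow> jordan_scale r X \<sim>\<^sub>J jordan_scale r Y"
  unfolding jordan_equiv_def by (metis jordan_groupD(2))

text \<open>If a and b are divisible by p, a unit coordinate x $ i is carried to the diagonal by the
  shear along the dual basis vector d: up to a multiple of p, it adds (x, d) = x $ i to b.
  Permutations reduce the other entries to this case.\<close>

lemma equiv_unit_entry:
  fixes X :: "'p::prime_card zp jordan"
  assumes "\<not> jordan_dvd 1 X"
  obtains a b c x y z where "X \<sim>\<^sub>J (a, b, c, x, y, z)" "\<not> \<pi> dvd a"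
proof -
  define P where "P X \<longleftrightarrow> (\<exists>Y. X \<sim>\<^sub>J Y \<and> \<not> \<pi> dvd fst Y)" for X :: "'p zp jordan"
  have step: "P Y \<Longrightarrow> X \<sim>\<^sub>J Y \<Longrightarrow> P X" for X Y
    unfolding P_def using jordan_equiv_trans by blast
  have 0: "P (a, b, c, x, y, z)" if "\<not> \<pi> dvd a" for a b c x y z
    unfolding P_def using that by (intro exI[of _ "(a, b, c, x, y, z)"]) simp
  have 1: "P (a, b, c, x, y, z)" if "\<not> \<pi> dvd b" for a b c x y z
    by (rule step[OF _ jordan_equiv_moves(2)]) (simp add: 0 that)
  have 2: "P (a, b, c, x, y, z)" if "\<not> \<pi> dvd c" for a b c x y z
    by (rule step[OF _ jordan_equiv_moves(3)]) (simp add: 1 that)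
  have 3: "P (a, b, c, x, y, z)" if i: "\<not> \<pi> dvd x $ i" for a b c x y z i
  proof (cases "\<pi> dvd a \<and> \<pi> dvd b")
    case True
    obtain d :: "'p zp cayley" where d: "\<forall>x. cayley_inner x d = x $ i" using cayley_dual_basis by blast
    have "\<pi> dvd b + a * cayley_norm d" using True by simp
    then have "\<not> \<pi> dvd (b + a * cayley_norm d) + x $ i"
      using i dvd_add_right_iff by blast
    then have "\<not> \<pi> dvd b + x $ i + a * cayley_norm d"
      unfolding add.assoc add.commute[of "a * cayley_norm d"] .
    then have "P (jordan_shear d (a, b, c, x, y, z))"
      unfolding jordan_shear.simps using d by (intro 1) simp
    then show ?thesis by (rule step[OF _ jordan_equiv_moves(1)])
  next
    case False
    then show ?thesis using 0[of a b c x y z] 1[of b a c x y z] by blast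
  qed
  have 4: "P (a, b, c, x, y, z)" if i: "\<not> \<pi> dvd y $ i" for a b c x y z i
    by (rule step[OF _ jordan_equiv_moves(3)]) (simp add: 3[OF i])
  have 5: "P (a, b, c, x, y, z)" if i: "\<not> \<pi> dvd z $ i" for a b c x y z i
    by (rule step[OF _ jordan_equiv_moves(2)]) (simp add: 4[OF i])
  obtain a b c x y z where X: "X = (a, b, c, x, y, z)" by (cases X)
  have "P X"
  proof (rule ccontr)
    assume n: "\<not> P X"
    have "\<pi> dvd a" "\<pi> dvd b" "\<pi> dvd c" using n 0 1 2 unfolding X by metis+
    moreover have "\<pi> dvd x $ i" "\<pi> dvd y $ i" "\<pi> dvd z $ i" for i
      using n 3 4 5 unfolding X by metis+
    ultimately show False using assms by (simp add: X)
  qed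
  then obtain Y where "X \<sim>\<^sub>J Y" "\<not> \<pi> dvd fst Y" unfolding P_def by blast
  then show thesis using that by (cases Y) auto
qed

text \<open>A shear by - x / a clears x. After the last two indices are exchanged, the same is done
  to y; this second shear changes the Cayley entry of the block only by a multiple of the entry
  already cleared.\<close>

lemma equiv_clear_first_row:
  fixes a :: "'p::prime_card zp"
  assumes "\<not> \<pi> dvd a"
  obtains b' c' z' where "(a, b, c, x, y, z) \<sim>\<^sub>J (a, b', c', 0, 0, z')"
proof -
  obtain a' where a': "a * a' = 1" using zp_inverse_exists assms by blast
  have *: "v + a *s ((- a') *s v) = 0" for v :: "'p zp cayley"
    using a' by (simp add: vec_eq_iff mult.assoc[symmetric])
  have "\<exists>b' z'. (a, b, c, x, y, z) \<sim>\<^sub>J (a, b', c, 0, y, z')" for b c x y z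
    using jordan_equiv_moves(1)[of "(a, b, c, x, y, z)" "(- a') *s x"]
    unfolding jordan_shear.simps * by blast
  then obtain b' z' where 1: "(a, b, c, x, y, z) \<sim>\<^sub>J (a, b', c, 0, y, z')" by blast
  have 2: "(a, b', c, 0, y, z') \<sim>\<^sub>J (a, c, b', y, 0, cayley_conj z')"
    using jordan_equiv_moves(3)[of "(a, b', c, 0, y, z')"] by simp
  have 3: "\<exists>c'. (a, c, b', y, 0, cayley_conj z') \<sim>\<^sub>J (a, c', b', 0, 0, cayley_conj z')"
    using jordan_equiv_moves(1)[of "(a, c, b', y, 0, cayley_conj z')" "(- a') *s y"]
    unfolding jordan_shear.simps * cayley_mult_0 add_0_right by blast
  show thesis using 1 2 3 that jordan_equiv_trans by meson
qed

text \<open>The quantification over \<open>r\<close> allows a common power of \<open>p\<close> to be split off the block \<open>(b, c, z)\<close>.\<close>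

definition block_equiv :: "'p::prime_card zp \<times> 'p zp \<times> 'p zp cayley \<Rightarrow> 'p zp \<times> 'p zp \<times> 'p zp cayley \<Rightarrow> bool" where
  "block_equiv B B' = (case (B, B') of ((b, c, z), (b', c', z')) \<Rightarrow>
     \<forall>a r. (a, r * b, r * c, 0, 0, r *s z) \<sim>\<^sub>J (a, r * b', r * c', 0, 0, r *s z'))"

lemma block_equivD:
  "block_equiv (b, c, z) (b', c', z') \<Longrightarrow> (a, r * b, r * c, 0, 0, r *s z) \<sim>\<^sub>J (a, r * b', r * c', 0, 0, r *s z')"
  by (simp add: block_equiv_def)

lemma block_equivI:
  "(\<And>a r. (a, r * b, r * c, 0, 0, r *s z) \<sim>\<^sub>J (a, r * b', r * c', 0, 0, r *s z'))
    \<Longrightarrow> block_equiv (b, c, z) (b', c', z')"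
  by (simp add: block_equiv_def)

lemma block_equiv_trans [trans]:
  assumes "block_equiv A B" "block_equiv B C"
  shows "block_equiv A C"
proof -
  obtain b c z b' c' z' b'' c'' z'' where *: "A = (b, c, z)" "B = (b', c', z')" "C = (b'', c'', z'')"
    by (cases A, cases B, cases C)
  show ?thesis
    unfolding * by (rule block_equivI, rule jordan_equiv_trans[OF block_equivD block_equivD])
      (use assms in \<open>simp_all add: *\<close>)
qed

lemma block_equiv_refl [simp]: "block_equiv A A"
  unfolding block_equiv_def by auto

lemma block_equiv_swap: "block_equiv (b, c, z) (c, b, cayley_conj z)"
proof (rule block_equivI)
  show "(a, r * b, r * c, 0, 0, r *s z) \<sim>\<^sub>J (a, r * c, r * b, 0, 0, r *s cayley_conj z)" for a r
    using jordan_equiv_moves(3)[of "(a, r * b, r * c, 0, 0, r *s z)"]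
    by (simp add: cayley_conj_linear)
qed

lemma rotate_equiv:
  fixes a b c :: "'a::idom"
  shows "(a, b, c, 0, 0, z) \<sim>\<^sub>J (b, c, a, z, 0, 0)"
proof -
  have "(a, b, c, 0, 0, z) \<sim>\<^sub>J (b, a, c, 0, z, 0)"
    using jordan_equiv_moves(2)[of "(a, b, c, 0, 0, z)"] by simp
  also have "\<dots> \<sim>\<^sub>J (b, c, a, z, 0, 0)"
    using jordan_equiv_moves(3)[of "(b, a, c, 0, z, 0)"] by simp
  finally show ?thesis .
qed

lemma block_equiv_shear:
  fixes b c :: "'p::prime_card zp"
  shows "block_equiv (b, c, z) (b, c + cayley_inner z u + b * cayley_norm u, z + b *s u)"
proof (rule block_equivI)
  fix a r :: "'p zp"
  have "(a, r * b, r * c, 0, 0, r *s z) \<sim>\<^sub>J (r * b, r * c, a, r *s z, 0, 0)" by (rule rotate_equiv)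
  also have "\<dots> \<sim>\<^sub>J (r * b, r * (c + cayley_inner z u + b * cayley_norm u), a, r *s (z + b *s u), 0, 0)"
    using jordan_equiv_moves(1)[of "(r * b, r * c, a, r *s z, 0, 0)" u]
    by (simp add: cayley_inner_linear algebra_simps vector_add_ldistrib)
  also have "\<dots> \<sim>\<^sub>J (a, r * b, r * (c + cayley_inner z u + b * cayley_norm u), 0, 0, r *s (z + b *s u))"
    by (rule jordan_equiv_sym[OF rotate_equiv])
  finally show "(a, r * b, r * c, 0, 0, r *s z) \<sim>\<^sub>J
    (a, r * b, r * (c + cayley_inner z u + b * cayley_norm u), 0, 0, r *s (z + b *s u))" .
qed

lemma block_equiv_diag:
  fixes b c :: "'p::prime_card zp"
  assumes "\<not> \<pi> dvd b"
  obtains c' where "block_equiv (b, c, z) (b, c', 0)"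
proof -
  obtain b' where b': "b * b' = 1" using zp_inverse_exists assms by blast
  have "z + b *s ((- b') *s z) = 0" using b' by (simp add: vec_eq_iff mult.assoc[symmetric])
  then show thesis using block_equiv_shear[of b c z "(- b') *s z"] that by metis
qed

lemma block_equiv_unit_entry:
  fixes b c :: "'p::prime_card zp"
  assumes "\<not> (\<pi> dvd b \<and> \<pi> dvd c \<and> (\<forall>i. \<pi> dvd z $ i))"
  obtains b' c' where "block_equiv (b, c, z) (b', c', 0)" "\<not> \<pi> dvd b'"
proof -
  note main = that
  have 1: thesis if e: "block_equiv (b, c, z) (b', c', z')" and u: "\<not> \<pi> dvd b'" for b' c' z'
  proof -
    obtain c'' where "block_equiv (b', c', z') (b', c'', 0)" using u by (rule block_equiv_diag)
    then show thesis using main[OF block_equiv_trans[OF e] u] by blast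
  qed
  have 2: thesis if "block_equiv (b, c, z) (b', c', z')" "\<not> \<pi> dvd c'" for b' c' z'
    by (rule 1[OF block_equiv_trans[OF that(1) block_equiv_swap] that(2)])
  show thesis
  proof (cases "\<pi> dvd b \<and> \<pi> dvd c")
    case False
    then show thesis using 1[of b c z] 2[of b c z] by auto
  next
    case True
    then obtain i where i: "\<not> \<pi> dvd z $ i" using assms by blast
    obtain d :: "'p zp cayley" where d: "\<forall>x. cayley_inner x d = x $ i" using cayley_dual_basis by blast
    have "\<pi> dvd c + b * cayley_norm d" using True by simp
    then have "\<not> \<pi> dvd (c + b * cayley_norm d) + z $ i" using i dvd_add_right_iff by blast
    then show thesis using 2[OF block_equiv_shear[of b c z d]] d by (simp add: algebra_simps)
  qed
qed

text \<open>The unit \<open>u\<close> is moved to the other entry: shearing by \<open>w\<close> and then, after a swap, by \<open>1\<close>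
  turns the second entry into \<open>u N(w' + 1) + e\<close>, where \<open>w'\<close> is the conjugate of \<open>w\<close>, and the
  norm form takes all values.\<close>

lemma block_equiv_move_unit:
  fixes u e :: "'p::prime_card zp"
  assumes "\<not> \<pi> dvd u"
  shows "block_equiv (u, e, 0) (1, u * e, 0)"
proof -
  obtain u' where u': "u * u' = 1" using zp_inverse_exists assms by blast
  \<comment> \<open>This norm makes u N(v) + e equal to 1, which is the entry that appears after the
    two shears.\<close>
  obtain v where v: "cayley_norm v = u' * (1 - e)" by (rule cayley_norm_zp_surj)
  let ?i = "axis 0 1 :: 'p zp cayley"
  define w where "w = cayley_conj (v - ?i)"
  define c where "c = e + u * cayley_norm w"
  have i: "cayley_norm ?i = 1" by (simp add: cayley_norm_eq axis_def)
  have "block_equiv (u, e, 0) (u, c, u *s w)"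
    using block_equiv_shear[of u e 0 w] by (simp add: c_def)
  also have "block_equiv \<dots> (c, u, cayley_conj (u *s w))" by (rule block_equiv_swap)
  also have "block_equiv \<dots> (c, u + cayley_inner (cayley_conj (u *s w)) ?i + c * cayley_norm ?i,
      cayley_conj (u *s w) + c *s ?i)"
    by (rule block_equiv_shear)
  also have "u + cayley_inner (cayley_conj (u *s w)) ?i + c * cayley_norm ?i = 1"
  proof -
    have "cayley_norm v = cayley_norm (cayley_conj w + ?i)" by (simp add: w_def)
    also have "\<dots> = cayley_norm w + cayley_inner (cayley_conj w) ?i + 1"
      by (simp add: cayley_norm_add i)
    finally have "u * (cayley_norm w + cayley_inner (cayley_conj w) ?i + 1) = u * u' * (1 - e)"
      using v by (simp add: mult.assoc)
    then show ?thesis using u' by (simp add: i c_def cayley_conj_linear cayley_inner_linear algebra_simps)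
  qed
  also have "block_equiv (c, 1, cayley_conj (u *s w) + c *s ?i)
      (1, c, cayley_conj (cayley_conj (u *s w) + c *s ?i))"
    by (rule block_equiv_swap)
  also have "cayley_conj (cayley_conj (u *s w) + c *s ?i) = u *s w + c *s ?i"
    by (simp add: cayley_conj_linear) (simp add: vec_eq_iff forall_index8 cayley_conj_nth axis_def)
  also have "block_equiv (1, c, u *s w + c *s ?i) (1, c + cayley_inner (u *s w + c *s ?i) (- (u *s w + c *s ?i)) +
       1 * cayley_norm (- (u *s w + c *s ?i)), u *s w + c *s ?i + 1 *s (- (u *s w + c *s ?i)))"
    by (rule block_equiv_shear)
  also have "\<dots> = (1, c - cayley_norm (u *s w + c *s ?i), 0)"
    by (simp only: cayley_inner_linear(8) cayley_inner_self cayley_norm_minus) simp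
  \<comment> \<open>Shears and swaps of the block preserve b c - N z, so the other entry can only be
    u e. The expansion confirms it, using the relation that produced the entry 1.\<close>
  also have "c - cayley_norm (u *s w + c *s ?i) = u * e"
  proof -
    have 1: "u + u * cayley_inner w ?i + c = 1"
      using \<open>u + cayley_inner (cayley_conj (u *s w)) ?i + c * cayley_norm ?i = 1\<close> 
        cayley_inner_conj[of w ?i]
      by (simp add: i cayley_conj_linear cayley_inner_linear)
         (simp add: cayley_inner_eq cayley_conj_nth axis_def algebra_simps)
    have "cayley_norm (u *s w + c *s ?i) = u ^ 2 * cayley_norm w + c * (u * cayley_inner w ?i) + c ^ 2"
      by (simp add: cayley_norm_add cayley_norm_scale cayley_inner_linear i algebra_simps)
    also have "u * cayley_inner w ?i = 1 - u - c" using 1 by (simp add: algebra_simps)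
    finally show ?thesis by (simp add: c_def algebra_simps power2_eq_square)
  qed
  finally show ?thesis .
qed

lemma jordan_diag_equiv_perm:
  fixes a b c :: "'a::idom"
  shows "jordan_diag a b c \<sim>\<^sub>J jordan_diag b a c" "jordan_diag a b c \<sim>\<^sub>J jordan_diag a c b"
  using jordan_equiv_moves(2)[of "jordan_diag a b c"] jordan_equiv_moves(3)[of "jordan_diag a b c"]
  by (simp_all add: jordan_diag_def)

lemma jordan_diag_move_unit:
  fixes u e :: "'p::prime_card zp"
  assumes "\<not> \<pi> dvd u"
  shows "jordan_diag a (r * u) (r * e) \<sim>\<^sub>J jordan_diag a r (r * (u * e))"
  using block_equivD[OF block_equiv_move_unit[OF assms], of a r e] by (simp add: jordan_diag_def)

lemma jordan_diag_move_unit':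
  fixes u e :: "'p::prime_card zp"
  assumes "\<not> \<pi> dvd u"
  shows "jordan_diag u e c \<sim>\<^sub>J jordan_diag 1 (u * e) c"
proof -
  have "jordan_diag u e c \<sim>\<^sub>J jordan_diag u c e" by (rule jordan_diag_equiv_perm)
  also have "\<dots> \<sim>\<^sub>J jordan_diag c u e" by (rule jordan_diag_equiv_perm)
  also have "\<dots> \<sim>\<^sub>J jordan_diag c 1 (u * e)" using jordan_diag_move_unit[OF assms, of c 1 e] by simp
  also have "\<dots> \<sim>\<^sub>J jordan_diag 1 c (u * e)" by (rule jordan_diag_equiv_perm)
  also have "\<dots> \<sim>\<^sub>J jordan_diag 1 (u * e) c" by (rule jordan_diag_equiv_perm)
  finally show ?thesis .
qed

text \<open>A similitude scales the three entries by \<open>v, v, u\<close> with \<open>v u = 1\<close>; moving the units \<open>v\<close> back to the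
  last entry cancels the unit there.\<close>

lemma jordan_diag_absorb_unit:
  fixes u :: "'p::prime_card zp"
  assumes "\<not> \<pi> dvd u"
  shows "jordan_diag 1 r (r * (s * u)) \<sim>\<^sub>J jordan_diag 1 r (r * s)"
proof -
  obtain v where v: "v * u = 1" using zp_inverse_exists[OF assms] by (metis mult.commute)
  then have nv: "\<not> \<pi> dvd v" by (metis zp_unit_iff dvd_triv_left)
  then have nv2: "\<not> \<pi> dvd v * v" by (simp add: zp_prime_dvd_mult_iff)
  have "jordan_diag 1 r (r * (s * u)) \<sim>\<^sub>J jordan_diag v (v * r) (u * (r * (s * u)))"
    using jordan_equiv_moves(4)[OF v, of "jordan_diag 1 r (r * (s * u))"] by (simp add: jordan_diag_def)
  also have "\<dots> \<sim>\<^sub>J jordan_diag 1 (v * (v * r)) (u * (r * (s * u)))"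
    by (rule jordan_diag_move_unit'[OF nv])
  also have "\<dots> = jordan_diag 1 (r * (v * v)) (r * (u * u * s))" by (simp add: ac_simps)
  also have "\<dots> \<sim>\<^sub>J jordan_diag 1 r (r * (v * v * (u * u * s)))"
    by (rule jordan_diag_move_unit[OF nv2])
  also have "v * v * (u * u * s) = v * u * (v * u) * s" by (simp add: ac_simps)
  finally show ?thesis using v by simp
qed

lemma jordan_det_dvd_equiv:
  fixes X Y :: "'a::comm_ring_1 jordan"
  assumes "X \<sim>\<^sub>J Y"
  shows "r dvd jordan_det X \<longleftrightarrow> r dvd jordan_det Y"
proof -
  obtain g where "g \<in> jordan_group" "g X = Y" using assms by (auto simp: jordan_equiv_def)
  then obtain \<nu> where "\<nu> dvd 1" "jordan_det Y = \<nu> * jordan_det X" using jordan_groupD(6) by blast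
  moreover then obtain \<mu> where "\<mu> * \<nu> = 1" by (metis dvd_def mult.commute)
  ultimately show ?thesis
    by (metis dvd_mult mult.assoc mult_1)
qed

lemma jordan_det_diag [simp]: "jordan_det (jordan_diag a b c) = a * b * c"
  by (simp add: jordan_diag_def cayley_trace_eq)

lemma jordan_det_scale: "jordan_det (jordan_scale r X) = r ^ 3 * jordan_det X"
  by (cases X) (simp add: jordan_det_eq cayley_norm_scale cayley_mult_scale_left cayley_mult_scale_right
      cayley_inner_linear algebra_simps power2_eq_square power3_eq_cube del: jordan_det.simps)

text \<open>Once the first row is cleared, the largest power p^j dividing the block is split off;
  the quotient has a unit somewhere and is diagonalized by block moves. The units on the first two
  places are pushed into the last entry, whose unit part is then absorbed.\<close>

lemma jordan_primitive_diagonalize: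
  fixes X :: "'p::prime_card zp jordan"
  assumes "\<not> jordan_dvd 1 X" "jordan_det X \<noteq> 0"
  obtains j l where "X \<sim>\<^sub>J jordan_diag 1 (\<pi> ^ j) (\<pi> ^ j * \<pi> ^ l)"
proof -
  obtain a b c x y z where 1: "X \<sim>\<^sub>J (a, b, c, x, y, z)" and a: "\<not> \<pi> dvd a"
    using equiv_unit_entry assms(1) by blast
  obtain b' c' z' where "(a, b, c, x, y, z) \<sim>\<^sub>J (a, b', c', 0, 0, z')"
    by (rule equiv_clear_first_row[OF a])
  then have "X \<sim>\<^sub>J (a, b', c', 0, 0, z')" using 1 jordan_equiv_trans by blast
  then obtain b c z where X: "X \<sim>\<^sub>J (a, b, c, 0, 0, z)" by blast
  \<comment> \<open>A block divisible by all powers of p would be zero and make the determinant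
    vanish.\<close>
  have "\<exists>n. \<not> (\<pi> ^ n dvd b \<and> \<pi> ^ n dvd c \<and> (\<forall>i. \<pi> ^ n dvd z $ i))"
  proof (rule ccontr)
    assume *: "\<not> ?thesis"
    have "b = 0" "c = 0" using * by (auto intro!: zp_eq_0I)
    moreover have "z = 0" unfolding vec_eq_iff using * by (auto intro!: zp_eq_0I)
    ultimately have "jordan_det (a, b, c, 0, 0, z) = 0" by (simp add: cayley_trace_eq)
    then show False using assms(2) jordan_det_dvd_equiv[OF X, of 0] by simp
  qed
  then obtain j where j: "\<pi> ^ j dvd b \<and> \<pi> ^ j dvd c \<and> (\<forall>i. \<pi> ^ j dvd z $ i)"
    and nj: "\<not> (\<pi> ^ Suc j dvd b \<and> \<pi> ^ Suc j dvd c \<and> (\<forall>i. \<pi> ^ Suc j dvd z $ i))"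
    using exists_least_lemma[of "\<lambda>n. \<not> (\<pi> ^ n dvd b \<and> \<pi> ^ n dvd c \<and> (\<forall>i. \<pi> ^ n dvd z $ i))"] by auto
  from j obtain b' c' z' where bcz: "b = \<pi> ^ j * b'" "c = \<pi> ^ j * c'" "z = \<pi> ^ j *s z'"
    unfolding vec_dvd_iff by (auto elim!: dvdE)
  have "\<not> (\<pi> dvd b' \<and> \<pi> dvd c' \<and> (\<forall>i. \<pi> dvd z' $ i))"
    using nj by (auto simp: bcz power_Suc2 simp del: power_Suc)
  then obtain b'' c'' where B: "block_equiv (b', c', z') (b'', c'', 0)" and b'': "\<not> \<pi> dvd b''"
    by (rule block_equiv_unit_entry)
  have "X \<sim>\<^sub>J jordan_diag a (\<pi> ^ j * b'') (\<pi> ^ j * c'')"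
    using X block_equivD[OF B, of a "\<pi> ^ j"] unfolding bcz jordan_diag_def
    by (auto intro: jordan_equiv_trans)
  also have "\<dots> \<sim>\<^sub>J jordan_diag 1 (a * (\<pi> ^ j * b'')) (\<pi> ^ j * c'')"
    by (rule jordan_diag_move_unit'[OF a])
  also have "\<dots> = jordan_diag 1 (\<pi> ^ j * (a * b'')) (\<pi> ^ j * c'')" by (simp add: ac_simps)
  also have "\<dots> \<sim>\<^sub>J jordan_diag 1 (\<pi> ^ j) (\<pi> ^ j * (a * b'' * c''))"
    by (rule jordan_diag_move_unit) (simp add: zp_prime_dvd_mult_iff a b'')
  finally have D: "X \<sim>\<^sub>J jordan_diag 1 (\<pi> ^ j) (\<pi> ^ j * (a * b'' * c''))" .
  then have "jordan_det (jordan_diag 1 (\<pi> ^ j) (\<pi> ^ j * (a * b'' * c''))) \<noteq> 0"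
    using assms(2) jordan_det_dvd_equiv[OF D, of 0] by simp
  then have "a * b'' * c'' \<noteq> 0" unfolding jordan_det_diag by auto
  then obtain l u where u: "a * b'' * c'' = \<pi> ^ l * u" "\<not> \<pi> dvd u" by (rule zp_unit_decomp)
  have "X \<sim>\<^sub>J jordan_diag 1 (\<pi> ^ j) (\<pi> ^ j * \<pi> ^ l)"
    using D jordan_diag_absorb_unit[OF u(2), of "\<pi> ^ j" "\<pi> ^ l"] unfolding u(1)
    by (rule jordan_equiv_trans)
  then show thesis by (rule that)
qed

lemma jordan_diagonalize:
  fixes X :: "'p::prime_card zp jordan"
  assumes "jordan_det X \<noteq> 0"
  obtains i j k where "i \<le> j" "j \<le> k" "X \<sim>\<^sub>J jordan_diag (\<pi> ^ i) (\<pi> ^ j) (\<pi> ^ k)"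
proof -
  have "\<exists>n. \<not> jordan_dvd n X"
  proof (rule ccontr)
    assume *: "\<not> ?thesis"
    obtain a b c x y z where X: "X = (a, b, c, x, y, z)" by (cases X)
    have "a = 0" "b = 0" "c = 0" using * by (auto intro!: zp_eq_0I simp: X)
    moreover have "x = 0" "y = 0" "z = 0"
      unfolding vec_eq_iff using * by (auto intro!: zp_eq_0I simp: X)
    ultimately show False using assms X by (simp add: cayley_trace_eq)
  qed
  then have "\<exists>i. \<not> \<not> jordan_dvd i X \<and> \<not> jordan_dvd (Suc i) X"
    by (intro exists_least_lemma[of "\<lambda>n. \<not> jordan_dvd n X"]) (cases X, simp_all)
  then obtain i where i: "jordan_dvd i X" "\<not> jordan_dvd (Suc i) X" by blast
  then obtain Y where Y: "X = jordan_scale (\<pi> ^ i) Y" by (auto simp: jordan_dvd_iff)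
  have "\<not> jordan_dvd 1 Y"
  proof
    assume "jordan_dvd 1 Y"
    then obtain Z where "Y = jordan_scale \<pi> Z" by (auto simp: jordan_dvd_iff)
    then have "X = jordan_scale (\<pi> ^ Suc i) Z"
      using module.scale_scale[OF module_jordan_scale, of "\<pi> ^ i" \<pi> Z] by (simp add: Y mult.commute)
    then show False using i(2) by (auto simp: jordan_dvd_iff)
  qed
  moreover have "jordan_det Y \<noteq> 0" using assms by (auto simp: Y jordan_det_scale)
  ultimately obtain j l where "Y \<sim>\<^sub>J jordan_diag 1 (\<pi> ^ j) (\<pi> ^ j * \<pi> ^ l)"
    by (rule jordan_primitive_diagonalize)
  then have "X \<sim>\<^sub>J jordan_scale (\<pi> ^ i) (jordan_diag 1 (\<pi> ^ j) (\<pi> ^ j * \<pi> ^ l))"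
    unfolding Y by (rule jordan_scale_equiv)
  also have "\<dots> = jordan_diag (\<pi> ^ i) (\<pi> ^ (i + j)) (\<pi> ^ (i + j + l))"
    by (simp add: jordan_diag_def power_add mult.assoc)
  finally show thesis by (rule that[of i "i + j" "i + j + l", rotated 2]) simp_all
qed

section \<open>Invariants of the orbits\<close>

text \<open>This is the differential of the determinant at X in the direction Y, or the pairing of
  the adjoint of X with Y. The coefficients of the primed variables are the entries of the
  adjoint.\<close>

fun jordan_lin :: "'a::comm_ring_1 jordan \<Rightarrow> 'a jordan \<Rightarrow> 'a" where
  "jordan_lin (a, b, c, x, y, z) (a', b', c', x', y', z') =
     (b * c - cayley_norm z) * a' + (a * c - cayley_norm y) * b' + (a * b - cayley_norm x) * c'
     + cayley_inner x' (cayley_mult y (cayley_conj z) - c *s x)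
     + cayley_inner y' (cayley_mult x z - b *s y)
     + cayley_inner z' (cayley_mult (cayley_conj x) y - a *s z)"

lemma jordan_det_add:
  fixes X Y :: "'a::comm_ring_1 jordan"
  shows "jordan_det (X + Y) = jordan_det X + jordan_lin X Y + jordan_lin Y X + jordan_det Y"
proof -
  obtain a b c x y z where X: "X = (a, b, c, x, y, z)" by (cases X)
  obtain a' b' c' x' y' z' where Y: "Y = (a', b', c', x', y', z')" by (cases Y)
  have 1: "cayley_inner x' (cayley_mult y (cayley_conj z)) = cayley_inner (cayley_mult x' z) y" for x' y z :: "'a cayley"
    by (simp add: cayley_inner_mult_right)
  have 2: "cayley_inner z' (cayley_mult (cayley_conj x) y) = cayley_inner (cayley_mult x z') y" for x y z' :: "'a cayley"
    by (simp add: cayley_inner_mult_left)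
  have 3: "cayley_inner y' (cayley_mult x z) = cayley_inner (cayley_mult x z) y'" for x z y' :: "'a cayley"
    by (rule cayley_inner_commute)
  have 4: "cayley_inner x' x = cayley_inner x x'" "cayley_inner y' y = cayley_inner y y'" "cayley_inner z' z = cayley_inner z z'"
    by (rule cayley_inner_commute)+
  show ?thesis
    unfolding X Y jordan_lin.simps add_Pair jordan_det_eq cayley_inner_linear
      1[of x' y z] 1[of x y' z'] 2[of z' x y] 2[of z x' y'] 3[of y' x z] 3[of y x' z'] 4
      cayley_norm_add cayley_mult_add_left cayley_mult_add_right
    by (simp add: algebra_simps)
qed

lemma jordan_lin_scale: "jordan_lin X (jordan_scale r Y) = r * jordan_lin X Y"
  and jordan_lin_scale_left: "jordan_lin (jordan_scale r X) Y = r ^ 2 * jordan_lin X Y"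
  by (cases X; cases Y; simp add: cayley_inner_linear cayley_norm_scale cayley_mult_scale_left
      cayley_mult_scale_right cayley_conj_linear vec.scale_right_diff_distrib algebra_simps power2_eq_square)+

text \<open>Polarization expresses twice the differential through values of the determinant, so it
  acquires the same multiplier. The factor 2 is cancelled in an integral domain of characteristic 0,
  which is possible for p = 2 although 2 is not a unit there.\<close>

lemma jordan_lin_group:
  fixes g :: "'p::prime_card zp jordan \<Rightarrow> 'p zp jordan"
  assumes g: "g \<in> jordan_group" and \<nu>: "\<And>X. jordan_det (g X) = \<nu> * jordan_det X"
  shows "jordan_lin (g X) (g Y) = \<nu> * jordan_lin X Y"
proof -
  have *: "2 * jordan_lin X Y = jordan_det (X + Y) - jordan_det (X + jordan_scale (- 1) Y) + 2 * jordan_det (jordan_scale (- 1) Y)"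
    for X Y :: "'p zp jordan"
    unfolding jordan_det_add jordan_det_scale jordan_lin_scale jordan_lin_scale_left by simp
  have "2 * jordan_lin (g X) (g Y) = 2 * (\<nu> * jordan_lin X Y)"
    unfolding mult.left_commute[of 2] *
    by (simp add: jordan_groupD(1,2)[OF g, symmetric] \<nu> algebra_simps)
  moreover have "(2 :: 'p zp) \<noteq> 0"
  proof
    assume "(2 :: 'p zp) = 0"
    \<comment> \<open>Reduction modulo p^2 suffices for every prime, because p^2 is at least
      4.\<close>
    then have "Rep_zp (of_nat 2 :: 'p zp) 2 = 0" by (simp add: zero_zp.rep_eq)
    then have "int CARD('p) ^ 2 dvd 2" unfolding Rep_zp_of_nat by (simp add: dvd_eq_mod_eq_0)
    then have "int CARD('p) ^ 2 \<le> 2" by (rule zdvd_imp_le) simp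
    moreover have "int CARD('p) ^ 2 \<ge> 2 ^ 2"
      using card_gt_1[where 'p = 'p] by (intro power_mono) auto
    ultimately show False by simp
  qed
  ultimately show ?thesis by simp
qed

text \<open>Divisibility of the adjoint by p^n, tested in all directions. In this form its
  invariance follows from that of the differential, with no formula for the action of the group on
  adjoints.\<close>

definition jordan_lin_dvd :: "nat \<Rightarrow> 'p::prime_card zp jordan \<Rightarrow> bool" where
  "jordan_lin_dvd n X \<longleftrightarrow> (\<forall>Y. \<pi> ^ n dvd jordan_lin X Y)"

lemma jordan_lin_dvd_equiv:
  fixes X Y :: "'p::prime_card zp jordan"
  assumes "X \<sim>\<^sub>J Y"
  shows "jordan_lin_dvd n X \<longleftrightarrow> jordan_lin_dvd n Y"
proof -
  have "jordan_lin_dvd n Y" if XY: "X \<sim>\<^sub>J Y" and X: "jordan_lin_dvd n X" for X Y :: "'p zp jordan"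
  proof -
    obtain g where g: "g \<in> jordan_group" "g X = Y" using XY by (auto simp: jordan_equiv_def)
    then obtain \<nu> where \<nu>: "\<And>X. jordan_det (g X) = \<nu> * jordan_det X" using jordan_groupD(6) by blast
    have "\<pi> ^ n dvd jordan_lin Y Z" for Z
    proof -
      obtain W where "Z = g W" using jordan_groupD(5)[OF g(1)] by (metis bij_pointE)
      then show ?thesis
        using X jordan_lin_group[OF g(1) \<nu>, of X W] g(2) by (simp add: jordan_lin_dvd_def dvd_mult)
    qed
    then show ?thesis by (simp add: jordan_lin_dvd_def)
  qed
  then show ?thesis using assms jordan_equiv_sym by blast
qed

text \<open>On diag(p^i, p^j, p^k) with i \<le> j \<le> k, the contents of the matrix and of its
  adjoint and the valuation of the determinant are i, i + j and i + j + k, so they recover the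
  exponents.\<close>

definition jordan_type :: "nat \<Rightarrow> nat \<Rightarrow> nat \<Rightarrow> 'p::prime_card zp jordan \<Rightarrow> bool" where
  "jordan_type i j k X \<longleftrightarrow> jordan_dvd i X \<and> \<not> jordan_dvd (Suc i) X \<and>
     jordan_lin_dvd (i + j) X \<and> \<not> jordan_lin_dvd (Suc (i + j)) X \<and>
     \<pi> ^ (i + j + k) dvd jordan_det X \<and> \<not> \<pi> ^ Suc (i + j + k) dvd jordan_det X"

lemma zp_power_dvd_power: "\<pi> ^ m dvd (\<pi> ^ n :: 'p::prime_card zp) \<longleftrightarrow> m \<le> n"
  using zp_power_dvd_power_iff[of 1 m n] zp_prime_not_unit by simp

lemma jordan_invariants_diag:
  assumes "i \<le> j" "j \<le> k"
  defines "X \<equiv> jordan_diag (\<pi> ^ i) (\<pi> ^ j) (\<pi> ^ k) :: 'p::prime_card zp jordan"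
  shows "jordan_dvd n X \<longleftrightarrow> n \<le> i" "jordan_lin_dvd n X \<longleftrightarrow> n \<le> i + j"
    "\<pi> ^ n dvd jordan_det X \<longleftrightarrow> n \<le> i + j + k"
proof -
  show "jordan_dvd n X \<longleftrightarrow> n \<le> i"
    using assms by (auto simp: X_def jordan_diag_def zp_power_dvd_power)
  show "jordan_lin_dvd n X \<longleftrightarrow> n \<le> i + j"
  proof
    assume "jordan_lin_dvd n X"
    then have "\<pi> ^ n dvd jordan_lin X (jordan_diag 0 0 1)" by (simp add: jordan_lin_dvd_def)
    then show "n \<le> i + j"
      by (simp add: X_def jordan_diag_def zp_power_dvd_power flip: power_add)
  next
    assume n: "n \<le> i + j"
    have "\<pi> ^ n dvd jordan_lin X Y" for Y
    proof -
      obtain a' b' c' x' y' z' where Y: "Y = (a', b', c', x', y', z')" by (cases Y)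
      have "jordan_lin X Y = \<pi> ^ (j + k) * a' + \<pi> ^ (i + k) * b' + \<pi> ^ (i + j) * c'"
        by (simp add: X_def jordan_diag_def Y power_add)
      then show ?thesis
        using n assms by (simp add: dvd_add dvd_mult2 zp_power_dvd_power)
    qed
    then show "jordan_lin_dvd n X" by (simp add: jordan_lin_dvd_def)
  qed
  show "\<pi> ^ n dvd jordan_det X \<longleftrightarrow> n \<le> i + j + k"
    by (simp add: X_def zp_power_dvd_power flip: power_add)
qed

lemma jordan_type_iff_equiv:
  fixes X :: "'p::prime_card zp jordan"
  assumes "i \<le> j" "j \<le> k"
  shows "jordan_type i j k X \<longleftrightarrow> X \<sim>\<^sub>J jordan_diag (\<pi> ^ i) (\<pi> ^ j) (\<pi> ^ k)"
proof
  assume X: "jordan_type i j k X"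
  then have "jordan_det X \<noteq> 0" unfolding jordan_type_def by (metis dvd_0_right)
  then obtain i' j' k' where *: "i' \<le> j'" "j' \<le> k'" "X \<sim>\<^sub>J jordan_diag (\<pi> ^ i') (\<pi> ^ j') (\<pi> ^ k')"
    by (rule jordan_diagonalize)
  have "i' = i" "i' + j' = i + j" "i' + j' + k' = i + j + k"
    using X unfolding jordan_type_def jordan_dvd_equiv[OF *(3)] jordan_lin_dvd_equiv[OF *(3)]
      jordan_det_dvd_equiv[OF *(3)] jordan_invariants_diag[OF *(1,2)] by linarith+
  then show "X \<sim>\<^sub>J jordan_diag (\<pi> ^ i) (\<pi> ^ j) (\<pi> ^ k)" using *(3) by simp
next
  assume *: "X \<sim>\<^sub>J jordan_diag (\<pi> ^ i) (\<pi> ^ j) (\<pi> ^ k)"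
  show "jordan_type i j k X"
    unfolding jordan_type_def jordan_dvd_equiv[OF *] jordan_lin_dvd_equiv[OF *]
      jordan_det_dvd_equiv[OF *] jordan_invariants_diag[OF assms] by simp
qed

lemma jordan_orbit_eq:
  assumes "i \<le> j" "j \<le> k"
  shows "{g (jordan_diag (\<pi> ^ i) (\<pi> ^ j) (\<pi> ^ k)) | g. g \<in> jordan_group}
    = {X :: 'p::prime_card zp jordan. jordan_type i j k X}"
  unfolding jordan_type_iff_equiv[OF assms]
proof (intro equalityI subsetI)
  fix X assume "X \<in> {g (jordan_diag (\<pi> ^ i) (\<pi> ^ j) (\<pi> ^ k)) | g. g \<in> jordan_group}"
  then have "jordan_diag (\<pi> ^ i) (\<pi> ^ j) (\<pi> ^ k) \<sim>\<^sub>J X" unfolding jordan_equiv_def by blast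
  then show "X \<in> {X. X \<sim>\<^sub>J jordan_diag (\<pi> ^ i) (\<pi> ^ j) (\<pi> ^ k)}" by (simp add: jordan_equiv_sym)
next
  fix X assume "X \<in> {X. X \<sim>\<^sub>J jordan_diag (\<pi> ^ i) (\<pi> ^ j) (\<pi> ^ k)}"
  then have "jordan_diag (\<pi> ^ i) (\<pi> ^ j) (\<pi> ^ k) \<sim>\<^sub>J X" by (simp add: jordan_equiv_sym)
  then show "X \<in> {g (jordan_diag (\<pi> ^ i) (\<pi> ^ j) (\<pi> ^ k)) | g. g \<in> jordan_group}"
    unfolding jordan_equiv_def by blast
qed

section \<open>Counting over a finite field\<close>

lemma card_additive_fibers:
  fixes f :: "'v::{finite, ab_group_add} \<Rightarrow> 'w::ab_group_add"
  assumes W: "\<And>v w. v \<in> W \<Longrightarrow> w \<in> W \<Longrightarrow> v - w \<in> W" "\<And>v w. v \<in> W \<Longrightarrow> w \<in> W \<Longrightarrow> v + w \<in> W"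
    and f: "\<And>v w. f (v + w) = f v + f w" "\<And>v w. f (v - w) = f v - f w"
  shows "u \<in> W \<Longrightarrow> card {w \<in> W. f w = f u} = card {w \<in> W. f w = 0}"
    and "card W = card (f ` W) * card {w \<in> W. f w = 0}"
proof -
  have *: "card {w \<in> W. f w = f u} = card {w \<in> W. f w = 0}" if u: "u \<in> W" for u
    by (rule bij_betw_same_card[of "\<lambda>w. w - u"], rule bij_betw_byWitness[where f' = "\<lambda>w. w + u"])
      (use u in \<open>auto simp: f intro: W\<close>)
  show "u \<in> W \<Longrightarrow> card {w \<in> W. f w = f u} = card {w \<in> W. f w = 0}" by (rule *)
  have "card W = (\<Sum>y\<in>f ` W. card {w \<in> W. f w = y})"
    using sum.image_gen[of W "\<lambda>_. 1 :: nat" f] by simp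
  also have "\<dots> = (\<Sum>y\<in>f ` W. card {w \<in> W. f w = 0})"
    by (rule sum.cong) (auto simp: *)
  finally show "card W = card (f ` W) * card {w \<in> W. f w = 0}" by simp
qed

lemma card_functional_fibers:
  fixes f :: "'v::{finite, ab_group_add} \<Rightarrow> 'a::{finite, field}"
  assumes W: "\<And>v w. v \<in> W \<Longrightarrow> w \<in> W \<Longrightarrow> v - w \<in> W" "\<And>v w. v \<in> W \<Longrightarrow> w \<in> W \<Longrightarrow> v + w \<in> W"
    and f: "\<And>v w. f (v + w) = f v + f w" "\<And>v w. f (v - w) = f v - f w"
    and s: "\<And>r v. v \<in> W \<Longrightarrow> s r v \<in> W" "\<And>r v. f (s r v) = r * f v"
    and w: "w \<in> W" "f w \<noteq> 0"
  shows "CARD('a) * card {w \<in> W. f w = t} = card W"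
proof -
  have im: "t \<in> f ` W" for t
    using s(1)[OF w(1), of "t / f w"] s(2)[of "t / f w" w] w(2) by (intro image_eqI[of _ f "s (t / f w) w"]) auto
  then have "f ` W = UNIV" by blast
  moreover obtain u where "u \<in> W" "t = f u" using im by blast
  ultimately show ?thesis
    using card_additive_fibers[of W f, OF W f] by simp
qed


lemma card_filter_sum: "finite A \<Longrightarrow> card {x \<in> A. P x} = (\<Sum>x\<in>A. if P x then 1 else 0)"
  by (simp flip: sum.inter_filter)

lemma sum_card_swap:
  assumes "finite A" "finite B"
  shows "(\<Sum>v\<in>A. card {w \<in> B. P v w}) = (\<Sum>w\<in>B. card {v \<in> A. P v w})"
proof -
  have "(\<Sum>v\<in>A. card {w \<in> B. P v w}) = (\<Sum>v\<in>A. \<Sum>w\<in>B. if P v w then 1 else 0)"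
    using assms by (simp add: card_filter_sum)
  also have "\<dots> = (\<Sum>w\<in>B. \<Sum>v\<in>A. if P v w then 1 else 0)" by (rule sum.swap)
  also have "\<dots> = (\<Sum>w\<in>B. card {v \<in> A. P v w})"
    using assms by (simp add: card_filter_sum)
  finally show ?thesis .
qed

lemma sum_if_card:
  fixes c d :: nat
  assumes "finite A"
  shows "(\<Sum>x\<in>A. if P x then c else d) = card {x \<in> A. P x} * c + card {x \<in> A. \<not> P x} * d"
  using assms by (simp add: sum.If_cases Int_def Collect_neg_eq[symmetric] conj_commute)

section \<open>Totally isotropic subspaces and null vectors of the norm\<close>

definition cayley_subspace :: "'a::comm_ring_1 cayley set \<Rightarrow> bool" where
  "cayley_subspace W \<longleftrightarrow> 0 \<in> W \<and> (\<forall>v\<in>W. \<forall>w\<in>W. v + w \<in> W) \<and> (\<forall>r. \<forall>v\<in>W. r *s v \<in> W)"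

lemma cayley_subspaceD:
  assumes "cayley_subspace W"
  shows "0 \<in> W" "v \<in> W \<Longrightarrow> w \<in> W \<Longrightarrow> v + w \<in> W" "v \<in> W \<Longrightarrow> w \<in> W \<Longrightarrow> v - w \<in> W"
    "v \<in> W \<Longrightarrow> r *s v \<in> W"
proof -
  show *: "0 \<in> W" "v \<in> W \<Longrightarrow> w \<in> W \<Longrightarrow> v + w \<in> W" "v \<in> W \<Longrightarrow> r *s v \<in> W" for v w r
    using assms by (auto simp: cayley_subspace_def)
  show "v \<in> W \<Longrightarrow> w \<in> W \<Longrightarrow> v - w \<in> W"
    using *(2)[of v "(- 1) *s w"] *(3)[of w "- 1"] by (simp flip: vector_sneg_minus1)
qed

lemma card_inner_fibers:
  fixes W :: "'a::{finite, field} cayley set"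
  assumes W: "cayley_subspace W" and v: "w \<in> W" "cayley_inner v w \<noteq> 0"
  shows "CARD('a) * card {w \<in> W. cayley_inner v w = t} = card W"
  by (rule card_functional_fibers[where s = "(*s)" and w = w])
    (auto simp: cayley_inner_linear v intro: cayley_subspaceD[OF W])

lemma cayley_nondegenerate:
  assumes "v \<noteq> 0"
  obtains w where "cayley_inner v w \<noteq> 0"
proof -
  obtain i where "v $ i \<noteq> 0" using assms by (auto simp: vec_eq_iff)
  then show thesis using cayley_dual_basis[of i] that by metis
qed

text \<open>Double counting of orthogonal pairs (v, w) with w in W. For fixed v the condition cuts W
  down by the factor q unless v is orthogonal to W; for fixed w it cuts the whole space down by q
  unless w = 0. The comparison gives the product after cancelling q - 1.\<close>

lemma card_perp:
  fixes W :: "'a::{finite, field} cayley set"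
  assumes W: "cayley_subspace W"
  shows "card {v. \<forall>w\<in>W. cayley_inner v w = 0} * card W = CARD('a) ^ 8"
proof -
  let ?q = "CARD('a)" and ?P = "{v. \<forall>w\<in>W. cayley_inner v w = 0}"
  have q: "?q > 1" using card_mono[of UNIV "{0, 1 :: 'a}"] by simp
  have UNIV: "cayley_subspace (UNIV :: 'a cayley set)" by (simp add: cayley_subspace_def)
  have cU: "card (UNIV :: 'a cayley set) = ?q ^ 8" by (simp add: CARD_vec)
  let ?S = "\<Sum>v\<in>UNIV. card {w \<in> W. cayley_inner v w = 0}"
  have "?q * ?S = (\<Sum>v\<in>UNIV. if v \<in> ?P then ?q * card W else card W)"
    unfolding sum_distrib_left
  proof (rule sum.cong[OF refl])
    fix v :: "'a cayley"
    have "{w \<in> W. cayley_inner v w = 0} = W" if "v \<in> ?P" using that by auto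
    moreover have "?q * card {w \<in> W. cayley_inner v w = 0} = card W" if "v \<notin> ?P"
      using that card_inner_fibers[OF W] by blast
    ultimately show "?q * card {w \<in> W. cayley_inner v w = 0} = (if v \<in> ?P then ?q * card W else card W)"
      by auto
  qed
  also have "\<dots> = card ?P * (?q * card W) + (?q ^ 8 - card ?P) * card W"
  proof -
    have "{v \<in> UNIV. v \<notin> ?P} = UNIV - ?P" by auto
    then have "card {v \<in> UNIV. v \<notin> ?P} = ?q ^ 8 - card ?P"
      using cU card_Diff_subset[of ?P UNIV] by simp
    then show ?thesis by (subst sum_if_card) simp_all
  qed
  finally have 1: "?q * ?S = card ?P * (?q * card W) + (?q ^ 8 - card ?P) * card W" .
  define S where "S = ?q * ?S"
  have "?S = (\<Sum>w\<in>W. card {v \<in> UNIV. cayley_inner v w = 0})" by (rule sum_card_swap) simp_all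
  also have "?q * \<dots> = (\<Sum>w\<in>W. if w = 0 then ?q * ?q ^ 8 else ?q ^ 8)"
    unfolding sum_distrib_left
  proof (rule sum.cong[OF refl])
    fix w :: "'a cayley"
    show "?q * card {v \<in> UNIV. cayley_inner v w = 0} = (if w = 0 then ?q * ?q ^ 8 else ?q ^ 8)"
    proof (cases "w = 0")
      case False
      then obtain v where "cayley_inner w v \<noteq> 0" by (rule cayley_nondegenerate)
      then have "?q * card {v \<in> UNIV. cayley_inner w v = 0} = ?q ^ 8"
        using card_inner_fibers[OF UNIV, of v w 0] by (simp add: cU)
      then show ?thesis using False by (simp add: cayley_inner_commute[of _ w])
    qed (simp add: cU)
  qed
  also have "\<dots> = ?q * ?q ^ 8 + (card W - 1) * ?q ^ 8"
  proof -
    have "{w \<in> W. w = 0} = {0}" "{w \<in> W. w \<noteq> 0} = W - {0}" using cayley_subspaceD(1)[OF W] by auto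
    then show ?thesis using cayley_subspaceD(1)[OF W] by (subst sum_if_card) simp_all
  qed
  finally have 2: "?q * ?S = ?q * ?q ^ 8 + (card W - 1) * ?q ^ 8" .
  have P: "card ?P \<le> ?q ^ 8" using card_mono[of "UNIV :: 'a cayley set" ?P] cU by simp
  have W1: "card W \<ge> 1" using cayley_subspaceD(1)[OF W] by (simp add: Suc_le_eq card_gt_0_iff) auto
  have "int S = int (card ?P) * (int ?q * int (card W)) + (int (?q ^ 8) - int (card ?P)) * int (card W)"
    unfolding S_def 1 of_nat_add of_nat_mult of_nat_diff[OF P] ..
  moreover have "int S = int ?q * int (?q ^ 8) + (int (card W) - 1) * int (?q ^ 8)"
    unfolding S_def 2 of_nat_add of_nat_mult of_nat_diff[OF W1] by simp
  ultimately have e: "(int ?q - 1) * (int (card ?P) * int (card W)) = (int ?q - 1) * int (?q ^ 8)"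
    by (simp add: algebra_simps)
  have n: "int ?q - 1 \<noteq> 0" using q by simp
  have "int (card ?P) * int (card W) = int (?q ^ 8)" by (rule iffD1[OF mult_left_cancel[OF n] e])
  then show ?thesis by (simp only: of_nat_mult[symmetric] of_nat_eq_iff)
qed

definition cayley_ker :: "'a::comm_ring_1 cayley \<Rightarrow> 'a cayley set" where
  "cayley_ker x = {z. cayley_mult x z = 0}"

lemma cayley_subspace_ker: "cayley_subspace (cayley_ker x)"
  by (simp add: cayley_subspace_def cayley_ker_def cayley_mult_add_right cayley_mult_scale_right)

lemma cayley_subspace_range: "cayley_subspace (range (cayley_mult x))"
  unfolding cayley_subspace_def
  by (auto simp: image_iff intro: exI[of _ 0] cayley_mult_add_right[symmetric] cayley_mult_scale_right[symmetric])

lemma cayley_norm_ker: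
  assumes "x \<noteq> 0" "z \<in> cayley_ker (x :: 'a::idom cayley)"
  shows "cayley_norm z = 0"
proof -
  have "cayley_norm z *s x = 0"
    using cayley_mult_conj_right[of x z] assms(2) by (simp add: cayley_ker_def)
  then show ?thesis using assms(1) by (auto simp: vec_eq_iff)
qed

lemma isotropic_inner:
  assumes "cayley_subspace W" "\<And>w. w \<in> W \<Longrightarrow> cayley_norm w = 0" "v \<in> W" "w \<in> W"
  shows "cayley_inner v w = 0"
  using cayley_norm_add[of v w] assms(2)[of v] assms(2)[of w] assms(2)[of "v + w"]
    cayley_subspaceD(2)[OF assms(1)] assms by simp

text \<open>Such a W lies in its own orthogonal complement, so the square of its size is at most
  q^8.\<close>

lemma card_isotropic_le:
  fixes W :: "'a::{finite, field} cayley set"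
  assumes W: "cayley_subspace W" "\<And>w. w \<in> W \<Longrightarrow> cayley_norm w = 0"
  shows "card W \<le> CARD('a) ^ 4"
proof -
  have "W \<subseteq> {v. \<forall>w\<in>W. cayley_inner v w = 0}" using isotropic_inner[OF W] by auto
  then have "card W * card W \<le> card {v. \<forall>w\<in>W. cayley_inner v w = 0} * card W"
    by (intro mult_right_mono card_mono) auto
  then have "card W ^ 2 \<le> (CARD('a) ^ 4) ^ 2"
    unfolding card_perp[OF W(1)] by (simp add: power2_eq_square flip: power_add)
  then show ?thesis by (rule power2_le_imp_le) simp
qed

text \<open>For isotropic \<open>x\<close> the kernel and the image of left multiplication by \<open>x\<close> are totally isotropic,
  hence of dimension at most \<open>4\<close>; as the dimensions add up to \<open>8\<close>, both are equal to \<open>4\<close>.\<close>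

lemma card_cayley_ker_range:
  fixes x :: "'a::{finite, field} cayley"
  assumes "x \<noteq> 0" "cayley_norm x = 0"
  shows "card (cayley_ker x) = CARD('a) ^ 4" "card (range (cayley_mult x)) = CARD('a) ^ 4"
proof -
  let ?q = "CARD('a)"
  have 1: "card (cayley_ker x) \<le> ?q ^ 4"
    by (rule card_isotropic_le[OF cayley_subspace_ker]) (rule cayley_norm_ker[OF assms(1)])
  have 2: "card (range (cayley_mult x)) \<le> ?q ^ 4"
    by (rule card_isotropic_le[OF cayley_subspace_range]) (auto simp: cayley_norm_mult assms)
  have "card (UNIV :: 'a cayley set) = card (range (cayley_mult x)) * card {w \<in> UNIV. cayley_mult x w = 0}"
    by (rule card_additive_fibers) (simp_all add: cayley_mult_add_right cayley_mult_diff_right)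
  then have 3: "card (range (cayley_mult x)) * card (cayley_ker x) = ?q ^ 4 * ?q ^ 4"
    by (simp add: CARD_vec cayley_ker_def flip: power_add)
  have q: "?q ^ 4 > 0" by simp
  show "card (cayley_ker x) = ?q ^ 4"
  proof (rule antisym[OF 1])
    have "?q ^ 4 * ?q ^ 4 \<le> ?q ^ 4 * card (cayley_ker x)" unfolding 3[symmetric] by (rule mult_right_mono[OF 2]) simp
    then show "?q ^ 4 \<le> card (cayley_ker x)" by (simp only: nat_mult_le_cancel1[OF q])
  qed
  then have "card (range (cayley_mult x)) * ?q ^ 4 = ?q ^ 4 * ?q ^ 4" using 3 by simp
  then show "card (range (cayley_mult x)) = ?q ^ 4" using q by (metis mult_right_cancel less_not_refl)
qed

text \<open>The alternative law x' (x y) = N(x) y = 0 gives one inclusion, and both sides have q^4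
  elements.\<close>

lemma cayley_range_eq_ker:
  fixes x :: "'a::{finite, field} cayley"
  assumes "x \<noteq> 0" "cayley_norm x = 0"
  shows "range (cayley_mult x) = cayley_ker (cayley_conj x)"
proof (rule card_subset_eq)
  show "range (cayley_mult x) \<subseteq> cayley_ker (cayley_conj x)"
    using assms(2) by (auto simp: cayley_ker_def cayley_mult_conj_left')
  show "card (range (cayley_mult x)) = card (cayley_ker (cayley_conj x))"
    using card_cayley_ker_range(1)[of "cayley_conj x"] card_cayley_ker_range(2)[of x] assms by simp
qed simp

text \<open>Null vectors are averaged over the translates by K, the kernel of left multiplication by
  a nonzero null vector. For w in K the value N(v + w) = N(v) + (v, w) is affine in w. It vanishes
  on all of K if v is in K, and has q^3 zeros otherwise, because K is its own orthogonal
  complement.\<close>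

lemma card_cayley_null:
  shows "card {x :: 'a::{finite, field} cayley. cayley_norm x = 0} = CARD('a) ^ 4 + (CARD('a) ^ 4 - 1) * CARD('a) ^ 3"
proof -
  let ?q = "CARD('a)" and ?Z = "card {x :: 'a cayley. cayley_norm x = 0}"
  obtain x :: "'a cayley" where x: "cayley_norm x = 0" "x \<noteq> 0"
    using cayley_norm_field_surj[of 0] by (metis zero_index zero_neq_one)
  let ?K = "cayley_ker x"
  have K: "card ?K = ?q ^ 4" "\<And>w. w \<in> ?K \<Longrightarrow> cayley_norm w = 0"
    using card_cayley_ker_range[OF x(2,1)] cayley_norm_ker[OF x(2)] by auto
  have "?K = {v. \<forall>w\<in>?K. cayley_inner v w = 0}"
  proof (rule card_subset_eq)
    show "?K \<subseteq> {v. \<forall>w\<in>?K. cayley_inner v w = 0}"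
      using isotropic_inner[OF cayley_subspace_ker K(2)] by auto
    have e: "card {v. \<forall>w\<in>?K. cayley_inner v w = 0} * ?q ^ 4 = ?q ^ 4 * ?q ^ 4"
      using card_perp[OF cayley_subspace_ker[of x]] by (simp add: K flip: power_add)
    have n: "?q ^ 4 \<noteq> 0" by simp
    show "card ?K = card {v. \<forall>w\<in>?K. cayley_inner v w = 0}"
      unfolding K by (rule iffD1[OF mult_right_cancel[OF n] e, symmetric])
  qed simp
  then have perp: "v \<notin> ?K \<Longrightarrow> \<exists>w\<in>?K. cayley_inner v w \<noteq> 0" for v by blast
  have q: "?q > 0" by simp
  have "?q ^ 4 * ?Z = (\<Sum>w\<in>?K. card {v \<in> UNIV. cayley_norm (v + w) = 0})"
  proof -
    have "card {v \<in> UNIV. cayley_norm (v + w) = 0} = ?Z" for w :: "'a cayley"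
      by (rule bij_betw_same_card[of "\<lambda>v. v + w"], rule bij_betw_byWitness[where f' = "\<lambda>v. v - w"]) auto
    then show ?thesis by (simp add: K)
  qed
  also have "\<dots> = (\<Sum>v\<in>UNIV. card {w \<in> ?K. cayley_norm (v + w) = 0})"
    by (rule sum_card_swap[symmetric]) simp_all
  also have "\<dots> = (\<Sum>v\<in>UNIV. if v \<in> ?K then ?q ^ 4 else ?q ^ 3)"
  proof (rule sum.cong[OF refl])
    fix v :: "'a cayley"
    have eq: "{w \<in> ?K. cayley_norm (v + w) = 0} = {w \<in> ?K. cayley_inner v w = - cayley_norm v}"
      using K(2) by (auto simp: cayley_norm_add add_eq_0_iff)
    show "card {w \<in> ?K. cayley_norm (v + w) = 0} = (if v \<in> ?K then ?q ^ 4 else ?q ^ 3)"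
    proof (cases "v \<in> ?K")
      case True
      then have "{w \<in> ?K. cayley_norm (v + w) = 0} = ?K"
        using K(2) cayley_subspaceD(2)[OF cayley_subspace_ker] by blast
      then show ?thesis using True by (simp add: K)
    next
      case False
      then obtain w where "w \<in> ?K" "cayley_inner v w \<noteq> 0" using perp by blast
      then have "?q * card {w \<in> ?K. cayley_inner v w = - cayley_norm v} = ?q * ?q ^ 3"
        using card_inner_fibers[OF cayley_subspace_ker, of w x v "- cayley_norm v"]
        by (simp add: K eval_nat_numeral)
      then show ?thesis unfolding eq using False q by simp
    qed
  qed
  also have "\<dots> = ?q ^ 4 * ?q ^ 4 + (?q ^ 8 - ?q ^ 4) * ?q ^ 3"
  proof -
    have "{v \<in> UNIV. v \<notin> ?K} = UNIV - ?K" by auto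
    then have "card {v \<in> UNIV. v \<notin> ?K} = ?q ^ 8 - ?q ^ 4"
      using card_Diff_subset[of ?K UNIV] by (simp add: K CARD_vec)
    then show ?thesis by (subst sum_if_card) (simp_all add: K)
  qed
  also have "?q ^ 8 - ?q ^ 4 = ?q ^ 4 * (?q ^ 4 - 1)" by (simp add: diff_mult_distrib2 flip: power_add)
  finally have "?q ^ 4 * ?Z = ?q ^ 4 * (?q ^ 4 + (?q ^ 4 - 1) * ?q ^ 3)" by (simp add: algebra_simps)
  then show ?thesis using q by simp
qed

section \<open>Counting matrices by their first row\<close>

definition block_norm :: "'a::comm_ring_1 \<Rightarrow> 'a \<Rightarrow> 'a cayley \<Rightarrow> 'a" where
  "block_norm b c z = b * c - cayley_norm z"

lemma card_Collect_pairs: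
  "card {(x :: 'a::finite, y :: 'b::finite). P x y} = (\<Sum>x\<in>UNIV. card {y. P x y})"
proof -
  have "{(x, y). P x y} = Sigma UNIV (\<lambda>x. {y. P x y})" by auto
  then show ?thesis by simp
qed

lemma sum_UNIV_0:
  fixes f :: "'b::{finite, zero} \<Rightarrow> nat"
  assumes "\<And>x. x \<noteq> 0 \<Longrightarrow> f x = c"
  shows "(\<Sum>x\<in>UNIV. f x) = f 0 + (CARD('b) - 1) * c"
proof -
  have "(\<Sum>x\<in>UNIV. f x) = f 0 + (\<Sum>x\<in>UNIV - {0}. f x)" by (rule sum.remove) simp_all
  also have "(\<Sum>x\<in>UNIV - {0}. f x) = (\<Sum>x\<in>UNIV - {0 :: 'b}. c)"
    by (rule sum.cong) (simp_all add: assms)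
  finally show ?thesis by (simp add: card_Diff_singleton)
qed

text \<open>For nonzero b the entry c is determined by z; for b = 0 it is free and z has to be a
  null vector.\<close>

lemma card_block_null:
  "card {(b, c, z :: 'a cayley). block_norm b c z = 0}
     = CARD('a) * card {z :: 'a::{finite, field} cayley. cayley_norm z = 0} + (CARD('a) - 1) * CARD('a) ^ 8"
proof -
  have "card {(c, z :: 'a cayley). block_norm b c z = 0}
      = (if b = 0 then CARD('a) * card {z :: 'a cayley. cayley_norm z = 0} else CARD('a) ^ 8)" for b
  proof (cases "b = 0")
    case True
    have "{(c :: 'a, z :: 'a cayley). block_norm 0 c z = 0} = UNIV \<times> {z. cayley_norm z = 0}"
      by (auto simp: block_norm_def)
    then show ?thesis using True by (simp add: card_cartesian_product)
  next
    case False
    have "bij_betw (\<lambda>z. (cayley_norm z / b, z)) UNIV {(c, z). block_norm b c z = 0}"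
      by (rule bij_betw_byWitness[where f' = snd]) (use False in \<open>auto simp: block_norm_def field_simps\<close>)
    then show ?thesis using False by (simp add: bij_betw_same_card[symmetric] CARD_vec)
  qed
  then show ?thesis
    by (subst card_Collect_pairs) (simp add: sum_UNIV_0[where c = "CARD('a) ^ 8"])
qed

text \<open>The first row is summed on the outside, because for a fixed first row the conditions on
  (b, c, z) can be solved directly.\<close>

lemma card_jordan_split:
  "card {X :: 'a::{finite, comm_ring_1} jordan. P X}
     = (\<Sum>a\<in>UNIV. \<Sum>x\<in>UNIV. \<Sum>y\<in>UNIV. card {(b, c, z). P (a, b, c, x, y, z)})"
proof -
  let ?S = "Sigma UNIV (\<lambda>a. Sigma UNIV (\<lambda>x. Sigma UNIV (\<lambda>y. {(b, c, z). P (a, b, c, x, y, z)})))"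
  have "bij_betw (\<lambda>(a, x, y, b, c, z). (a, b, c, x, y, z)) ?S {X. P X}"
    by (rule bij_betw_byWitness[where f' = "\<lambda>(a, b, c, x, y, z). (a, x, y, b, c, z)"]) auto
  then have "card {X. P X} = card ?S" by (simp only: bij_betw_same_card)
  then show ?thesis by simp
qed

text \<open>The Schur complement of the corner \<open>a\<close>, multiplied by \<open>a\<close> to
  avoid division. Its entries are entries of the adjoint, up to the sign of the Cayley
  entry.\<close>

lemma chart_identity:
  fixes a :: "'a::idom"
  shows "a * jordan_det (a, b, c, x, y, z)
    = block_norm (a * b - cayley_norm x) (a * c - cayley_norm y) (a *s z - cayley_mult (cayley_conj x) y)"
proof -
  have "cayley_norm (a *s z - cayley_mult (cayley_conj x) y)
      = a ^ 2 * cayley_norm z - a * cayley_inner (cayley_mult x z) y + cayley_norm x * cayley_norm y"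
    using cayley_norm_add[of "a *s z" "- cayley_mult (cayley_conj x) y"]
    by (simp add: cayley_norm_scale cayley_inner_linear cayley_norm_mult cayley_inner_mult_left)
  then show ?thesis
    unfolding jordan_det_eq block_norm_def by (simp add: algebra_simps power2_eq_square)
qed

lemma chart_bij:
  fixes a :: "'a::field"
  assumes "a \<noteq> 0"
  shows "bij (\<lambda>(b, c, z). (a * b - r, a * c - s, a *s z - v :: 'a cayley))"
  by (rule bij_betw_byWitness[where f' = "\<lambda>(b, c, z). ((b + r) / a, (c + s) / a, inverse a *s (z + v))"])
    (use assms in \<open>auto simp: vec_eq_iff field_simps\<close>)

text \<open>For a nonzero null x the solutions y form the kernel of left multiplication by its
  conjugate, which consists of q^4 null vectors. For x = 0 every null y is a solution.\<close>

lemma card_null_pairs: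
  "card {(x :: 'a::{finite, field} cayley, y). cayley_norm x = 0 \<and> cayley_norm y = 0 \<and> cayley_mult (cayley_conj x) y = 0}
    = (let Z = card {z :: 'a cayley. cayley_norm z = 0} in Z + (Z - 1) * CARD('a) ^ 4)"
proof -
  let ?N = "{z :: 'a cayley. cayley_norm z = 0}"
  have "card {y. cayley_norm x = 0 \<and> cayley_norm y = 0 \<and> cayley_mult (cayley_conj x) y = 0}
      = (if x \<in> ?N - {0} then CARD('a) ^ 4 else if x = 0 then card ?N else 0)" for x :: "'a cayley"
  proof (cases "x \<in> ?N - {0}")
    case True
    then have "{y. cayley_norm x = 0 \<and> cayley_norm y = 0 \<and> cayley_mult (cayley_conj x) y = 0} = cayley_ker (cayley_conj x)"
      using cayley_norm_ker[of "cayley_conj x"] by (auto simp: cayley_ker_def)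
    then show ?thesis using True card_cayley_ker_range(1)[of "cayley_conj x"] by simp
  qed auto
  then have "card {(x :: 'a cayley, y). cayley_norm x = 0 \<and> cayley_norm y = 0 \<and> cayley_mult (cayley_conj x) y = 0}
      = (\<Sum>x\<in>UNIV. if x \<in> ?N - {0} then CARD('a) ^ 4 else if x = 0 then card ?N else 0)"
    by (subst card_Collect_pairs) simp
  also have "\<dots> = (card ?N - 1) * CARD('a) ^ 4 + card ?N"
  proof -
    have "{x :: 'a cayley. cayley_norm x = 0 \<and> x \<noteq> 0} = ?N - {0}" by auto
    moreover have "UNIV \<inter> - (?N - {0}) = insert 0 (- ?N)" by auto
    ultimately have "card {x :: 'a cayley. cayley_norm x = 0 \<and> x \<noteq> 0} = card ?N - 1"
      "(\<Sum>x\<in>UNIV \<inter> - (?N - {0}). if x = 0 then card ?N else 0) = card ?N" by (simp_all add: card_Diff_singleton)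
    then show ?thesis by (subst sum.If_cases) simp_all
  qed
  finally show ?thesis by (simp add: Let_def)
qed

lemma card_linear_nonzero:
  fixes r s :: "'a::{finite, field}" and v :: "'a cayley"
  assumes "r \<noteq> 0 \<or> s \<noteq> 0 \<or> v \<noteq> 0"
  shows "card {(b, c, z). r * b + s * c + cayley_inner v z \<noteq> 0} = CARD('a) ^ 10 - CARD('a) ^ 9"
proof -
  let ?q = "CARD('a)" and ?f = "\<lambda>(b, c, z). r * b + s * c + cayley_inner v z"
  have "\<exists>X. ?f X \<noteq> 0"
  proof -
    consider "r \<noteq> 0" | "s \<noteq> 0" | "v \<noteq> 0" using assms by blast
    then show ?thesis
    proof cases
      case 1 then show ?thesis by (intro exI[of _ "(1, 0, 0)"]) simp
    next
      case 2 then show ?thesis by (intro exI[of _ "(0, 1, 0)"]) simp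
    next
      case 3
      then obtain w where "cayley_inner v w \<noteq> 0" by (rule cayley_nondegenerate)
      then show ?thesis by (intro exI[of _ "(0, 0, w)"]) simp
    qed
  qed
  then obtain X where "?f X \<noteq> 0" by blast
  then have "?q * card {X \<in> UNIV. ?f X = 0} = card (UNIV :: ('a \<times> 'a \<times> 'a cayley) set)"
    by (intro card_functional_fibers[where s = "\<lambda>t (b, c, z). (t * b, t * c, t *s z)" and w = X])
      (auto simp: cayley_inner_linear algebra_simps)
  also have "\<dots> = ?q * ?q ^ 9"
    by (simp add: CARD_vec eval_nat_numeral)
  finally have 1: "card {X. ?f X = 0} = ?q ^ 9" by simp
  have "{(b, c, z). r * b + s * c + cayley_inner v z \<noteq> 0} = UNIV - {X. ?f X = 0}" by auto
  then have "card {(b, c, z). r * b + s * c + cayley_inner v z \<noteq> 0} = card (UNIV :: ('a \<times> 'a \<times> 'a cayley) set) - ?q ^ 9"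
    using 1 by (simp add: card_Diff_subset)
  then show ?thesis by (simp add: CARD_vec eval_nat_numeral)
qed

text \<open>For a nonzero corner the Schur complement maps (b, c, z) bijectively to the arguments of
  the 10-dimensional form. For a = 0 the determinant is linear in (b, c, z) with coefficients -
  N(y), - N(x) and x' y, where ' is conjugation; it vanishes identically exactly on the pairs just
  counted.\<close>

lemma card_jordan_det_nonzero:
  "card {X :: 'a::{finite, field} jordan. jordan_det X \<noteq> 0}
    = (CARD('a) - 1) * CARD('a) ^ 16 * (CARD('a) ^ 10 - card {(b, c, z :: 'a cayley). block_norm b c z = 0})
    + (CARD('a) ^ 16 - card {(x :: 'a cayley, y). cayley_norm x = 0 \<and> cayley_norm y = 0 \<and> cayley_mult (cayley_conj x) y = 0})
      * (CARD('a) ^ 10 - CARD('a) ^ 9)"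
proof -
  let ?q = "CARD('a)"
  let ?B = "{(b, c, z :: 'a cayley). block_norm b c z = 0}"
  let ?P = "{(x :: 'a cayley, y). cayley_norm x = 0 \<and> cayley_norm y = 0 \<and> cayley_mult (cayley_conj x) y = 0}"
  have c3: "card (UNIV :: ('a \<times> 'a \<times> 'a cayley) set) = ?q ^ 10"
    by (simp add: CARD_vec eval_nat_numeral)
  define F where "F a x y = card {(b, c, z). jordan_det (a, b, c, x, y, z) \<noteq> 0}" for a :: 'a and x y
  have 1: "F a x y = ?q ^ 10 - card ?B" if a: "a \<noteq> 0" for a x y
  proof -
    let ?g = "\<lambda>(b, c, z). (a * b - cayley_norm x, a * c - cayley_norm y, a *s z - cayley_mult (cayley_conj x) y)"
    have "jordan_det (a, b, c, x, y, z) \<noteq> 0 \<longleftrightarrow> ?g (b, c, z) \<in> UNIV - ?B" for b c z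
      using chart_identity[of a b c x y z] a by auto
    then have "{(b, c, z). jordan_det (a, b, c, x, y, z) \<noteq> 0} = ?g -` (UNIV - ?B)" by auto
    also have "card \<dots> = card (UNIV - ?B)"
      by (rule card_vimage_inj) (use chart_bij[OF a] in \<open>auto simp: bij_def\<close>)
    also have "\<dots> = ?q ^ 10 - card ?B" using c3 card_Diff_subset[of ?B UNIV] by simp
    finally show ?thesis unfolding F_def .
  qed
  have 2: "F 0 x y = (if (x, y) \<in> ?P then 0 else ?q ^ 10 - ?q ^ 9)" for x y
  proof -
    have eq: "jordan_det (0, b, c, x, y, z)
        = (- cayley_norm y) * b + (- cayley_norm x) * c + cayley_inner (cayley_mult (cayley_conj x) y) z" for b c z
      unfolding jordan_det_eq
      by (simp add: cayley_inner_mult_left cayley_inner_commute[of z])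
    show ?thesis
    proof (cases "(x, y) \<in> ?P")
      case True
      then show ?thesis unfolding F_def eq by simp
    next
      case False
      then show ?thesis unfolding F_def eq
        by (subst card_linear_nonzero) auto
    qed
  qed
  have "card {X :: 'a jordan. jordan_det X \<noteq> 0} = (\<Sum>a\<in>UNIV. \<Sum>x\<in>UNIV. \<Sum>y\<in>UNIV. F a x y)"
    unfolding F_def by (rule card_jordan_split)
  also have "\<dots> = (\<Sum>x\<in>UNIV. \<Sum>y\<in>UNIV. F 0 x y) + (?q - 1) * (?q ^ 16 * (?q ^ 10 - card ?B))"
    by (rule sum_UNIV_0) (simp add: 1 CARD_vec)
  also have "(\<Sum>x\<in>UNIV. \<Sum>y\<in>UNIV. F 0 x y) = (\<Sum>v\<in>UNIV. if v \<in> ?P then 0 else ?q ^ 10 - ?q ^ 9)"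
    unfolding 2 by (simp only: sum.cartesian_product UNIV_Times_UNIV case_prod_unfold prod.collapse)
  also have "\<dots> = card (UNIV - ?P) * (?q ^ 10 - ?q ^ 9)"
    by (subst sum_if_card) (simp_all add: set_diff_eq)
  also have "card (UNIV - ?P) = ?q ^ 16 - card ?P"
    by (simp add: card_Diff_subset CARD_vec)
  finally show ?thesis by (simp only: ac_simps)
qed

text \<open>The six equations say that the adjoint of the matrix is zero.\<close>

definition rank_le_1 :: "'a::comm_ring_1 jordan \<Rightarrow> bool" where
  "rank_le_1 X = (case X of (a, b, c, x, y, z) \<Rightarrow>
     cayley_norm z = b * c \<and> cayley_norm y = a * c \<and> cayley_norm x = a * b \<and>
     cayley_mult y (cayley_conj z) = c *s x \<and> cayley_mult x z = b *s y \<and>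
     cayley_mult (cayley_conj x) y = a *s z)"

text \<open>With a nonzero corner the first row determines the rest. With a = 0, both x and y are
  null. If both vanish, the null cone of the block remains. If only x vanishes, then b = 0, c is
  free, and the conjugate of z is annihilated by y. If x is nonzero, y runs through the q^4 products
  x s, with q^5 blocks for each.\<close>

lemma card_rank_le_1:
  defines "Z \<equiv> card {z :: 'a::{finite, field} cayley. cayley_norm z = 0}"
  shows "card {X :: 'a jordan. rank_le_1 X}
    = (CARD('a) - 1) * CARD('a) ^ 16 + card {(b, c, z :: 'a cayley). block_norm b c z = 0}
      + (Z - 1) * CARD('a) ^ 5 + (Z - 1) * CARD('a) ^ 9"
proof -
  let ?q = "CARD('a)"
  let ?B = "{(b, c, z :: 'a cayley). block_norm b c z = 0}" and ?N = "{z :: 'a cayley. cayley_norm z = 0}"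
  define F where "F a x y = card {(b, c, z). rank_le_1 (a, b, c, x, y, z)}" for a :: 'a and x y
  have 1: "F a x y = 1" if a: "a \<noteq> 0" for a x y
  proof -
    let ?b = "cayley_norm x / a" and ?c = "cayley_norm y / a" and ?z = "inverse a *s cayley_mult (cayley_conj x) y"
    have "{(b, c, z). rank_le_1 (a, b, c, x, y, z)} = {(?b, ?c, ?z)}"
    proof (intro equalityI subsetI)
      fix X assume "X \<in> {(b, c, z). rank_le_1 (a, b, c, x, y, z)}"
      then obtain b c z where X: "X = (b, c, z)" "rank_le_1 (a, b, c, x, y, z)" by auto
      then show "X \<in> {(?b, ?c, ?z)}"
        using a by (auto simp: rank_le_1_def vector_smult_assoc)
    next
      have "rank_le_1 (a, ?b, ?c, x, y, ?z)"
        using a by (simp add: rank_le_1_def cayley_norm_scale cayley_norm_mult cayley_conj_linear cayley_conj_mult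
            cayley_mult_scale_right cayley_mult_conj_left vector_smult_assoc power2_eq_square field_simps)
      then show "X \<in> {(b, c, z). rank_le_1 (a, b, c, x, y, z)}" if "X \<in> {(?b, ?c, ?z)}" for X
        using that by simp
    qed
    then show ?thesis by (simp add: F_def)
  qed
  have 2: "F 0 0 y = (if y \<in> ?N - {0} then ?q ^ 5 else if y = 0 then card ?B else 0)" for y
  proof (cases "y \<in> ?N - {0}")
    case True
    have "rank_le_1 (0, b, c, 0, y, z) \<longleftrightarrow> b = 0 \<and> cayley_conj z \<in> cayley_ker y" for b c z
    proof -
      have "cayley_norm z = 0" if "cayley_mult y (cayley_conj z) = 0"
        using True cayley_norm_ker[of y "cayley_conj z"] that by (simp add: cayley_ker_def)
      moreover have "b *s y = 0 \<longleftrightarrow> b = 0" using True by (simp add: vector_mul_eq_0)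
      ultimately show ?thesis using True by (auto simp: rank_le_1_def cayley_ker_def)
    qed
    then have "{(b, c, z). rank_le_1 (0, b, c, 0, y, z)} = {0} \<times> (UNIV :: 'a set) \<times> cayley_conj -` cayley_ker y"
      by auto
    moreover have "card (cayley_conj -` cayley_ker y) = ?q ^ 4"
    proof -
      have "inj (cayley_conj :: 'a cayley \<Rightarrow> _)" "surj (cayley_conj :: 'a cayley \<Rightarrow> _)"
        by (metis injI cayley_conj_conj, metis surjI cayley_conj_conj)
      then show ?thesis using True card_cayley_ker_range(1)[of y] by (subst card_vimage_inj) auto
    qed
    ultimately show ?thesis using True by (simp add: F_def card_cartesian_product eval_nat_numeral)
  next
    case False
    have *: "{(b, c, z). rank_le_1 (0, b, c, 0, 0, z)} = ?B"
      by (auto simp: rank_le_1_def block_norm_def)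
    show ?thesis
    proof (cases "y = 0")
      case True
      then show ?thesis by (simp add: F_def *)
    next
      case no: False
      then have "{(b, c, z). rank_le_1 (0, b, c, 0, y, z)} = {}"
        using False by (auto simp: rank_le_1_def)
      then show ?thesis using False no by (simp only: F_def) simp
    qed
  qed
  have 3: "F 0 x y = 0" if "x \<notin> ?N" for x y
    using that by (simp add: F_def rank_le_1_def)
  have 4: "F 0 x y = (if y \<in> range (cayley_mult x) then ?q ^ 5 else 0)" if x: "x \<in> ?N - {0}" for x y
  proof (cases "y \<in> range (cayley_mult x)")
    case True
    then obtain s where s: "y = cayley_mult x s" by blast
    have Nx: "cayley_norm x = 0" and x0: "x \<noteq> 0" using x by auto
    \<comment> \<open>With y = x s, the equation x z = b y says that z - b s is annihilated by x.
      The value of c is then forced by y z' = c x, where ' is conjugation.\<close>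
    let ?g = "\<lambda>(b, w). (b, b * cayley_norm s + cayley_inner s w, b *s s + w)"
    have fwd: "rank_le_1 (0, b, b * cayley_norm s + cayley_inner s w, x, y, b *s s + w)"
      if w: "cayley_mult x w = 0" for b w
    proof -
      have Nw: "cayley_norm w = 0" using w cayley_norm_ker[OF x0] by (simp add: cayley_ker_def)
      \<comment> \<open>Expanding this instance and dropping all terms with x w or N(w) leaves (x s)
        w' = (s, w) x, a mixed product that cannot simply be rebracketed.\<close>
      have "cayley_mult (cayley_mult x (s + w)) (cayley_conj (s + w)) = cayley_norm (s + w) *s x"
        by (rule cayley_mult_conj_right)
      then have sw: "cayley_mult (cayley_mult x s) (cayley_conj w) = cayley_inner s w *s x"
        by (simp add: cayley_mult_add_left cayley_mult_add_right cayley_conj_linear w cayley_norm_add Nw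
            cayley_mult_conj_right vector_sadd_rdistrib)
      show ?thesis
        by (simp add: rank_le_1_def s Nx cayley_norm_mult cayley_norm_add cayley_norm_scale Nw
            cayley_inner_linear cayley_mult_conj_left' cayley_conj_linear cayley_mult_add_right
            cayley_mult_scale_right sw cayley_mult_conj_right w vector_sadd_rdistrib vector_smult_assoc
            cayley_inner_commute[of w s] power2_eq_square algebra_simps)
    qed
    have bwd: "(b, c, z) = ?g (b, z - b *s s) \<and> cayley_mult x (z - b *s s) = 0"
      if r: "rank_le_1 (0, b, c, x, y, z)" for b c z
    proof -
      have w: "cayley_mult x (z - b *s s) = 0"
        using r by (simp add: rank_le_1_def s cayley_mult_diff_right cayley_mult_scale_right)
      \<comment> \<open>The given matrix and the parametrized one share b, x, y and z, so comparing
        y z' = c x in both identifies the entry c.\<close>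
      from fwd[OF this, of b]
      have "(b * cayley_norm s + cayley_inner s (z - b *s s)) *s x = c *s x"
        using r by (simp add: rank_le_1_def)
      then have "b * cayley_norm s + cayley_inner s (z - b *s s) = c"
        using x0 by (simp only: vector_mul_rcancel simp_thms)
      then show ?thesis using w by simp
    qed
    have "bij_betw ?g (UNIV \<times> cayley_ker x) {(b, c, z). rank_le_1 (0, b, c, x, y, z)}"
    proof (rule bij_betw_byWitness[where f' = "\<lambda>(b, c, z). (b, z - b *s s)"])
      show "\<forall>v\<in>UNIV \<times> cayley_ker x. (\<lambda>(b, c, z). (b, z - b *s s)) (?g v) = v" by auto
      show "\<forall>X\<in>{(b, c, z). rank_le_1 (0, b, c, x, y, z)}. ?g ((\<lambda>(b, c, z). (b, z - b *s s)) X) = X"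
        using bwd by fastforce
      show "?g ` (UNIV \<times> cayley_ker x) \<subseteq> {(b, c, z). rank_le_1 (0, b, c, x, y, z)}"
        using fwd by (auto simp: cayley_ker_def)
      show "(\<lambda>(b, c, z). (b, z - b *s s)) ` {(b, c, z). rank_le_1 (0, b, c, x, y, z)} \<subseteq> UNIV \<times> cayley_ker x"
        using bwd by (auto simp: cayley_ker_def)
    qed
    then have "F 0 x y = card ((UNIV :: 'a set) \<times> cayley_ker x)" by (simp add: F_def bij_betw_same_card)
    also have "\<dots> = ?q ^ 5" by (simp add: card_cartesian_product card_cayley_ker_range x0 Nx eval_nat_numeral)
    finally show ?thesis using True by simp
  next
    case False
    then have "cayley_mult (cayley_conj x) y \<noteq> 0"
      using cayley_range_eq_ker[of x] x by (auto simp: cayley_ker_def)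
    then show ?thesis using False by (simp add: F_def rank_le_1_def)
  qed
  have N0: "0 \<in> ?N" by simp
  have 5: "(\<Sum>y\<in>UNIV. F 0 x y) = (if x \<in> ?N - {0} then ?q ^ 9 else if x = 0 then card ?B + (Z - 1) * ?q ^ 5 else 0)" for x
  proof -
    consider "x \<in> ?N - {0}" | "x = 0" | "x \<notin> ?N" by auto
    then show ?thesis
    proof cases
      case 1
      then have "(\<Sum>y\<in>UNIV. F 0 x y) = (\<Sum>y\<in>UNIV. if y \<in> range (cayley_mult x) then ?q ^ 5 else 0)"
        by (intro sum.cong refl 4)
      also have "\<dots> = card (range (cayley_mult x)) * ?q ^ 5" by (subst sum_if_card) simp_all
      also have "\<dots> = ?q ^ 9" using 1 card_cayley_ker_range(2)[of x] by (simp flip: power_add)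
      finally show ?thesis using 1 by simp
    next
      case x: 2
      have "(\<Sum>y\<in>UNIV. F 0 0 y) = F 0 0 0 + (\<Sum>y\<in>UNIV - {0}. F 0 0 y)"
        by (rule sum.remove) simp_all
      also have "(\<Sum>y\<in>UNIV - {0}. F 0 0 y) = (\<Sum>y\<in>UNIV - {0}. if y \<in> ?N then ?q ^ 5 else 0)"
        by (rule sum.cong) (simp_all add: 2)
      also have "\<dots> = card {y \<in> UNIV - {0}. y \<in> ?N} * ?q ^ 5" by (subst sum_if_card) simp_all
      also have "{y \<in> UNIV - {0}. y \<in> ?N} = ?N - {0}" by auto
      also have "card (?N - {0}) = Z - 1" by (simp add: Z_def card_Diff_singleton)
      finally show ?thesis by (simp add: x 2)
    next
      case 3
      then show ?thesis using \<open>\<And>x y. x \<notin> ?N \<Longrightarrow> F 0 x y = 0\<close> by auto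
    qed
  qed
  have "card {X :: 'a jordan. rank_le_1 X} = (\<Sum>a\<in>UNIV. \<Sum>x\<in>UNIV. \<Sum>y\<in>UNIV. F a x y)"
    unfolding F_def by (rule card_jordan_split)
  also have "\<dots> = (\<Sum>x\<in>UNIV. \<Sum>y\<in>UNIV. F 0 x y) + (?q - 1) * ?q ^ 16"
    by (rule sum_UNIV_0) (simp add: 1 CARD_vec flip: power_add)
  also have "(\<Sum>x\<in>UNIV. \<Sum>y\<in>UNIV. F 0 x y) = (\<Sum>y\<in>UNIV. F 0 0 y) + (\<Sum>x\<in>UNIV - {0}. \<Sum>y\<in>UNIV. F 0 x y)"
    by (rule sum.remove) simp_all
  also have "(\<Sum>x\<in>UNIV - {0}. \<Sum>y\<in>UNIV. F 0 x y) = (\<Sum>x\<in>UNIV - {0}. if x \<in> ?N then ?q ^ 9 else 0)"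
    by (rule sum.cong) (simp_all add: 5)
  also have "\<dots> = card {y \<in> UNIV - {0}. y \<in> ?N} * ?q ^ 9" by (subst sum_if_card) simp_all
  also have "{y \<in> UNIV - {0}. y \<in> ?N} = ?N - {0}" by auto
  also have "card (?N - {0}) = Z - 1" by (simp add: Z_def card_Diff_singleton)
  finally show ?thesis by (simp add: 5)
qed

section \<open>Volumes\<close>

lemma qp_of_zp_inj: "qp_of_zp x = qp_of_zp y \<longleftrightarrow> x = y"
  unfolding qp_of_zp_def by (simp add: Abs_qp_inject eq_fract)

lemma jordan_of_zp_add: "jordan_of_zp (X + Y) = jordan_of_zp X + jordan_of_zp Y"
  by (cases X; cases Y) (simp add: qp_of_zp_add vec_eq_iff)

lemma inj_jordan_of_zp: "inj jordan_of_zp"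
proof (rule injI)
  fix X Y :: "'p::prime_card zp jordan"
  assume "jordan_of_zp X = jordan_of_zp Y"
  then show "X = Y" by (cases X; cases Y) (simp add: qp_of_zp_inj vec_eq_iff)
qed

text \<open>First row and block get separate exponents because they scale differently near a residue
  of rank 1. They have 1 + 8 + 8 = 17 and 1 + 1 + 8 = 10 coordinates, the origin of 17 e + 10 f
  below.\<close>

fun jordan_box :: "nat \<Rightarrow> nat \<Rightarrow> 'p::prime_card zp jordan set" where
  "jordan_box e f = {(a, b, c, x, y, z). \<pi> ^ e dvd a \<and> \<pi> ^ f dvd b \<and> \<pi> ^ f dvd c \<and>
     (\<forall>i. \<pi> ^ e dvd x $ i) \<and> (\<forall>i. \<pi> ^ e dvd y $ i) \<and> (\<forall>i. \<pi> ^ f dvd z $ i)}"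

declare jordan_box.simps [simp del]

lemma jordan_box_mem:
  "(a, b, c, x, y, z) \<in> jordan_box e f \<longleftrightarrow> \<pi> ^ e dvd a \<and> \<pi> ^ f dvd b \<and> \<pi> ^ f dvd c \<and>
     (\<forall>i. \<pi> ^ e dvd x $ i) \<and> (\<forall>i. \<pi> ^ e dvd y $ i) \<and> (\<forall>i. \<pi> ^ f dvd z $ i)"
  by (simp add: jordan_box.simps)

lemma jordan_box_eq_dvd: "X \<in> jordan_box n n \<longleftrightarrow> jordan_dvd n X"
  by (cases X) (auto simp: jordan_box_mem)

lemma jordan_box_0: "0 \<in> jordan_box e f"
  by (simp add: zero_prod_def jordan_box_mem)

lemma jordan_box_add: "X \<in> jordan_box e f \<Longrightarrow> Y \<in> jordan_box e f \<Longrightarrow> X + Y \<in> jordan_box e f"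
  by (cases X; cases Y) (simp add: jordan_box_mem)

lemma jordan_box_diff: "X \<in> jordan_box e f \<Longrightarrow> Y \<in> jordan_box e f \<Longrightarrow> X - Y \<in> jordan_box e f"
  by (cases X; cases Y) (simp add: jordan_box_mem dvd_diff)

lemma jordan_box_mono: "e' \<le> e \<Longrightarrow> f' \<le> f \<Longrightarrow> jordan_box e f \<subseteq> jordan_box e' f'"
  unfolding jordan_box.simps using dvd_trans[OF le_imp_power_dvd] by blast

definition jordan_coset :: "nat \<Rightarrow> nat \<Rightarrow> 'p::prime_card zp jordan \<Rightarrow> 'p zp jordan set" where
  "jordan_coset e f X = {Y. Y - X \<in> jordan_box e f}"

lemma jordan_coset_eq: "jordan_coset e f X = (+) X ` jordan_box e f"
  unfolding jordan_coset_def by (auto simp: image_iff intro!: bexI[of _ "_ - X"])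

lemma jordan_coset_disjoint:
  assumes "Y - X \<notin> jordan_box e f"
  shows "jordan_coset e f X \<inter> jordan_coset e f Y = {}"
proof -
  have False if "Z - X \<in> jordan_box e f" "Z - Y \<in> jordan_box e f" for Z
    using jordan_box_diff[OF that] assms by simp
  then show ?thesis by (auto simp: jordan_coset_def)
qed

definition vec_residues :: "nat \<Rightarrow> 'p::prime_card zp cayley set" where
  "vec_residues n = {v. \<forall>i. v $ i \<in> zp_residues n}"

lemma card_vec_residues:
  "card (vec_residues n :: 'p::prime_card zp cayley set) = CARD('p) ^ (8 * n)"
  "finite (vec_residues n :: 'p zp cayley set)"
proof -
  let ?E = "PiE (UNIV :: 8 set) (\<lambda>_. zp_residues n :: 'p zp set)"
  have bij: "bij_betw vec_lambda ?E (vec_residues n)"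
    by (rule bij_betw_byWitness[where f' = vec_nth]) (auto simp: vec_residues_def PiE_def)
  have "card ?E = CARD('p) ^ (8 * n)"
    by (simp add: card_PiE zp_residues(1) mult.commute flip: power_mult)
  then show "card (vec_residues n :: 'p zp cayley set) = CARD('p) ^ (8 * n)"
    using bij_betw_same_card[OF bij] by simp
  have "finite ?E" by (rule finite_PiE) (simp_all add: zp_residues(2))
  then show "finite (vec_residues n :: 'p zp cayley set)" using bij bij_betw_finite by blast
qed

lemma vec_residues_ex1:
  "\<exists>!r. r \<in> vec_residues n \<and> (\<forall>i. \<pi> ^ n dvd (x :: 'p::prime_card zp cayley) $ i - r $ i)"
proof -
  have "\<forall>i. \<exists>!r. r \<in> zp_residues n \<and> \<pi> ^ n dvd x $ i - r" using zp_residues(3) by blast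
  then obtain r where r: "\<And>i. r i \<in> zp_residues n \<and> \<pi> ^ n dvd x $ i - r i"
    and u: "\<And>i s. s \<in> zp_residues n \<and> \<pi> ^ n dvd x $ i - s \<Longrightarrow> s = r i" by metis
  show ?thesis
    by (rule ex1I[of _ "\<chi> i. r i"]) (use r u in \<open>auto simp: vec_residues_def vec_eq_iff\<close>)
qed

definition jordan_grid :: "nat \<Rightarrow> nat \<Rightarrow> 'p::prime_card zp jordan set" where
  "jordan_grid e f = zp_residues e \<times> zp_residues f \<times> zp_residues f \<times>
     vec_residues e \<times> vec_residues e \<times> vec_residues f"

lemma card_jordan_grid:
  "card (jordan_grid e f :: 'p::prime_card zp jordan set) = CARD('p) ^ (17 * e + 10 * f)"
  "finite (jordan_grid e f :: 'p zp jordan set)"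
proof -
  have "17 * e + 10 * f = e + (f + (f + (8 * e + (8 * e + 8 * f))))" by simp
  then show "card (jordan_grid e f :: 'p zp jordan set) = CARD('p) ^ (17 * e + 10 * f)"
    by (simp only: jordan_grid_def card_cartesian_product zp_residues(1) card_vec_residues power_add)
  show "finite (jordan_grid e f :: 'p zp jordan set)"
    by (simp add: jordan_grid_def zp_residues(2) card_vec_residues)
qed

lemma jordan_grid_ex1:
  "\<exists>!r. r \<in> jordan_grid e f \<and> (X :: 'p::prime_card zp jordan) - r \<in> jordan_box e f"
proof -
  obtain a b c x y z where X: "X = (a, b, c, x, y, z)" by (cases X)
  obtain a' where a: "a' \<in> zp_residues e \<and> \<pi> ^ e dvd a - a'" "\<And>s. s \<in> zp_residues e \<and> \<pi> ^ e dvd a - s \<Longrightarrow> s = a'"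
    using zp_residues(3)[of e a] by blast
  obtain b' where b: "b' \<in> zp_residues f \<and> \<pi> ^ f dvd b - b'" "\<And>s. s \<in> zp_residues f \<and> \<pi> ^ f dvd b - s \<Longrightarrow> s = b'"
    using zp_residues(3)[of f b] by blast
  obtain c' where c: "c' \<in> zp_residues f \<and> \<pi> ^ f dvd c - c'" "\<And>s. s \<in> zp_residues f \<and> \<pi> ^ f dvd c - s \<Longrightarrow> s = c'"
    using zp_residues(3)[of f c] by blast
  obtain x' where x: "x' \<in> vec_residues e \<and> (\<forall>i. \<pi> ^ e dvd x $ i - x' $ i)"
    "\<And>s. s \<in> vec_residues e \<and> (\<forall>i. \<pi> ^ e dvd x $ i - s $ i) \<Longrightarrow> s = x'"
    using vec_residues_ex1[of e x] by blast
  obtain y' where y: "y' \<in> vec_residues e \<and> (\<forall>i. \<pi> ^ e dvd y $ i - y' $ i)"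
    "\<And>s. s \<in> vec_residues e \<and> (\<forall>i. \<pi> ^ e dvd y $ i - s $ i) \<Longrightarrow> s = y'"
    using vec_residues_ex1[of e y] by blast
  obtain z' where z: "z' \<in> vec_residues f \<and> (\<forall>i. \<pi> ^ f dvd z $ i - z' $ i)"
    "\<And>s. s \<in> vec_residues f \<and> (\<forall>i. \<pi> ^ f dvd z $ i - s $ i) \<Longrightarrow> s = z'"
    using vec_residues_ex1[of f z] by blast
  show ?thesis
  proof (rule ex1I[of _ "(a', b', c', x', y', z')"])
    show "(a', b', c', x', y', z') \<in> jordan_grid e f \<and> X - (a', b', c', x', y', z') \<in> jordan_box e f"
      using a(1) b(1) c(1) x(1) y(1) z(1) by (simp add: jordan_grid_def X jordan_box_mem)
  next
    fix r assume r: "r \<in> jordan_grid e f \<and> X - r \<in> jordan_box e f"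
    obtain a'' b'' c'' x'' y'' z'' where r': "r = (a'', b'', c'', x'', y'', z'')" by (cases r)
    show "r = (a', b', c', x', y', z')"
      using r a(2) b(2) c(2) x(2) y(2) z(2) by (simp add: r' jordan_grid_def X jordan_box_mem)
  qed
qed

text \<open>Such sets are unions of residue classes modulo p^n. On them the volume is a normalized
  count, which removes measure theory from everything that follows.\<close>

definition jordan_level :: "nat \<Rightarrow> 'p::prime_card zp jordan set \<Rightarrow> bool" where
  "jordan_level n A \<longleftrightarrow> (\<forall>X Y. X - Y \<in> jordan_box n n \<longrightarrow> X \<in> A \<longleftrightarrow> Y \<in> A)"

lemma jordan_levelD: "jordan_level n A \<Longrightarrow> X - Y \<in> jordan_box n n \<Longrightarrow> X \<in> A \<longleftrightarrow> Y \<in> A"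
  by (simp add: jordan_level_def)

lemma jordan_level_mono: "jordan_level n A \<Longrightarrow> n \<le> m \<Longrightarrow> jordan_level m A"
  unfolding jordan_level_def using jordan_box_mono[of n m n m] by blast

lemma jordan_level_Int: "jordan_level n A \<Longrightarrow> jordan_level n B \<Longrightarrow> jordan_level n (A \<inter> B)"
  unfolding jordan_level_def by blast

lemma jordan_level_Diff: "jordan_level n A \<Longrightarrow> jordan_level n B \<Longrightarrow> jordan_level n (A - B)"
  unfolding jordan_level_def by blast

lemma jordan_level_Un_cosets:
  assumes "jordan_level n A"
  shows "A = (\<Union>r\<in>jordan_grid n n \<inter> A. jordan_coset n n r)"
proof (intro equalityI subsetI)
  fix X assume X: "X \<in> A"
  obtain r where "r \<in> jordan_grid n n" "X - r \<in> jordan_box n n" using jordan_grid_ex1 by blast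
  then show "X \<in> (\<Union>r\<in>jordan_grid n n \<inter> A. jordan_coset n n r)"
    using jordan_levelD[OF assms] X by (auto simp: jordan_coset_def)
next
  fix X assume "X \<in> (\<Union>r\<in>jordan_grid n n \<inter> A. jordan_coset n n r)"
  then obtain r where "r \<in> A" "X - r \<in> jordan_box n n" unfolding jordan_coset_def by blast
  then show "X \<in> A" using jordan_levelD[OF assms] by blast
qed

lemma open_qp_ball: "open (range (\<lambda>t. s + qp_of_zp (\<pi> ^ n * t)) :: 'p::prime_card qp set)"
  unfolding open_qp_def
proof
  fix x :: "'p qp" assume "x \<in> range (\<lambda>t. s + qp_of_zp (\<pi> ^ n * t))"
  then obtain u where u: "x = s + qp_of_zp (\<pi> ^ n * u)" by blast
  have "x + qp_of_zp (\<pi> ^ n * t) = s + qp_of_zp (\<pi> ^ n * (u + t))" for t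
    unfolding u distrib_left qp_of_zp_add by (simp add: add.assoc)
  then show "\<exists>m. \<forall>t. x + qp_of_zp (\<pi> ^ m * t) \<in> range (\<lambda>t. s + qp_of_zp (\<pi> ^ n * t))" by auto
qed

text \<open>The image is a product of balls. A ball of radius at most 1 around an integral centre
  contains integral points only, so the product is not larger than the image.\<close>

lemma open_jordan_coset:
  fixes X :: "'p::prime_card zp jordan"
  shows "open (jordan_of_zp ` jordan_coset e f X)"
proof -
  obtain a b c x y z where X: "X = (a, b, c, x, y, z)" by (cases X)
  define B where "B s n = range (\<lambda>t. qp_of_zp s + qp_of_zp (\<pi> ^ n * t))" for s :: "'p zp" and n
  define V where "V v n = {w :: 'p qp cayley. \<forall>i. w $ i \<in> B (v $ i) n}" for v :: "'p zp cayley" and n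
  have B: "qp_of_zp u \<in> B s n \<longleftrightarrow> \<pi> ^ n dvd u - s" for u s :: "'p zp" and n
  proof -
    have "qp_of_zp u \<in> B s n \<longleftrightarrow> (\<exists>t. u = s + \<pi> ^ n * t)"
      unfolding B_def by (auto simp: qp_of_zp_inj simp flip: qp_of_zp_add)
    also have "\<dots> \<longleftrightarrow> \<pi> ^ n dvd u - s" by (auto simp: dvd_def algebra_simps)
    finally show ?thesis .
  qed
  have B': "\<exists>u. w = qp_of_zp u" if "w \<in> B s n" for w s n
    using that unfolding B_def by (auto simp flip: qp_of_zp_add)
  have V': "\<exists>u. w = (\<chi> i. qp_of_zp (u $ i))" if "w \<in> V v n" for w v n
  proof -
    have "\<forall>i. \<exists>u. w $ i = qp_of_zp u" using that B' unfolding V_def by blast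
    from choice[OF this] obtain u where "\<forall>i. w $ i = qp_of_zp (u i)" by blast
    then have "w = (\<chi> i. qp_of_zp ((\<chi> i. u i) $ i))" by (simp add: vec_eq_iff)
    then show ?thesis by blast
  qed
  have V: "(\<chi> i. qp_of_zp (u $ i)) \<in> V v n \<longleftrightarrow> (\<forall>i. \<pi> ^ n dvd u $ i - v $ i)" for u v n
    by (simp add: V_def B)
  have oB: "open (B s n)" for s n unfolding B_def by (rule open_qp_ball)
  have oV: "open (V v n)" for v n unfolding V_def by (rule open_vector_box) (simp add: oB)
  have "jordan_of_zp ` jordan_coset e f X = B a e \<times> B b f \<times> B c f \<times> V x e \<times> V y e \<times> V z f"
  proof (intro equalityI subsetI)
    fix Y assume "Y \<in> jordan_of_zp ` jordan_coset e f X"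
    then obtain Z where Z: "Y = jordan_of_zp Z" "Z - X \<in> jordan_box e f" by (auto simp: jordan_coset_def)
    obtain a' b' c' x' y' z' where "Z = (a', b', c', x', y', z')" by (cases Z)
    then show "Y \<in> B a e \<times> B b f \<times> B c f \<times> V x e \<times> V y e \<times> V z f"
      using Z by (simp add: X jordan_box_mem B V)
  next
    fix Y assume Y: "Y \<in> B a e \<times> B b f \<times> B c f \<times> V x e \<times> V y e \<times> V z f"
    obtain qa qb qc qx qy qz where Y': "Y = (qa, qb, qc, qx, qy, qz)" by (cases Y)
    have "qa \<in> B a e" "qb \<in> B b f" "qc \<in> B c f" "qx \<in> V x e" "qy \<in> V y e" "qz \<in> V z f"
      using Y by (simp_all add: Y')
    moreover then obtain a' b' c' x' y' z' where *: "qa = qp_of_zp a'" "qb = qp_of_zp b'" "qc = qp_of_zp c'"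
        "qx = (\<chi> i. qp_of_zp (x' $ i))" "qy = (\<chi> i. qp_of_zp (y' $ i))" "qz = (\<chi> i. qp_of_zp (z' $ i))"
      using B' V' by metis
    ultimately have "(a', b', c', x', y', z') \<in> jordan_coset e f X"
      by (simp add: jordan_coset_def X jordan_box_mem B V)
    then show "Y \<in> jordan_of_zp ` jordan_coset e f X"
      by (rule rev_image_eqI) (simp add: Y' *)
  qed
  then show ?thesis by (simp add: open_Times oB oV)
qed

section \<open>Haar volume as a count of residue classes\<close>

locale jordan_haar =
  fixes \<sigma> :: "'p::prime_card qp jordan measure" and q :: real
  assumes q: "q = real CARD('p)"
    and haar: "haar_measure \<sigma>"
    and total: "emeasure \<sigma> (range jordan_of_zp) = 1"
begin

definition vol :: "'p zp jordan set \<Rightarrow> real" where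
  "vol A = measure \<sigma> (jordan_of_zp ` A)"

lemma q_gt_1: "q > 1"
  using card_gt_1[where 'p = 'p] by (simp add: q)

lemma coset_measurable: "jordan_of_zp ` jordan_coset e f X \<in> sets \<sigma>"
  using haar open_jordan_coset[of e f X] by (auto simp: haar_measure_def)

lemma emeasure_coset: "emeasure \<sigma> (jordan_of_zp ` jordan_coset e f X) = emeasure \<sigma> (jordan_of_zp ` jordan_box e f)"
proof -
  have "jordan_coset e f (0 :: 'p zp jordan) = jordan_box e f" by (simp add: jordan_coset_def)
  then have m: "jordan_of_zp ` jordan_box e f \<in> sets \<sigma>" using coset_measurable[of e f 0] by simp
  have "jordan_of_zp ` jordan_coset e f X = (+) (jordan_of_zp X) ` (jordan_of_zp ` jordan_box e f)"
    unfolding jordan_coset_eq image_image jordan_of_zp_add ..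
  then show ?thesis using haar m by (simp add: haar_measure_def)
qed

lemma emeasure_cosets:
  assumes "finite R" "\<And>r s. r \<in> R \<Longrightarrow> s \<in> R \<Longrightarrow> s - r \<in> jordan_box e f \<Longrightarrow> r = s"
  shows "emeasure \<sigma> (jordan_of_zp ` (\<Union>r\<in>R. jordan_coset e f r))
    = of_nat (card R) * emeasure \<sigma> (jordan_of_zp ` jordan_box e f)"
proof -
  have "emeasure \<sigma> (\<Union>r\<in>R. jordan_of_zp ` jordan_coset e f r) = (\<Sum>r\<in>R. emeasure \<sigma> (jordan_of_zp ` jordan_coset e f r))"
  proof (rule sum_emeasure[symmetric])
    show "disjoint_family_on (\<lambda>r. jordan_of_zp ` jordan_coset e f r) R"
      unfolding disjoint_family_on_def
    proof (intro ballI impI)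
      fix r s assume rs: "r \<in> R" "s \<in> R" "r \<noteq> s"
      then have "jordan_coset e f r \<inter> jordan_coset e f s = {}"
        using assms(2) jordan_coset_disjoint by blast
      then show "jordan_of_zp ` jordan_coset e f r \<inter> jordan_of_zp ` jordan_coset e f s = {}"
        using image_Int[OF inj_jordan_of_zp] by (metis image_empty)
    qed
  qed (use assms coset_measurable in auto)
  then show ?thesis by (simp add: image_UN emeasure_coset)
qed

lemma grid_unique:
  "r \<in> jordan_grid e f \<Longrightarrow> s \<in> jordan_grid e f \<Longrightarrow> s - r \<in> jordan_box e f \<Longrightarrow> r = s"
  using jordan_grid_ex1[of e f s] jordan_box_0[of e f] by (metis diff_self)

text \<open>The integral matrices form the disjoint union of q^(17 e + 10 f) translates of the box,
  and their total measure is 1.\<close>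

lemma emeasure_box: "emeasure \<sigma> (jordan_of_zp ` jordan_box e f) = ennreal (1 / q ^ (17 * e + 10 * f))"
proof -
  have "(\<Union>r\<in>jordan_grid e f. jordan_coset e f r) = (UNIV :: 'p zp jordan set)"
  proof -
    have "X \<in> (\<Union>r\<in>jordan_grid e f. jordan_coset e f r)" for X :: "'p zp jordan"
    proof -
      obtain r where "r \<in> jordan_grid e f" "X - r \<in> jordan_box e f" using jordan_grid_ex1 by blast
      then show ?thesis unfolding jordan_coset_def by blast
    qed
    then show ?thesis by (rule UNIV_eq_I[symmetric])
  qed
  then have 1: "of_nat (CARD('p) ^ (17 * e + 10 * f)) * emeasure \<sigma> (jordan_of_zp ` jordan_box e f) = 1"
  proof -
    have "emeasure \<sigma> (jordan_of_zp ` (\<Union>r\<in>jordan_grid e f. jordan_coset e f r))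
        = of_nat (card (jordan_grid e f :: 'p zp jordan set)) * emeasure \<sigma> (jordan_of_zp ` jordan_box e f)"
      by (rule emeasure_cosets, rule card_jordan_grid(2), rule grid_unique)
    then show ?thesis unfolding card_jordan_grid(1) \<open>_ = UNIV\<close> total by simp
  qed
  \<comment> \<open>Finiteness is read off from the same equation: an infinite box would make the
    total infinite.\<close>
  have fin: "emeasure \<sigma> (jordan_of_zp ` jordan_box e f) \<noteq> \<infinity>"
  proof
    assume "emeasure \<sigma> (jordan_of_zp ` jordan_box e f) = \<infinity>"
    then show False using 1 by (simp add: ennreal_mult_top)
  qed
  then obtain m where m: "emeasure \<sigma> (jordan_of_zp ` jordan_box e f) = ennreal m" "m \<ge> 0"
    by (cases "emeasure \<sigma> (jordan_of_zp ` jordan_box e f)") auto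
  have "ennreal (q ^ (17 * e + 10 * f) * m) = ennreal 1"
    using 1 by (simp add: m q ennreal_mult ennreal_of_nat_eq_real_of_nat)
  then have "q ^ (17 * e + 10 * f) * m = 1" using m(2) q_gt_1 by (subst (asm) ennreal_inj) simp_all
  then have "m = 1 / q ^ (17 * e + 10 * f)" using q_gt_1 by (simp add: field_simps)
  then show ?thesis using m by simp
qed

lemma vol_cosets:
  assumes "finite R" "\<And>r s. r \<in> R \<Longrightarrow> s \<in> R \<Longrightarrow> s - r \<in> jordan_box e f \<Longrightarrow> r = s"
  shows "vol (\<Union>r\<in>R. jordan_coset e f r) = real (card R) / q ^ (17 * e + 10 * f)"
proof -
  have "emeasure \<sigma> (jordan_of_zp ` (\<Union>r\<in>R. jordan_coset e f r)) = ennreal (real (card R) / q ^ (17 * e + 10 * f))"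
    using emeasure_cosets[OF assms] q_gt_1 unfolding emeasure_box
    by (simp add: ennreal_of_nat_eq_real_of_nat flip: ennreal_mult)
  then show ?thesis using q_gt_1 by (simp add: vol_def measure_def)
qed

lemma vol_level:
  assumes "jordan_level n A"
  shows "vol A = real (card (jordan_grid n n \<inter> A)) / q ^ (27 * n)"
proof -
  have "vol (\<Union>r\<in>jordan_grid n n \<inter> A. jordan_coset n n r) = real (card (jordan_grid n n \<inter> A)) / q ^ (17 * n + 10 * n)"
  proof (rule vol_cosets)
    fix r s assume "r \<in> jordan_grid n n \<inter> A" "s \<in> jordan_grid n n \<inter> A" "s - r \<in> jordan_box n n"
    then show "r = s" using grid_unique by blast
  qed (simp add: card_jordan_grid(2))
  then show ?thesis using jordan_level_Un_cosets[OF assms] by simp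
qed

lemma vol_disjoint_Union:
  assumes "finite I" "\<And>i. i \<in> I \<Longrightarrow> jordan_level n (A i)"
    and "\<And>i j. i \<in> I \<Longrightarrow> j \<in> I \<Longrightarrow> i \<noteq> j \<Longrightarrow> A i \<inter> A j = {}"
  shows "vol (\<Union>i\<in>I. A i) = (\<Sum>i\<in>I. vol (A i))"
proof -
  have "jordan_level n (\<Union>i\<in>I. A i)" using assms(2) unfolding jordan_level_def by blast
  then have "vol (\<Union>i\<in>I. A i) = real (card (\<Union>i\<in>I. jordan_grid n n \<inter> A i)) / q ^ (27 * n)"
    by (simp add: vol_level)
  also have "card (\<Union>i\<in>I. jordan_grid n n \<inter> A i) = (\<Sum>i\<in>I. card (jordan_grid n n \<inter> A i))"
  proof (rule card_UN_disjoint)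
    show "\<forall>i\<in>I. finite (jordan_grid n n \<inter> A i)" by (simp add: card_jordan_grid(2))
    show "\<forall>i\<in>I. \<forall>j\<in>I. i \<noteq> j \<longrightarrow> jordan_grid n n \<inter> A i \<inter> (jordan_grid n n \<inter> A j) = {}"
      using assms(3) by blast
  qed (rule assms(1))
  finally show ?thesis by (simp add: vol_level[OF assms(2)] sum_divide_distrib)
qed

lemma vol_Diff:
  assumes "jordan_level n A" "jordan_level n B" "B \<subseteq> A"
  shows "vol (A - B) = vol A - vol B"
proof -
  have "jordan_grid n n \<inter> (A - B) = (jordan_grid n n \<inter> A) - (jordan_grid n n \<inter> B)" by blast
  moreover have "jordan_grid n n \<inter> B \<subseteq> jordan_grid n n \<inter> A" using assms(3) by blast
  ultimately have "real (card (jordan_grid n n \<inter> (A - B))) = real (card (jordan_grid n n \<inter> A)) - real (card (jordan_grid n n \<inter> B))"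
    by (simp add: card_Diff_subset card_mono card_jordan_grid(2) of_nat_diff)
  then show ?thesis
    using assms by (simp add: vol_level[OF jordan_level_Diff] vol_level[of n] diff_divide_distrib)
qed

text \<open>A map that keeps residue classes modulo p^n apart embeds the classes in A into those in
  B. Applied in both directions, this takes the place of a change of variables formula.\<close>

lemma vol_le:
  assumes A: "jordan_level n A" and B: "jordan_level n B"
    and \<Phi>: "\<And>X. X \<in> A \<Longrightarrow> \<Phi> X \<in> B"
      "\<And>X Y. X \<in> A \<Longrightarrow> Y \<in> A \<Longrightarrow> \<Phi> X - \<Phi> Y \<in> jordan_box n n \<Longrightarrow> X - Y \<in> jordan_box n n"
  shows "vol A \<le> vol B"
proof -
  have "\<forall>X. \<exists>r. r \<in> jordan_grid n n \<and> X - r \<in> jordan_box n n" using jordan_grid_ex1 by blast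
  from choice[OF this] obtain \<rho> :: "'p zp jordan \<Rightarrow> _" where
    \<rho>: "\<And>X. \<rho> X \<in> jordan_grid n n" "\<And>X. X - \<rho> X \<in> jordan_box n n" by blast
  have "card (jordan_grid n n \<inter> A) \<le> card (jordan_grid n n \<inter> B)"
  proof (rule card_inj_on_le[of "\<lambda>X. \<rho> (\<Phi> X)"])
    show "inj_on (\<lambda>X. \<rho> (\<Phi> X)) (jordan_grid n n \<inter> A)"
    proof (rule inj_onI)
      fix X Y assume XY: "X \<in> jordan_grid n n \<inter> A" "Y \<in> jordan_grid n n \<inter> A" "\<rho> (\<Phi> X) = \<rho> (\<Phi> Y)"
      then have "\<Phi> X - \<Phi> Y \<in> jordan_box n n"
        using jordan_box_diff[OF \<rho>(2)[of "\<Phi> X"] \<rho>(2)[of "\<Phi> Y"]] by simp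
      then have "X - Y \<in> jordan_box n n" using \<Phi>(2) XY by blast
      then show "X = Y" using grid_unique XY by blast
    qed
    show "(\<lambda>X. \<rho> (\<Phi> X)) ` (jordan_grid n n \<inter> A) \<subseteq> jordan_grid n n \<inter> B"
      using \<rho>(1) \<Phi>(1) jordan_levelD[OF B \<rho>(2)] by blast
  qed (simp add: card_jordan_grid(2))
  then show ?thesis using q_gt_1 by (simp add: vol_level[OF A] vol_level[OF B] divide_right_mono)
qed

lemma vol_translate:
  assumes "jordan_level n A"
  shows "vol ((+) X ` A) = vol A"
proof (rule antisym)
  have *: "jordan_level n ((+) X ` A)"
    unfolding jordan_level_def
  proof (intro allI impI)
    fix Y Z :: "'p zp jordan" assume "Y - Z \<in> jordan_box n n"
    then have "(Y - X) - (Z - X) \<in> jordan_box n n" by simp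
    then have "Y - X \<in> A \<longleftrightarrow> Z - X \<in> A" by (rule jordan_levelD[OF assms])
    moreover have "W \<in> (+) X ` A \<longleftrightarrow> W - X \<in> A" for W by (auto simp: image_iff intro!: bexI[of _ "W - X"])
    ultimately show "Y \<in> (+) X ` A \<longleftrightarrow> Z \<in> (+) X ` A" by simp
  qed
  show "vol A \<le> vol ((+) X ` A)" by (rule vol_le[OF assms *, of "\<lambda>Y. X + Y"]) auto
  show "vol ((+) X ` A) \<le> vol A" by (rule vol_le[OF * assms, of "\<lambda>Y. Y - X"]) auto
qed

fun jordan_stretch :: "nat \<Rightarrow> nat \<Rightarrow> 'p zp jordan \<Rightarrow> 'p zp jordan" where
  "jordan_stretch e f (a, b, c, x, y, z) = (\<pi> ^ e * a, \<pi> ^ f * b, \<pi> ^ f * c, \<pi> ^ e *s x, \<pi> ^ e *s y, \<pi> ^ f *s z)"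

text \<open>Residue classes modulo p^n are carried bijectively to cosets of a finer box, so the
  number of cosets stays and only the volume of each one changes.\<close>

lemma vol_stretch:
  assumes "jordan_level n A"
  shows "vol (jordan_stretch e f ` A) = vol A / q ^ (17 * e + 10 * f)"
proof -
  let ?R = "jordan_grid n n \<inter> A"
  have diff: "jordan_stretch e f X - jordan_stretch e f Y = jordan_stretch e f (X - Y)" for X Y
    by (cases X; cases Y) (simp add: algebra_simps vec_eq_iff)
  have box: "jordan_stretch e f X \<in> jordan_box (n + e) (n + f) \<longleftrightarrow> X \<in> jordan_box n n" for X
    by (cases X) (simp add: jordan_box_mem power_add mult.commute[of "\<pi> ^ n"])
  have surj: "\<exists>Z. Y = jordan_stretch e f Z" if "Y \<in> jordan_box (n + e) (n + f)" for Y
  proof -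
    obtain a b c x y z where Y: "Y = (a, b, c, x, y, z)" by (cases Y)
    have "\<pi> ^ e dvd a" "\<pi> ^ f dvd b" "\<pi> ^ f dvd c" "\<forall>i. \<pi> ^ e dvd x $ i" "\<forall>i. \<pi> ^ e dvd y $ i" "\<forall>i. \<pi> ^ f dvd z $ i"
      using that unfolding Y jordan_box_mem power_add by (blast dest: dvd_mult_right)+
    then obtain a' b' c' x' y' z' where "Y = jordan_stretch e f (a', b', c', x', y', z')"
      unfolding vec_dvd_iff Y by (auto elim!: dvdE)
    then show ?thesis ..
  qed
  have add: "jordan_stretch e f (X + Y) = jordan_stretch e f X + jordan_stretch e f Y" for X Y
    by (cases X; cases Y) (simp add: algebra_simps vec_eq_iff)
  have inj: "inj (jordan_stretch e f)"
  proof (rule injI)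
    fix X Y :: "'p zp jordan" assume "jordan_stretch e f X = jordan_stretch e f Y"
    then show "X = Y" by (cases X; cases Y) (auto simp: vec_eq_iff)
  qed
  have cos: "jordan_stretch e f ` jordan_coset n n r = jordan_coset (n + e) (n + f) (jordan_stretch e f r)" for r
  proof (intro equalityI subsetI)
    fix Y assume "Y \<in> jordan_stretch e f ` jordan_coset n n r"
    then obtain Z where "Y = jordan_stretch e f Z" "Z - r \<in> jordan_box n n"
      unfolding jordan_coset_def by blast
    then show "Y \<in> jordan_coset (n + e) (n + f) (jordan_stretch e f r)"
      by (simp add: jordan_coset_def diff box)
  next
    fix Y assume Y: "Y \<in> jordan_coset (n + e) (n + f) (jordan_stretch e f r)"
    then obtain Z where Z: "Y - jordan_stretch e f r = jordan_stretch e f Z"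
      using surj unfolding jordan_coset_def by blast
    then have "Y = jordan_stretch e f (r + Z)" unfolding add by (simp add: algebra_simps)
    moreover have "r + Z \<in> jordan_coset n n r"
      using Y Z by (simp add: jordan_coset_def box)
    ultimately show "Y \<in> jordan_stretch e f ` jordan_coset n n r" by blast
  qed
  have "jordan_stretch e f ` A = (\<Union>r\<in>?R. jordan_stretch e f ` jordan_coset n n r)"
    by (subst jordan_level_Un_cosets[OF assms]) (rule image_UN)
  also have "\<dots> = (\<Union>r\<in>jordan_stretch e f ` ?R. jordan_coset (n + e) (n + f) r)" by (simp add: cos)
  also have "vol \<dots> = real (card (jordan_stretch e f ` ?R)) / q ^ (17 * (n + e) + 10 * (n + f))"
  proof (rule vol_cosets)
    fix r s assume rs: "r \<in> jordan_stretch e f ` ?R" "s \<in> jordan_stretch e f ` ?R" "s - r \<in> jordan_box (n + e) (n + f)"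
    then obtain r' s' where *: "r = jordan_stretch e f r'" "s = jordan_stretch e f s'" "r' \<in> ?R" "s' \<in> ?R" by blast
    then have "s' - r' \<in> jordan_box n n" using rs(3) by (simp only: diff box)
    then show "r = s" using * grid_unique by blast
  qed (simp add: card_jordan_grid(2))
  also have "card (jordan_stretch e f ` ?R) = card ?R" by (rule card_image) (use inj in \<open>auto simp: inj_on_def\<close>)
  also have "17 * (n + e) + 10 * (n + f) = 27 * n + (17 * e + 10 * f)" by simp
  finally show ?thesis by (simp add: vol_level[OF assms] power_add)
qed

end

section \<open>Reduction of matrices modulo p\<close>

fun jordan_red :: "'p::prime_card zp jordan \<Rightarrow> 'p mod_ring jordan" where
  "jordan_red (a, b, c, x, y, z) = (zp_red a, zp_red b, zp_red c, vec_red x, vec_red y, vec_red z)"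

lemma vec_red_eq_iff: "vec_red x = vec_red y \<longleftrightarrow> (\<forall>i. \<pi> dvd x $ i - y $ i)"
  by (simp add: vec_eq_iff zp_red_eq_iff)

lemma jordan_red_eq_iff: "jordan_red X = jordan_red Y \<longleftrightarrow> X - Y \<in> jordan_box 1 1"
  by (cases X; cases Y) (simp add: jordan_box_mem zp_red_eq_iff vec_red_eq_iff)

lemma jordan_red_surj: "\<exists>X. jordan_red X = r"
proof -
  obtain a b c x y z where r: "r = (a, b, c, x, y, z)" by (cases r)
  obtain a' b' c' x' y' z' where "zp_red a' = a" "zp_red b' = b" "zp_red c' = c"
    "vec_red x' = x" "vec_red y' = y" "vec_red z' = z"
    using zp_red_surj vec_red_surj by metis
  then have "jordan_red (a', b', c', x', y', z') = r" by (simp add: r)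
  then show ?thesis by blast
qed

lemma jordan_level_red: "1 \<le> n \<Longrightarrow> jordan_level n {X. P (jordan_red X)}"
proof (rule jordan_level_mono)
  show "jordan_level 1 {X. P (jordan_red X)}"
    unfolding jordan_level_def jordan_red_eq_iff[symmetric] by simp
qed

lemma jordan_det_red: "jordan_det (jordan_red X) = zp_red (jordan_det X)"
  by (cases X) (simp add: jordan_det_eq zp_red_hom cayley_norm_red cayley_mult_red cayley_inner_red
      del: jordan_det.simps)

lemma jordan_lin_red: "jordan_lin (jordan_red X) (jordan_red Y) = zp_red (jordan_lin X Y)"
  by (cases X; cases Y) (simp add: zp_red_hom cayley_norm_red cayley_mult_red cayley_inner_red cayley_conj_red
      flip: vec_red_hom)

lemma inner_dvd_iff: "(\<forall>x. (r :: 'a::comm_ring_1) dvd cayley_inner x v) \<longleftrightarrow> (\<forall>i. r dvd v $ i)"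
proof
  assume *: "\<forall>x. r dvd cayley_inner x v"
  show "\<forall>i. r dvd v $ i"
  proof
    fix i
    obtain d :: "'a cayley" where "\<forall>x. cayley_inner x d = x $ i" using cayley_dual_basis by blast
    then show "r dvd v $ i" using * by (metis cayley_inner_commute)
  qed
next
  assume "\<forall>i. r dvd v $ i"
  then obtain w where "v = r *s w" unfolding vec_dvd_iff by blast
  then show "\<forall>x. r dvd cayley_inner x v" by (simp add: cayley_inner_linear)
qed

text \<open>Matrices with a single nonzero entry isolate the entries of the adjoint. For the Cayley
  entries, unimodularity turns divisibility of all inner products into divisibility of
  coordinates.\<close>

lemma jordan_lin_dvd_iff:
  "jordan_lin_dvd n (a, b, c, x, y, z) \<longleftrightarrow>
     \<pi> ^ n dvd b * c - cayley_norm z \<and> \<pi> ^ n dvd a * c - cayley_norm y \<and> \<pi> ^ n dvd a * b - cayley_norm x \<and>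
     (\<forall>i. \<pi> ^ n dvd (cayley_mult y (cayley_conj z) - c *s x) $ i) \<and>
     (\<forall>i. \<pi> ^ n dvd (cayley_mult x z - b *s y) $ i) \<and>
     (\<forall>i. \<pi> ^ n dvd (cayley_mult (cayley_conj x) y - a *s z) $ i)" (is "?L \<longleftrightarrow> ?R")
proof
  assume ?L
  then have *: "\<pi> ^ n dvd jordan_lin (a, b, c, x, y, z) Y" for Y by (simp add: jordan_lin_dvd_def)
  show ?R
    unfolding inner_dvd_iff[symmetric]
    using *[of "(1, 0, 0, 0, 0, 0)"] *[of "(0, 1, 0, 0, 0, 0)"] *[of "(0, 0, 1, 0, 0, 0)"]
      *[of "(0, 0, 0, v, 0, 0)" for v] *[of "(0, 0, 0, 0, v, 0)" for v] *[of "(0, 0, 0, 0, 0, v)" for v]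
    by (simp del: vector_minus_component)
next
  assume R: ?R
  have "\<pi> ^ n dvd jordan_lin (a, b, c, x, y, z) Y" for Y
  proof (cases Y)
    case (fields a' b' c' x' y' z')
    then show ?thesis
      using R unfolding inner_dvd_iff[symmetric] fields jordan_lin.simps
      by (intro dvd_add dvd_mult2) blast+
  qed
  then show ?L by (simp add: jordan_lin_dvd_def)
qed

lemma rank_le_1_red: "rank_le_1 (jordan_red X) \<longleftrightarrow> jordan_lin_dvd 1 X"
proof -
  obtain a b c x y z where X: "X = (a, b, c, x, y, z)" by (cases X)
  have v: "vec_red v = vec_red w \<longleftrightarrow> (\<forall>i. \<pi> ^ 1 dvd (v - w) $ i)" for v w :: "'a zp cayley"
    by (simp add: vec_red_eq_iff)
  have s: "zp_red r = zp_red s \<longleftrightarrow> \<pi> ^ 1 dvd s - r" for r s :: "'a zp"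
    by (metis zp_red_eq_iff power_one_right)
  show ?thesis
    unfolding X jordan_lin_dvd_iff jordan_red.simps rank_le_1_def prod.case cayley_norm_red cayley_mult_red
      cayley_conj_red zp_red_hom(2)[symmetric] vec_red_hom(3)[symmetric] v s ..
qed

lemma jordan_det_level:
  assumes "X - Y \<in> jordan_box n n"
  shows "\<pi> ^ n dvd jordan_det X - jordan_det Y"
proof -
  obtain W where "X - Y = jordan_scale (\<pi> ^ n) W" using assms by (auto simp: jordan_box_eq_dvd jordan_dvd_iff)
  then have X: "X = Y + jordan_scale (\<pi> ^ n) W" by (simp add: algebra_simps)
  show ?thesis
    unfolding X jordan_det_add jordan_lin_scale jordan_lin_scale_left jordan_det_scale
    by (simp add: power2_eq_square power3_eq_cube mult.assoc)
qed

text \<open>The form depends on the block alone but is defined on full matrices, so that the same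
  level sets and volumes serve for it.\<close>

definition block_quad :: "'a::comm_ring_1 jordan \<Rightarrow> 'a" where
  "block_quad X = (case X of (a, b, c, x, y, z) \<Rightarrow> block_norm b c z)"

definition block_polar :: "'a::comm_ring_1 jordan \<Rightarrow> 'a jordan \<Rightarrow> 'a" where
  "block_polar X Y = (case (X, Y) of ((a, b, c, x, y, z), (a', b', c', x', y', z')) \<Rightarrow>
     b * c' + b' * c - cayley_inner z z')"

definition block_nonzero :: "'a::comm_ring_1 jordan \<Rightarrow> bool" where
  "block_nonzero X \<longleftrightarrow> (case X of (a, b, c, x, y, z) \<Rightarrow> (b, c, z) \<noteq> 0)"

lemma block_quad_add:
  "block_quad (X + jordan_scale s Y) = block_quad X + s * block_polar X Y + s ^ 2 * block_quad Y"
  by (cases X; cases Y) (simp add: block_quad_def block_polar_def block_norm_def cayley_norm_add cayley_norm_scale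
      cayley_inner_linear algebra_simps power2_eq_square)

lemma block_quad_level:
  assumes "X - Y \<in> jordan_box n n"
  shows "\<pi> ^ n dvd block_quad X - block_quad Y"
proof -
  obtain W where "X - Y = jordan_scale (\<pi> ^ n) W" using assms by (auto simp: jordan_box_eq_dvd jordan_dvd_iff)
  then have X: "X = Y + jordan_scale (\<pi> ^ n) W" by (simp add: algebra_simps)
  show ?thesis
    unfolding X block_quad_add by (simp add: power2_eq_square mult.assoc)
qed

lemma block_quad_red: "block_quad (jordan_red X) = zp_red (block_quad X)"
  by (cases X) (simp add: block_quad_def block_norm_def zp_red_hom cayley_norm_red)

lemma block_polar_red: "block_polar (jordan_red X) (jordan_red Y) = zp_red (block_polar X Y)"
  by (cases X; cases Y) (simp add: block_polar_def zp_red_hom cayley_inner_red)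

lemma block_polar_nondegenerate:
  fixes r :: "'a::comm_ring_1 jordan"
  assumes "block_nonzero r"
  shows "\<exists>Y. block_polar r Y \<noteq> 0"
proof -
  obtain a b c x y z where r: "r = (a, b, c, x, y, z)" by (cases r)
  consider "b \<noteq> 0" | "c \<noteq> 0" | "z \<noteq> 0" using assms by (auto simp: block_nonzero_def r zero_prod_def)
  then show ?thesis
  proof cases
    case 1 then show ?thesis by (intro exI[of _ "(0, 0, 1, 0, 0, 0)"]) (simp add: block_polar_def r)
  next
    case 2 then show ?thesis by (intro exI[of _ "(0, 1, 0, 0, 0, 0)"]) (simp add: block_polar_def r)
  next
    case 3
    then obtain w where "cayley_inner z w \<noteq> 0" by (rule cayley_nondegenerate)
    then show ?thesis by (intro exI[of _ "(0, 0, 0, 0, 0, w)"]) (simp add: block_polar_def r)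
  qed
qed

text \<open>A function with a unit derivative along a fixed direction on a residue class takes equidistributed
  values there.\<close>

definition unit_direction :: "('p::prime_card zp jordan \<Rightarrow> 'p zp) \<Rightarrow> 'p zp jordan \<Rightarrow> 'p zp jordan \<Rightarrow> bool" where
  "unit_direction f Y X \<longleftrightarrow> (\<exists>u. \<not> \<pi> dvd u \<and> (\<forall>s. \<exists>w. f (X + jordan_scale s Y) = f X + s * u + s ^ 2 * w))"

lemma unit_direction_det:
  assumes "\<not> \<pi> dvd jordan_lin X Y"
  shows "unit_direction jordan_det Y X"
proof -
  have "jordan_det (X + jordan_scale s Y)
      = jordan_det X + s * jordan_lin X Y + s ^ 2 * (jordan_lin Y X + s * jordan_det Y)" for s
    unfolding jordan_det_add jordan_lin_scale jordan_lin_scale_left jordan_det_scale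
    by (simp add: algebra_simps power2_eq_square power3_eq_cube)
  then show ?thesis unfolding unit_direction_def using assms by blast
qed

lemma unit_direction_block: "\<not> \<pi> dvd block_polar X Y \<Longrightarrow> unit_direction block_quad Y X"
  unfolding unit_direction_def block_quad_add by blast

lemma jordan_translate_mem: "Z \<in> (+) W ` D \<longleftrightarrow> Z - W \<in> (D :: 'a::comm_ring_1 jordan set)"
proof
  assume "Z - W \<in> D"
  then show "Z \<in> (+) W ` D" by (rule rev_image_eqI) simp
qed (elim imageE, simp)

lemma jordan_level_translate:
  fixes A :: "'p::prime_card zp jordan set"
  assumes "jordan_level n A"
  shows "jordan_level n ((+) X ` A)"
  unfolding jordan_level_def jordan_translate_mem
proof (intro allI impI)
  fix Y Z :: "'p zp jordan"
  assume "Y - Z \<in> jordan_box n n"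
  then have "(Y - X) - (Z - X) \<in> jordan_box n n" by simp
  then show "Y - X \<in> A \<longleftrightarrow> Z - X \<in> A" by (rule jordan_levelD[OF assms])
qed

lemma jordan_level_dvd:
  fixes f :: "'p::prime_card zp jordan \<Rightarrow> 'p zp"
  assumes A: "jordan_level n A" and f: "\<And>X Y. X - Y \<in> jordan_box n n \<Longrightarrow> \<pi> ^ n dvd f X - f Y"
  shows "jordan_level n {X \<in> A. \<pi> ^ n dvd f X}"
proof -
  have "jordan_level n {X. \<pi> ^ n dvd f X}"
    unfolding jordan_level_def
  proof (intro allI impI)
    fix X Z :: "'p zp jordan" assume "X - Z \<in> jordan_box n n"
    then have "\<pi> ^ n dvd f X - f Z" by (rule f)
    then show "X \<in> {X. \<pi> ^ n dvd f X} \<longleftrightarrow> Z \<in> {X. \<pi> ^ n dvd f X}"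
      using dvd_add_right_iff[of "\<pi> ^ n" "f X - f Z" "f Z"] by simp
  qed
  moreover have "{X \<in> A. \<pi> ^ n dvd f X} = A \<inter> {X. \<pi> ^ n dvd f X}" by blast
  ultimately show ?thesis using jordan_level_Int[OF A] by simp
qed

section \<open>Equidistribution of values on residue classes\<close>

context jordan_haar
begin

lemma vol_red: "vol {X. P (jordan_red X)} = real (card {r. P r}) / q ^ 27"
proof -
  have "bij_betw jordan_red (jordan_grid 1 1 \<inter> {X. P (jordan_red X)}) {r :: 'p mod_ring jordan. P r}"
    unfolding bij_betw_def
  proof
    show "inj_on jordan_red (jordan_grid 1 1 \<inter> {X :: 'p zp jordan. P (jordan_red X)})"
    proof (rule inj_onI)
      fix X Y :: "'p zp jordan"
      assume XY: "X \<in> jordan_grid 1 1 \<inter> {X. P (jordan_red X)}" "Y \<in> jordan_grid 1 1 \<inter> {X. P (jordan_red X)}"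
        "jordan_red X = jordan_red Y"
      then have "Y - X \<in> jordan_box 1 1" by (metis jordan_red_eq_iff)
      then show "X = Y" using grid_unique XY by blast
    qed
    show "jordan_red ` (jordan_grid 1 1 \<inter> {X :: 'p zp jordan. P (jordan_red X)}) = {r. P r}"
    proof (intro equalityI subsetI)
      fix r :: "'p mod_ring jordan" assume r: "r \<in> {r. P r}"
      obtain X where X: "jordan_red X = r" using jordan_red_surj by blast
      obtain Y where Y: "Y \<in> jordan_grid 1 1" "X - Y \<in> jordan_box 1 1" using jordan_grid_ex1 by blast
      then have "jordan_red Y = r" using X by (metis jordan_red_eq_iff)
      then show "r \<in> jordan_red ` (jordan_grid 1 1 \<inter> {X :: 'p zp jordan. P (jordan_red X)})"
        using Y(1) r by blast
    qed blast
  qed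
  then have "card (jordan_grid 1 1 \<inter> {X :: 'p zp jordan. P (jordan_red X)}) = card {r :: 'p mod_ring jordan. P r}"
    by (rule bij_betw_same_card)
  then show ?thesis using vol_level[OF jordan_level_red[of 1 P]] by simp
qed

lemma vol_sum_residues:
  assumes "jordan_level n A" "1 \<le> n" "\<And>X. X \<in> A \<Longrightarrow> jordan_red X \<in> R"
  shows "vol A = (\<Sum>r\<in>R. vol {X \<in> A. jordan_red X = r})"
proof -
  have "A = (\<Union>r\<in>R. {X \<in> A. jordan_red X = r})" using assms(3) by blast
  also have "vol \<dots> = (\<Sum>r\<in>R. vol {X \<in> A. jordan_red X = r})"
  proof (rule vol_disjoint_Union)
    show "jordan_level n {X \<in> A. jordan_red X = r}" for r
      using jordan_level_Int[OF assms(1) jordan_level_red[OF assms(2), of "\<lambda>s. s = r"]] by (simp add: Int_def)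
    show "finite R" by (rule finite)
  qed blast
  finally show ?thesis .
qed

text \<open>Moving X by p^k t Y changes f by p^k t u modulo p^(k + 1), with u a unit. So exactly one
  t modulo p makes the shifted value divisible by p^(k + 1), and the set splits into q translates of
  the smaller one. As k is at least 1, the shift preserves residue classes modulo p, and the
  quadratic term, divisible by p^(2 k), does not interfere.\<close>

lemma vol_equidistribution:
  assumes A: "jordan_level 1 A"
    and f: "\<And>n X Y. X - Y \<in> jordan_box n n \<Longrightarrow> \<pi> ^ n dvd f X - f Y"
    and Y: "\<And>X. X \<in> A \<Longrightarrow> unit_direction f Y X"
    and k: "1 \<le> k"
  shows "vol {X \<in> A. \<pi> ^ k dvd f X} = q * vol {X \<in> A. \<pi> ^ Suc k dvd f X}"
proof -
  define D where "D n = {X \<in> A. \<pi> ^ n dvd f X}" for n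
  define W where "W t = jordan_scale (\<pi> ^ k * t) Y" for t
  have lev: "jordan_level n (D n)" if "1 \<le> n" for n
    unfolding D_def by (rule jordan_level_dvd[OF jordan_level_mono[OF A that] f])
  have pk: "\<pi> ^ k = \<pi> * (\<pi> :: 'p zp) ^ (k - 1)" using k by (simp flip: power_Suc)
  have box: "W t \<in> jordan_box 1 1" for t
  proof -
    have "W t = jordan_scale (\<pi> ^ 1) (jordan_scale (\<pi> ^ (k - 1) * t) Y)"
      unfolding W_def pk module.scale_scale[OF module_jordan_scale] power_one_right mult.assoc ..
    then show ?thesis unfolding jordan_box_eq_dvd jordan_dvd_iff by blast
  qed
  have WA: "X + W t \<in> A \<longleftrightarrow> X \<in> A" for X t
    by (rule jordan_levelD[OF A]) (use box[of t] in simp)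
  have dir: "\<exists>u. \<not> \<pi> dvd u \<and> (\<forall>t. \<exists>w. f (X + W t) = f X + \<pi> ^ k * (t * u) + \<pi> ^ Suc k * w)" if X: "X \<in> A" for X
  proof -
    obtain u where u: "\<not> \<pi> dvd u" "\<forall>s. \<exists>w. f (X + jordan_scale s Y) = f X + s * u + s ^ 2 * w"
      using Y[OF X] unfolding unit_direction_def by blast
    have "\<exists>w. f (X + W t) = f X + \<pi> ^ k * (t * u) + \<pi> ^ Suc k * w" for t
    proof -
      obtain w where "f (X + W t) = f X + (\<pi> ^ k * t) * u + (\<pi> ^ k * t) ^ 2 * w"
        using u(2) unfolding W_def by blast
      moreover have "(\<pi> ^ k * t) ^ 2 * w = \<pi> ^ Suc k * (\<pi> ^ (k - 1) * t ^ 2 * w)"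
      proof -
        have "(\<pi> ^ k * t) ^ 2 * w = \<pi> ^ k * \<pi> ^ k * (t ^ 2 * w)"
          by (simp add: power2_eq_square ac_simps)
        also have "\<pi> ^ k * \<pi> ^ k = \<pi> ^ Suc k * (\<pi> :: 'p zp) ^ (k - 1)"
          by (subst (2) pk) (simp add: ac_simps)
        finally show ?thesis by (simp only: mult.assoc)
      qed
      ultimately have "f (X + W t) = f X + \<pi> ^ k * (t * u) + \<pi> ^ Suc k * (\<pi> ^ (k - 1) * t ^ 2 * w)"
        by (simp only: mult.assoc)
      then show ?thesis by blast
    qed
    then show ?thesis using u(1) by blast
  qed
  have Wneg: "W (- t) = - W t" and Wdiff: "W (s - t) = W s - W t" for s t
    unfolding W_def using module.scale_minus_left[OF module_jordan_scale] module.scale_left_diff_distrib[OF module_jordan_scale]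
    by (simp_all add: right_diff_distrib)
  have "D k = (\<Union>t\<in>zp_residues 1. (+) (W t) ` D (Suc k))"
  proof (intro equalityI subsetI)
    fix Z assume "Z \<in> D k"
    then have ZA: "Z \<in> A" and "\<pi> ^ k dvd f Z" unfolding D_def by blast+
    then obtain v where v: "f Z = \<pi> ^ k * v" by (elim dvdE)
    obtain u where u: "\<not> \<pi> dvd u" "\<And>t. \<exists>w. f (Z + W t) = f Z + \<pi> ^ k * (t * u) + \<pi> ^ Suc k * w"
      using dir[OF ZA] by blast
    obtain u' where u': "u * u' = 1" using zp_inverse_exists u(1) by blast
    \<comment> \<open>With f Z = p^k v, the shift by - t has to cancel v modulo p, so t is the
      residue of v / u.\<close>
    obtain t where t: "t \<in> zp_residues 1" "\<pi> ^ 1 dvd v * u' - t" using zp_residues(3)[of 1 "v * u'"] by blast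
    obtain w where w: "f (Z + W (- t)) = f Z + \<pi> ^ k * (- t * u) + \<pi> ^ Suc k * w" using u(2) by blast
    have "v - t * u = u * (v * u' - t)" using u' by (simp add: algebra_simps)
    then have "\<pi> dvd v - t * u" using t(2) by simp
    then have "\<pi> ^ k * \<pi> dvd \<pi> ^ k * (v - t * u)" by (rule mult_dvd_mono[OF dvd_refl])
    then have "\<pi> ^ Suc k dvd \<pi> ^ k * (v - t * u) + \<pi> ^ Suc k * w"
      unfolding power_Suc2 by (rule dvd_add) simp
    moreover have "f (Z + W (- t)) = \<pi> ^ k * (v - t * u) + \<pi> ^ Suc k * w"
      unfolding w v by (simp add: algebra_simps)
    ultimately have "\<pi> ^ Suc k dvd f (Z + W (- t))" by (simp only:)
    then have "Z - W t \<in> D (Suc k)"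
      using WA[of Z "- t"] ZA unfolding D_def Wneg by simp
    then have "Z \<in> (+) (W t) ` D (Suc k)" by (simp only: jordan_translate_mem)
    then show "Z \<in> (\<Union>t\<in>zp_residues 1. (+) (W t) ` D (Suc k))" by (rule UN_I[OF t(1)])
  next
    fix Z assume "Z \<in> (\<Union>t\<in>zp_residues 1. (+) (W t) ` D (Suc k))"
    then obtain t where "Z - W t \<in> D (Suc k)" using jordan_translate_mem by blast
    moreover define X where "X = Z - W t"
    ultimately have XA: "X \<in> A" "\<pi> ^ Suc k dvd f X" and X: "Z = X + W t" by (simp_all add: D_def)
    obtain u w where "f Z = f X + \<pi> ^ k * (t * u) + \<pi> ^ Suc k * w" using dir[OF XA(1)] X by blast
    moreover have "\<pi> ^ k dvd f X" using XA(2) by (rule dvd_trans[rotated]) simp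
    ultimately have "\<pi> ^ k dvd f Z" by simp
    then show "Z \<in> D k" using XA(1) WA X by (simp add: D_def)
  qed
  also have "vol \<dots> = (\<Sum>t\<in>zp_residues 1. vol ((+) (W t) ` D (Suc k)))"
  proof (rule vol_disjoint_Union)
    show "jordan_level (Suc k) ((+) (W t) ` D (Suc k))" for t
      by (rule jordan_level_translate) (rule lev, simp)
    fix s t :: "'p zp" assume st: "s \<in> zp_residues 1" "t \<in> zp_residues 1" "s \<noteq> t"
    have False if Z: "Z - W s \<in> D (Suc k)" "Z - W t \<in> D (Suc k)" for Z
    proof -
      have eq: "Z - W t = (Z - W s) + W (s - t)" by (simp add: Wdiff)
      have "Z - W s \<in> A" using Z(1) unfolding D_def by blast
      from dir[OF this] obtain u w where u: "\<not> \<pi> dvd u" and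
        w: "f (Z - W t) = f (Z - W s) + \<pi> ^ k * ((s - t) * u) + \<pi> ^ Suc k * w"
        unfolding eq by blast
      have "\<pi> ^ k * ((s - t) * u) = f (Z - W t) - f (Z - W s) - \<pi> ^ Suc k * w" unfolding w by simp
      moreover have "\<pi> ^ Suc k dvd f (Z - W t) - f (Z - W s) - \<pi> ^ Suc k * w"
        by (rule dvd_diff[OF dvd_diff]) (use Z in \<open>simp_all add: D_def\<close>)
      ultimately have "\<pi> ^ k * \<pi> dvd \<pi> ^ k * ((s - t) * u)" unfolding power_Suc2 by simp
      then have "\<pi> dvd (s - t) * u" by (simp only: dvd_mult_cancel_left) simp
      then have "\<pi> ^ 1 dvd s - t" using u by (simp add: zp_prime_dvd_mult_iff)
      moreover have "\<pi> ^ 1 dvd s - s" by simp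
      ultimately show False using zp_residues(3)[of 1 s] st by blast
    qed
    then show "(+) (W s) ` D (Suc k) \<inter> (+) (W t) ` D (Suc k) = {}"
      using jordan_translate_mem by blast
  qed (rule zp_residues(2))
  also have "\<dots> = (\<Sum>t\<in>(zp_residues 1 :: 'p zp set). vol (D (Suc k)))"
    by (rule sum.cong[OF refl], rule vol_translate, rule lev) simp
  also have "\<dots> = q * vol (D (Suc k))" by (simp add: zp_residues(1) q)
  finally show ?thesis by (simp only: D_def)
qed

text \<open>The direction may depend on the residue class, so equidistribution is applied class by
  class and summed. Each further power of p costs a factor q, and valuation exactly k is the
  difference of two consecutive steps.\<close>

lemma vol_valuation:
  assumes f: "\<And>n X Y. X - Y \<in> jordan_box n n \<Longrightarrow> \<pi> ^ n dvd f X - f Y"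
    and R: "\<And>r. r \<in> R \<Longrightarrow> \<exists>Y. \<forall>X. jordan_red X = r \<longrightarrow> unit_direction f Y X"
    and k: "1 \<le> k"
  shows "vol {X. jordan_red X \<in> R \<and> \<pi> ^ k dvd f X \<and> \<not> \<pi> ^ Suc k dvd f X}
    = (1 - 1 / q) / q ^ (k - 1) * vol {X. jordan_red X \<in> R \<and> \<pi> dvd f X}"
proof -
  define D where "D n = {X. jordan_red X \<in> R \<and> \<pi> ^ n dvd f X}" for n
  have lev: "jordan_level n (D n)" if n: "1 \<le> n" for n
    unfolding D_def
    using jordan_level_dvd[OF jordan_level_red[OF n, of "\<lambda>r. r \<in> R"] f] unfolding mem_Collect_eq .
  have step: "vol (D n) = q * vol (D (Suc n))" if n: "1 \<le> n" for n
  proof -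
    have "vol (D n) = (\<Sum>r\<in>R. vol {X \<in> D n. jordan_red X = r})"
      by (rule vol_sum_residues[OF lev[OF n] n]) (simp add: D_def)
    also have "\<dots> = (\<Sum>r\<in>R. q * vol {X \<in> D (Suc n). jordan_red X = r})"
    proof (rule sum.cong[OF refl])
      fix r assume r: "r \<in> R"
      obtain Y where Y: "\<forall>X. jordan_red X = r \<longrightarrow> unit_direction f Y X" using R[OF r] by blast
      have "vol {X \<in> {X. jordan_red X = r}. \<pi> ^ n dvd f X} = q * vol {X \<in> {X. jordan_red X = r}. \<pi> ^ Suc n dvd f X}"
      proof (rule vol_equidistribution[OF jordan_level_red[of 1 "\<lambda>s. s = r"] f _ n])
        show "unit_direction f Y X" if "X \<in> {X. jordan_red X = r}" for X using that Y by blast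
      qed simp
      moreover have "{X \<in> {X. jordan_red X = r}. \<pi> ^ m dvd f X} = {X \<in> D m. jordan_red X = r}" for m
        using r unfolding D_def by blast
      ultimately show "vol {X \<in> D n. jordan_red X = r} = q * vol {X \<in> D (Suc n). jordan_red X = r}"
        by (simp only:)
    qed
    also have "\<dots> = q * vol (D (Suc n))"
      unfolding sum_distrib_left[symmetric]
      by (subst vol_sum_residues[OF lev, of "Suc n" R]) (simp_all add: D_def)
    finally show ?thesis .
  qed
  have D: "vol (D (Suc n)) = vol (D 1) / q ^ n" for n
  proof (induction n)
    case (Suc n)
    then show ?case using step[of "Suc n"] q_gt_1 by (simp add: field_simps)
  qed simp
  have "{X. jordan_red X \<in> R \<and> \<pi> ^ k dvd f X \<and> \<not> \<pi> ^ Suc k dvd f X} = D k - D (Suc k)"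
    unfolding D_def by blast
  also have "vol \<dots> = vol (D k) - vol (D (Suc k))"
  proof (rule vol_Diff)
    show "jordan_level (Suc k) (D k)" by (rule jordan_level_mono[OF lev[OF k]]) simp
    show "jordan_level (Suc k) (D (Suc k))" by (rule lev) simp
    show "D (Suc k) \<subseteq> D k" unfolding D_def using dvd_trans[OF le_imp_power_dvd[of k "Suc k" \<pi>]] by auto
  qed
  also have "\<dots> = (1 - 1 / q) * vol (D k)" using step[OF k] q_gt_1 by (simp add: field_simps)
  also have "vol (D k) = vol (D 1) / q ^ (k - 1)" using D[of "k - 1"] k by simp
  finally show ?thesis by (simp add: D_def)
qed

end

section \<open>Volumes of the orbits\<close>

lemma jordan_lin_add_right: "jordan_lin X (Y + Z) = jordan_lin X Y + jordan_lin X Z"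
  by (cases X; cases Y; cases Z) (simp add: cayley_inner_linear algebra_simps)

text \<open>The differential is rewritten by determinants and by the pairing in its linear argument,
  both of which respect congruences.\<close>

lemma jordan_lin_level:
  assumes "X - X' \<in> jordan_box n n"
  shows "\<pi> ^ n dvd jordan_lin X Y - jordan_lin X' Y"
proof -
  obtain W where "X - X' = jordan_scale (\<pi> ^ n) W" using assms by (auto simp: jordan_box_eq_dvd jordan_dvd_iff)
  then have X: "X = X' + jordan_scale (\<pi> ^ n) W" by (simp add: algebra_simps)
  have "jordan_lin X Y = jordan_det (X + Y) - jordan_det X - jordan_lin Y X - jordan_det Y" for X
    by (simp add: jordan_det_add)
  then have "jordan_lin X Y - jordan_lin X' Y = (jordan_det (X + Y) - jordan_det (X' + Y))
      - (jordan_det X - jordan_det X') - \<pi> ^ n * jordan_lin Y W"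
    by (simp add: X jordan_lin_add_right jordan_lin_scale)
  moreover have "\<pi> ^ n dvd jordan_det (X + Y) - jordan_det (X' + Y)"
    by (rule jordan_det_level) (use assms in simp)
  ultimately show ?thesis using jordan_det_level[OF assms] by (simp add: dvd_diff)
qed

lemma zp_dvd_diff_iff:
  fixes r s :: "'p::prime_card zp"
  assumes "m \<le> n" "\<pi> ^ n dvd r - s"
  shows "\<pi> ^ m dvd r \<longleftrightarrow> \<pi> ^ m dvd s"
proof -
  have "\<pi> ^ m dvd r - s" using dvd_trans[OF le_imp_power_dvd[OF assms(1)] assms(2)] .
  then show ?thesis using dvd_add_right_iff[of "\<pi> ^ m" "r - s" s] by simp
qed

text \<open>The largest exponent that the definition tests is i + j + k + 1.\<close>

lemma jordan_level_type:
  assumes "i + j + k < n"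
  shows "jordan_level n {X. jordan_type i j k X}"
  unfolding jordan_level_def mem_Collect_eq
proof (intro allI impI)
  fix X Y :: "'a zp jordan" assume XY: "X - Y \<in> jordan_box n n"
  have 1: "jordan_dvd m X \<longleftrightarrow> jordan_dvd m Y" if "m \<le> n" for m
  proof -
    have "X - Y \<in> jordan_box m m" using XY jordan_box_mono[OF that that] by blast
    then show ?thesis
      unfolding jordan_box_eq_dvd[symmetric]
      using jordan_box_add[of "X - Y" m m Y] jordan_box_diff[of X m m "X - Y"] by auto
  qed
  have 2: "jordan_lin_dvd m X \<longleftrightarrow> jordan_lin_dvd m Y" if "m \<le> n" for m
    unfolding jordan_lin_dvd_def using zp_dvd_diff_iff[OF that jordan_lin_level[OF XY]] by blast
  have 3: "\<pi> ^ m dvd jordan_det X \<longleftrightarrow> \<pi> ^ m dvd jordan_det Y" if "m \<le> n" for m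
    by (rule zp_dvd_diff_iff[OF that jordan_det_level[OF XY]])
  show "jordan_type i j k X \<longleftrightarrow> jordan_type i j k Y"
    unfolding jordan_type_def using assms 1[of i] 1[of "Suc i"] 2[of "i + j"] 2[of "Suc (i + j)"]
      3[of "i + j + k"] 3[of "Suc (i + j + k)"] by auto
qed

text \<open>Scaling commutes with the group, so the orbit of p^i D is p^i times the orbit of
  D.\<close>

lemma jordan_type_scale:
  assumes "i \<le> j" "j \<le> k"
  shows "{X :: 'p::prime_card zp jordan. jordan_type i j k X} = jordan_scale (\<pi> ^ i) ` {X. jordan_type 0 (j - i) (k - i) X}"
proof -
  let ?D = "jordan_diag 1 (\<pi> ^ (j - i)) (\<pi> ^ (k - i)) :: 'p zp jordan"
  have D: "jordan_diag (\<pi> ^ i) (\<pi> ^ j) (\<pi> ^ k) = jordan_scale (\<pi> ^ i) ?D"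
    using assms by (simp add: jordan_diag_def flip: power_add)
  have 0: "jordan_type 0 (j - i) (k - i) X \<longleftrightarrow> X \<sim>\<^sub>J ?D" for X
    using jordan_type_iff_equiv[of 0 "j - i" "k - i" X] assms by simp
  have "X \<sim>\<^sub>J jordan_scale (\<pi> ^ i) ?D \<longleftrightarrow> (\<exists>Y. X = jordan_scale (\<pi> ^ i) Y \<and> Y \<sim>\<^sub>J ?D)" for X
  proof
    assume "X \<sim>\<^sub>J jordan_scale (\<pi> ^ i) ?D"
    then obtain g where g: "g \<in> jordan_group" "g (jordan_scale (\<pi> ^ i) ?D) = X"
      using jordan_equiv_sym unfolding jordan_equiv_def by blast
    then have "X = jordan_scale (\<pi> ^ i) (g ?D)" by (metis jordan_groupD(2))
    moreover have "g ?D \<sim>\<^sub>J ?D" by (rule jordan_equiv_sym) (use g(1) in \<open>auto simp: jordan_equiv_def\<close>)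
    ultimately show "\<exists>Y. X = jordan_scale (\<pi> ^ i) Y \<and> Y \<sim>\<^sub>J ?D" by blast
  next
    assume "\<exists>Y. X = jordan_scale (\<pi> ^ i) Y \<and> Y \<sim>\<^sub>J ?D"
    then show "X \<sim>\<^sub>J jordan_scale (\<pi> ^ i) ?D" using jordan_scale_equiv by blast
  qed
  then show ?thesis unfolding jordan_type_iff_equiv[OF assms] D 0 by blast
qed

lemma jordan_type_000_iff: "jordan_type 0 0 0 X \<longleftrightarrow> jordan_det (jordan_red X) \<noteq> 0"
proof
  assume "jordan_type 0 0 0 X"
  then show "jordan_det (jordan_red X) \<noteq> 0" by (simp add: jordan_type_def jordan_det_red zp_red_eq_0_iff)
next
  assume "jordan_det (jordan_red X) \<noteq> 0"
  then have u: "\<not> \<pi> ^ 1 dvd jordan_det X" by (simp add: jordan_det_red zp_red_eq_0_iff)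
  then have "jordan_det X \<noteq> 0" by auto
  then obtain i j k where *: "i \<le> j" "j \<le> k" "X \<sim>\<^sub>J jordan_diag (\<pi> ^ i) (\<pi> ^ j) (\<pi> ^ k)"
    by (rule jordan_diagonalize)
  then have "i + j + k = 0"
    using u unfolding jordan_det_dvd_equiv[OF *(3)] jordan_invariants_diag[OF *(1,2)] by simp
  then show "jordan_type 0 0 0 X" using * jordan_type_iff_equiv[of 0 0 0 X] by simp
qed

text \<open>In the normal form diag(p^i, p^j, p^l), an adjoint that is nonzero modulo p forces i + j
  = 0, and the valuation of the determinant then gives l = k.\<close>

lemma jordan_type_00k_iff:
  assumes "1 \<le> k"
  shows "jordan_type 0 0 k X \<longleftrightarrow> \<not> rank_le_1 (jordan_red X) \<and> \<pi> ^ k dvd jordan_det X \<and> \<not> \<pi> ^ Suc k dvd jordan_det X"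
proof
  assume "jordan_type 0 0 k X"
  then show "\<not> rank_le_1 (jordan_red X) \<and> \<pi> ^ k dvd jordan_det X \<and> \<not> \<pi> ^ Suc k dvd jordan_det X"
    unfolding jordan_type_def rank_le_1_red by simp
next
  assume X: "\<not> rank_le_1 (jordan_red X) \<and> \<pi> ^ k dvd jordan_det X \<and> \<not> \<pi> ^ Suc k dvd jordan_det X"
  then have "jordan_det X \<noteq> 0" by (metis dvd_0_right)
  then obtain i j l where *: "i \<le> j" "j \<le> l" "X \<sim>\<^sub>J jordan_diag (\<pi> ^ i) (\<pi> ^ j) (\<pi> ^ l)"
    by (rule jordan_diagonalize)
  have "i + j = 0" "i + j + l = k"
    using X unfolding rank_le_1_red jordan_det_dvd_equiv[OF *(3)] jordan_lin_dvd_equiv[OF *(3)]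
      jordan_invariants_diag[OF *(1,2)] by linarith+
  then show "jordan_type 0 0 k X" using * jordan_type_iff_equiv[of 0 0 k X] by simp
qed

text \<open>For a nonzero corner the whole Schur complement vanishes. For a = 0 the vectors x and y
  are null, and the trace term reduces to 2 b N(y).\<close>

lemma rank_le_1_det:
  fixes r :: "'a::field jordan"
  assumes "rank_le_1 r"
  shows "jordan_det r = 0"
proof -
  obtain a b c x y z where r: "r = (a, b, c, x, y, z)" by (cases r)
  have *: "cayley_norm y = a * c" "cayley_norm x = a * b" "cayley_mult x z = b *s y" "cayley_mult (cayley_conj x) y = a *s z"
    using assms by (simp_all add: rank_le_1_def r)
  show ?thesis
  proof (cases "a = 0")
    case True
    then show ?thesis unfolding r jordan_det_eq * by (simp add: cayley_inner_linear cayley_inner_self *)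
  next
    case False
    then show ?thesis using chart_identity[of a b c x y z] by (simp add: * block_norm_def r)
  qed
qed

section \<open>The Schur complement at a unit corner\<close>

fun block_dvd :: "nat \<Rightarrow> 'p::prime_card zp jordan \<Rightarrow> bool" where
  "block_dvd n (a, b, c, x, y, z) \<longleftrightarrow> \<pi> ^ n dvd b \<and> \<pi> ^ n dvd c \<and> (\<forall>i. \<pi> ^ n dvd z $ i)"

text \<open>The Schur complement is recorded together with the first row, which makes it a map of
  the module to itself, invertible where the corner is a unit.\<close>

fun block_chart :: "'a::comm_ring_1 jordan \<Rightarrow> 'a jordan" where
  "block_chart (a, b, c, x, y, z) =
     (a, a * b - cayley_norm x, a * c - cayley_norm y, x, y, a *s z - cayley_mult (cayley_conj x) y)"

lemma jordan_det_chart: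
  fixes X :: "'a::idom jordan"
  shows "fst X * jordan_det X = block_quad (block_chart X)"
  by (cases X) (simp add: chart_identity block_quad_def del: jordan_det.simps)

text \<open>For a unit corner, the three entries of the adjoint that involve \<open>a\<close>
  control the others: after substitution of a b, a c and a z, the element a^2 (b c - N z) and
  \<open>a\<close> times the two remaining Cayley entries become multiples of p^n.\<close>

lemma jordan_lin_dvd_chart:
  fixes X :: "'p::prime_card zp jordan"
  assumes "\<not> \<pi> dvd fst X"
  shows "jordan_lin_dvd n X \<longleftrightarrow> block_dvd n (block_chart X)"
proof -
  obtain a b c x y z where X: "X = (a, b, c, x, y, z)" by (cases X)
  have a: "\<not> \<pi> dvd a" using assms by (simp add: X)
  have neg: "(\<forall>i. \<pi> ^ n dvd (cayley_mult (cayley_conj x) y - a *s z) $ i)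
      \<longleftrightarrow> (\<forall>i. \<pi> ^ n dvd (a *s z - cayley_mult (cayley_conj x) y) $ i)"
    unfolding vector_minus_component
    using dvd_minus_iff[of "\<pi> ^ n" "cayley_mult (cayley_conj x) y $ i - (a *s z) $ i" for i]
    by (simp only: minus_diff_eq)
  show ?thesis
  proof
    assume "jordan_lin_dvd n X"
    then show "block_dvd n (block_chart X)"
      unfolding X jordan_lin_dvd_iff neg block_chart.simps block_dvd.simps by blast
  next
    assume B: "block_dvd n (block_chart X)"
    then obtain \<beta> \<gamma> \<zeta> where \<beta>: "a * b = cayley_norm x + \<pi> ^ n * \<beta>" and \<gamma>: "a * c = cayley_norm y + \<pi> ^ n * \<gamma>"
      and \<zeta>: "a *s z = cayley_mult (cayley_conj x) y + \<pi> ^ n *s \<zeta>"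
      unfolding X block_chart.simps block_dvd.simps vec_dvd_iff by (auto elim!: dvdE simp: algebra_simps)
    have "a ^ 2 * (b * c - cayley_norm z) = (a * b) * (a * c) - cayley_norm (a *s z)"
      by (simp add: cayley_norm_scale algebra_simps power2_eq_square)
    also have "\<dots> = \<pi> ^ n * (\<beta> * cayley_norm y + \<gamma> * cayley_norm x + \<pi> ^ n * \<beta> * \<gamma>
        - cayley_inner (cayley_mult (cayley_conj x) y) \<zeta> - \<pi> ^ n * cayley_norm \<zeta>)"
      unfolding \<beta> \<gamma> \<zeta> cayley_norm_add
      by (simp add: cayley_norm_mult cayley_norm_scale cayley_inner_linear algebra_simps power2_eq_square)
    finally have "\<pi> ^ n dvd a ^ 2 * (b * c - cayley_norm z)" by simp
    moreover have "\<not> \<pi> dvd a ^ 2" using a by (simp add: power2_eq_square zp_prime_dvd_mult_iff)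
    ultimately have 1: "\<pi> ^ n dvd b * c - cayley_norm z" using zp_power_dvd_mult_unit(1) by blast
    have cancel: "\<forall>i. \<pi> ^ n dvd v $ i" if "a *s v = \<pi> ^ n *s w" for v w :: "'p zp cayley"
    proof
      fix i
      have "a * v $ i = \<pi> ^ n * w $ i" using that by (metis vector_smult_component)
      then have "\<pi> ^ n dvd a * v $ i" by simp
      then show "\<pi> ^ n dvd v $ i" by (simp only: zp_power_dvd_mult_unit[OF a])
    qed
    have "a *s (cayley_mult y (cayley_conj z) - c *s x) = cayley_mult y (cayley_conj (a *s z)) - (a * c) *s x"
      by (simp add: cayley_conj_linear cayley_mult_scale_right vector_ssub_ldistrib vector_smult_assoc)
    also have "\<dots> = \<pi> ^ n *s (cayley_mult y (cayley_conj \<zeta>) - \<gamma> *s x)"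
      unfolding \<gamma> \<zeta>
      by (simp add: cayley_conj_linear cayley_conj_mult cayley_mult_add_right cayley_mult_conj_left
          cayley_mult_scale_right vector_ssub_ldistrib vector_smult_assoc vector_sadd_rdistrib)
    finally have 2: "\<forall>i. \<pi> ^ n dvd (cayley_mult y (cayley_conj z) - c *s x) $ i" by (rule cancel)
    have "a *s (cayley_mult x z - b *s y) = cayley_mult x (a *s z) - (a * b) *s y"
      by (simp add: cayley_mult_scale_right vector_ssub_ldistrib vector_smult_assoc)
    also have "\<dots> = \<pi> ^ n *s (cayley_mult x \<zeta> - \<beta> *s y)"
      unfolding \<beta> \<zeta>
      by (simp add: cayley_mult_add_right cayley_mult_conj_left
          cayley_mult_scale_right vector_ssub_ldistrib vector_smult_assoc vector_sadd_rdistrib)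
    finally have 3: "\<forall>i. \<pi> ^ n dvd (cayley_mult x z - b *s y) $ i" by (rule cancel)
    show "jordan_lin_dvd n X"
      using B 1 2 3 unfolding X jordan_lin_dvd_iff neg block_chart.simps block_dvd.simps by blast
  qed
qed

text \<open>The counterpart of \<open>jordan_type\<close> in the chart: the content of the block is
  that of the adjoint, and the valuation of the form is that of the determinant.\<close>

definition block_type :: "nat \<Rightarrow> nat \<Rightarrow> 'p::prime_card zp jordan \<Rightarrow> bool" where
  "block_type j k X \<longleftrightarrow> block_dvd j X \<and> \<not> block_dvd (Suc j) X \<and>
     \<pi> ^ (j + k) dvd block_quad X \<and> \<not> \<pi> ^ Suc (j + k) dvd block_quad X"

lemma jordan_type_chart:
  fixes X :: "'p::prime_card zp jordan"
  assumes "\<not> \<pi> dvd fst X"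
  shows "jordan_type 0 j k X \<longleftrightarrow> block_type j k (block_chart X)"
proof -
  have "jordan_dvd 0 X" "\<not> jordan_dvd (Suc 0) X" using assms by (cases X; simp)+
  moreover have d: "\<pi> ^ m dvd jordan_det X \<longleftrightarrow> \<pi> ^ m dvd block_quad (block_chart X)" for m
    unfolding jordan_det_chart[symmetric] by (simp only: zp_power_dvd_mult_unit[OF assms])
  ultimately show ?thesis
    unfolding jordan_type_def block_type_def jordan_lin_dvd_chart[OF assms] d add_0 by blast
qed

definition rank_1_point :: "'a::comm_ring_1 \<Rightarrow> 'a jordan" where
  "rank_1_point u = (u, 0, 0, 0, 0, 0)"

lemma red_rank_1_point_iff:
  "jordan_red (a, b, c, x, y, z) = rank_1_point u \<longleftrightarrow>
     zp_red a = u \<and> \<pi> dvd b \<and> \<pi> dvd c \<and> (\<forall>i. \<pi> dvd x $ i) \<and> (\<forall>i. \<pi> dvd y $ i) \<and> (\<forall>i. \<pi> dvd z $ i)"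
  by (simp add: rank_1_point_def zp_red_eq_0_iff vec_eq_iff)

lemma block_level:
  assumes "j + k < n"
  shows "jordan_level n {X. block_type j k X}"
  unfolding jordan_level_def mem_Collect_eq
proof (intro allI impI)
  fix X Y :: "'a zp jordan" assume XY: "X - Y \<in> jordan_box n n"
  have 1: "block_dvd m X \<longleftrightarrow> block_dvd m Y" if "m \<le> n" for m
  proof -
    obtain a b c x y z a' b' c' x' y' z' where *: "X = (a, b, c, x, y, z)" "Y = (a', b', c', x', y', z')"
      by (cases X, cases Y)
    have "\<pi> ^ n dvd b - b'" "\<pi> ^ n dvd c - c'" "\<And>i. \<pi> ^ n dvd z $ i - z' $ i"
      using XY by (simp_all add: * jordan_box_mem)
    then show ?thesis unfolding * block_dvd.simps using zp_dvd_diff_iff[OF that] by blast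
  qed
  have 2: "\<pi> ^ m dvd block_quad X \<longleftrightarrow> \<pi> ^ m dvd block_quad Y" if "m \<le> n" for m
    by (rule zp_dvd_diff_iff[OF that block_quad_level[OF XY]])
  show "block_type j k X \<longleftrightarrow> block_type j k Y"
    unfolding block_type_def using assms 1[of j] 1[of "Suc j"] 2[of "j + k"] 2[of "Suc (j + k)"] by auto
qed

text \<open>The first row is cleared over the p-adic integers, not just over the residue field, so
  that the move belongs to the structure group. Since the adjoint vanishes modulo p and the corner
  is a unit, the block that remains is divisible by p.\<close>

lemma equiv_rank_1_point:
  fixes X :: "'p::prime_card zp jordan"
  assumes "rank_le_1 (jordan_red X)" "jordan_red X \<noteq> 0"
  obtains g u where "g \<in> jordan_group" "u \<noteq> 0" "jordan_red (g X) = rank_1_point u"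
proof -
  have "\<not> jordan_dvd 1 X"
  proof
    assume "jordan_dvd 1 X"
    then have "X - 0 \<in> jordan_box 1 1" by (simp add: jordan_box_eq_dvd del: diff_zero)
    then have "jordan_red X = jordan_red 0" by (simp only: jordan_red_eq_iff)
    then show False using assms(2) by (simp add: zero_prod_def zp_red_hom vec_red_hom)
  qed
  then obtain a b c x y z where 1: "X \<sim>\<^sub>J (a, b, c, x, y, z)" and a: "\<not> \<pi> dvd a"
    using equiv_unit_entry by blast
  obtain b' c' z' where "(a, b, c, x, y, z) \<sim>\<^sub>J (a, b', c', 0, 0, z')"
    by (rule equiv_clear_first_row[OF a])
  then have X: "X \<sim>\<^sub>J (a, b', c', 0, 0, z')" using 1 jordan_equiv_trans by blast
  have "jordan_lin_dvd 1 (a, b', c', 0, 0, z')"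
    using assms(1) jordan_lin_dvd_equiv[OF X] by (simp add: rank_le_1_red)
  then have "block_dvd 1 (block_chart (a, b', c', 0, 0, z'))"
    using jordan_lin_dvd_chart[of "(a, b', c', 0, 0, z')" 1] a by simp
  then have "\<pi> dvd b'" "\<pi> dvd c'" "\<forall>i. \<pi> dvd z' $ i"
    using a by (simp_all add: zp_prime_dvd_mult_iff)
  then have "jordan_red (a, b', c', 0, 0, z') = rank_1_point (zp_red a)"
    by (simp add: red_rank_1_point_iff del: jordan_red.simps)
  moreover have "zp_red a \<noteq> 0" using a by (simp add: zp_red_eq_0_iff)
  moreover obtain g where "g \<in> jordan_group" "g X = (a, b', c', 0, 0, z')"
    using X unfolding jordan_equiv_def by blast
  ultimately show thesis using that[of g "zp_red a"] by simp
qed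

section \<open>Volumes of the residue classes of rank one\<close>

context jordan_haar
begin

text \<open>A group element respects congruences modulo every power of p in both directions and
  preserves the type, so it carries the part of the orbit over Z into the part over g Z.\<close>

lemma vol_type_residue_le:
  assumes g: "g \<in> jordan_group"
  shows "vol {X. jordan_type i j k X \<and> jordan_red X = jordan_red Z}
    \<le> vol {X. jordan_type i j k X \<and> jordan_red X = jordan_red (g Z)}"
proof -
  let ?n = "Suc (i + j + k)"
  have lev: "jordan_level ?n {X. jordan_type i j k X \<and> jordan_red X = r}" for r
    using jordan_level_Int[OF jordan_level_type[of i j k ?n] jordan_level_red[of ?n "\<lambda>s. s = r"]]
    by (simp add: Int_def)
  have dvd: "g X - g Y \<in> jordan_box n n \<longleftrightarrow> X - Y \<in> jordan_box n n" for X Y n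
    unfolding jordan_groupD(4)[OF g, symmetric] jordan_box_eq_dvd
    by (rule jordan_dvd_equiv[symmetric]) (use g in \<open>unfold jordan_equiv_def, blast\<close>)
  show ?thesis
  proof (rule vol_le[OF lev lev, where \<Phi> = g])
    fix X assume X: "X \<in> {X. jordan_type i j k X \<and> jordan_red X = jordan_red Z}"
    have "X \<sim>\<^sub>J g X" unfolding jordan_equiv_def using g by blast
    then have "jordan_type i j k (g X)"
      using X jordan_dvd_equiv jordan_lin_dvd_equiv jordan_det_dvd_equiv unfolding jordan_type_def by blast
    moreover have "jordan_red (g X) = jordan_red (g Z)"
      using X unfolding jordan_red_eq_iff dvd by blast
    ultimately show "g X \<in> {X. jordan_type i j k X \<and> jordan_red X = jordan_red (g Z)}" by blast
  qed (simp only: dvd)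
qed

lemma vol_type_residue:
  assumes g: "g \<in> jordan_group"
  shows "vol {X. jordan_type i j k X \<and> jordan_red X = jordan_red Z}
    = vol {X. jordan_type i j k X \<and> jordan_red X = jordan_red (g Z)}"
proof (rule antisym)
  have "inv_into UNIV g (g Z) = Z" by (rule inv_f_f[OF bij_is_inj[OF jordan_groupD(5)[OF g]]])
  then show "vol {X. jordan_type i j k X \<and> jordan_red X = jordan_red (g Z)}
      \<le> vol {X. jordan_type i j k X \<and> jordan_red X = jordan_red Z}"
    using vol_type_residue_le[OF inv_jordan_group[OF g], of i j k "g Z"] by simp
qed (rule vol_type_residue_le[OF g])

text \<open>On this residue class the corner is a unit, so the chart and its inverse both respect
  congruences modulo p^n. Each yields one of the two inequalities.\<close>

lemma vol_type_chart:
  assumes "u \<noteq> 0"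
  shows "vol {X. jordan_type 0 j k X \<and> jordan_red X = rank_1_point u}
    = vol {X. block_type j k X \<and> jordan_red X = rank_1_point u}"
proof -
  let ?n = "Suc (j + k)"
  let ?S = "{X. jordan_type 0 j k X \<and> jordan_red X = rank_1_point u}"
  let ?B = "{X. block_type j k X \<and> jordan_red X = rank_1_point u}"
  have S: "jordan_level ?n ?S"
    using jordan_level_Int[OF jordan_level_type[of 0 j k ?n] jordan_level_red[of ?n "\<lambda>s. s = rank_1_point u"]]
    by (simp add: Int_def)
  have B: "jordan_level ?n ?B"
    using jordan_level_Int[OF block_level[of j k ?n] jordan_level_red[of ?n "\<lambda>s. s = rank_1_point u"]]
    by (simp add: Int_def)
  have unit: "\<not> \<pi> dvd fst X" if "jordan_red X = rank_1_point u" for X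
    using that assms by (cases X) (auto simp: red_rank_1_point_iff zp_red_eq_0_iff simp del: jordan_red.simps)
  obtain \<iota> where \<iota>: "\<And>a :: 'p zp. \<not> \<pi> dvd a \<Longrightarrow> a * \<iota> a = 1" using zp_inverse_exists by metis
  \<comment> \<open>The inverse of the chart: its equations are solved for b, c and z by means of
    the inverse \<open>\<iota> a\<close> of the corner.\<close>
  define \<Psi> where "\<Psi> X = (case X of (a, b, c, x, y, z) \<Rightarrow>
      (a, \<iota> a * (b + cayley_norm x), \<iota> a * (c + cayley_norm y), x, y, \<iota> a *s (z + cayley_mult (cayley_conj x) y)))"
    for X :: "'p zp jordan"
  have \<Psi>: "block_chart (\<Psi> X) = X" "fst (\<Psi> X) = fst X" if "\<not> \<pi> dvd fst X" for X
  proof -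
    obtain a b c x y z where X: "X = (a, b, c, x, y, z)" by (cases X)
    have "a * \<iota> a = 1" using \<iota>[of a] that by (simp add: X)
    then show "block_chart (\<Psi> X) = X" "fst (\<Psi> X) = fst X"
      by (simp_all add: \<Psi>_def X vec_eq_iff flip: mult.assoc)
  qed
  have red: "jordan_red (block_chart X) = rank_1_point u \<longleftrightarrow> jordan_red X = rank_1_point u"
    if "\<not> \<pi> dvd fst X" for X
  proof -
    obtain a b c x y z where X: "X = (a, b, c, x, y, z)" by (cases X)
    have a: "\<not> \<pi> dvd a" using that by (simp add: X)
    have "zp_red (cayley_norm x) = 0" "vec_red (cayley_mult (cayley_conj x) y) = 0" "zp_red (cayley_norm y) = 0"
      if "\<forall>i. \<pi> dvd x $ i" "\<forall>i. \<pi> dvd y $ i"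
    proof -
      have "vec_red x = 0" "vec_red y = 0" using that by (simp_all add: vec_eq_iff zp_red_eq_0_iff)
      then show "zp_red (cayley_norm x) = 0" "vec_red (cayley_mult (cayley_conj x) y) = 0" "zp_red (cayley_norm y) = 0"
        by (simp_all flip: cayley_norm_red cayley_mult_red)
    qed
    then have "\<pi> dvd cayley_norm x" "\<pi> dvd cayley_norm y" "\<forall>i. \<pi> dvd cayley_mult (cayley_conj x) y $ i"
      if "\<forall>i. \<pi> dvd x $ i" "\<forall>i. \<pi> dvd y $ i"
      using that by (simp_all add: vec_eq_iff zp_red_eq_0_iff)
    note 1 = this
    have 2: "\<pi> dvd a * r - s \<longleftrightarrow> \<pi> dvd r" if "\<pi> dvd s" for r s
    proof -
      have "\<pi> dvd a * r - s \<longleftrightarrow> \<pi> dvd a * r" using dvd_diff_left_iff that by blast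
      then show ?thesis using a by (simp add: zp_prime_dvd_mult_iff)
    qed
    show ?thesis
      unfolding X block_chart.simps red_rank_1_point_iff vector_minus_component vector_smult_component
      using 1 2 by blast
  qed
  have inj: "X - Y \<in> jordan_box ?n ?n"
    if XY: "block_chart X - block_chart Y \<in> jordan_box ?n ?n" and u: "\<not> \<pi> dvd fst X" for X Y :: "'p zp jordan"
  proof -
    obtain a b c x y z a' b' c' x' y' z' where *: "X = (a, b, c, x, y, z)" "Y = (a', b', c', x', y', z')"
      by (cases X, cases Y)
    obtain W where "block_chart X - block_chart Y = jordan_scale (\<pi> ^ ?n) W"
      using XY unfolding jordan_box_eq_dvd jordan_dvd_iff by blast
    then have "block_chart X = block_chart Y + jordan_scale (\<pi> ^ ?n) W" by (simp add: algebra_simps)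
    moreover obtain a'' b'' c'' x'' y'' z'' where W: "W = (a'', b'', c'', x'', y'', z'')" by (cases W)
    ultimately have "(a, a * b - cayley_norm x, a * c - cayley_norm y, x, y, a *s z - cayley_mult (cayley_conj x) y)
      = (a' + \<pi> ^ ?n * a'', a' * b' - cayley_norm x' + \<pi> ^ ?n * b'', a' * c' - cayley_norm y' + \<pi> ^ ?n * c'',
        x' + \<pi> ^ ?n *s x'', y' + \<pi> ^ ?n *s y'', a' *s z' - cayley_mult (cayley_conj x') y' + \<pi> ^ ?n *s z'')"
      by (simp only: * block_chart.simps jordan_scale.simps add_Pair)
    then have a: "a = a' + \<pi> ^ ?n * a''" and b: "a * b - cayley_norm x = a' * b' - cayley_norm x' + \<pi> ^ ?n * b''"
      and c: "a * c - cayley_norm y = a' * c' - cayley_norm y' + \<pi> ^ ?n * c''"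
      and x: "x = x' + \<pi> ^ ?n *s x''" and y: "y = y' + \<pi> ^ ?n *s y''"
      and z: "a *s z - cayley_mult (cayley_conj x) y = a' *s z' - cayley_mult (cayley_conj x') y' + \<pi> ^ ?n *s z''"
      unfolding prod.inject by blast+
    have N: "\<exists>w. cayley_norm (v + \<pi> ^ ?n *s v') = cayley_norm v + \<pi> ^ ?n * w" for v v' :: "'p zp cayley"
      by (rule exI[of _ "cayley_inner v v' + \<pi> ^ ?n * cayley_norm v'"])
        (simp add: cayley_norm_add cayley_norm_scale cayley_inner_linear algebra_simps power2_eq_square del: power_Suc)
    have ua: "\<not> \<pi> dvd a" using u by (simp add: *)
    \<comment> \<open>The common shape of the equations for b, c and the coordinates of z. As a' is
      congruent to the unit a, the congruence can be divided by a.\<close>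
    have key: "\<pi> ^ ?n dvd r - r'" if "a * r - s = a' * r' - s' + \<pi> ^ ?n * t" "\<pi> ^ ?n dvd s - s'" for r r' s s' t
    proof -
      have "a * (r - r') = \<pi> ^ ?n * (t - a'' * r') + (s - s')"
        using that(1) unfolding a by (simp add: algebra_simps del: power_Suc)
      then have "\<pi> ^ ?n dvd a * (r - r')" using that(2) by (simp del: power_Suc)
      then show ?thesis by (simp only: zp_power_dvd_mult_unit[OF ua])
    qed
    obtain w where w: "cayley_norm x = cayley_norm x' + \<pi> ^ ?n * w" using N x by blast
    obtain v where v: "cayley_norm y = cayley_norm y' + \<pi> ^ ?n * v" using N y by blast
    have m: "cayley_mult (cayley_conj x) y = cayley_mult (cayley_conj x') y' + \<pi> ^ ?n *s
        (cayley_mult (cayley_conj x'') y' + cayley_mult (cayley_conj x') y'' + \<pi> ^ ?n *s cayley_mult (cayley_conj x'') y'')"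
      unfolding x y by (simp add: cayley_conj_linear cayley_mult_add_left cayley_mult_add_right
          cayley_mult_scale_left cayley_mult_scale_right vector_add_ldistrib vector_smult_assoc del: power_Suc)
    have "\<pi> ^ ?n dvd b - b'" by (rule key[OF b]) (simp add: w del: power_Suc)
    moreover have "\<pi> ^ ?n dvd c - c'" by (rule key[OF c]) (simp add: v del: power_Suc)
    moreover have "\<pi> ^ ?n dvd z $ i - z' $ i" for i
    proof (rule key)
      show "a * z $ i - cayley_mult (cayley_conj x) y $ i
          = a' * z' $ i - cayley_mult (cayley_conj x') y' $ i + \<pi> ^ ?n * z'' $ i"
        using arg_cong[OF z, of "\<lambda>v. v $ i"]
        by (simp only: vector_minus_component vector_smult_component vector_add_component)
      show "\<pi> ^ ?n dvd cayley_mult (cayley_conj x) y $ i - cayley_mult (cayley_conj x') y' $ i"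
        unfolding m by (simp del: power_Suc)
    qed
    ultimately show ?thesis
      unfolding * minus_prod_def by (simp add: jordan_box_mem a x y del: power_Suc)
  qed
  have lip: "block_chart X - block_chart Y \<in> jordan_box ?n ?n" if XY: "X - Y \<in> jordan_box ?n ?n" for X Y :: "'p zp jordan"
  proof -
    obtain a b c x y z a' b' c' x' y' z' where *: "X = (a, b, c, x, y, z)" "Y = (a', b', c', x', y', z')"
      by (cases X, cases Y)
    obtain W where "X - Y = jordan_scale (\<pi> ^ ?n) W"
      using XY unfolding jordan_box_eq_dvd jordan_dvd_iff by blast
    then have "X = Y + jordan_scale (\<pi> ^ ?n) W" by (simp add: algebra_simps)
    moreover obtain a'' b'' c'' x'' y'' z'' where W: "W = (a'', b'', c'', x'', y'', z'')" by (cases W)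
    ultimately have X: "X = (a' + \<pi> ^ ?n * a'', b' + \<pi> ^ ?n * b'', c' + \<pi> ^ ?n * c'',
        x' + \<pi> ^ ?n *s x'', y' + \<pi> ^ ?n *s y'', z' + \<pi> ^ ?n *s z'')"
      by (simp add: * del: power_Suc)
    have "block_chart X - block_chart Y = jordan_scale (\<pi> ^ ?n)
      (a'', a' * b'' + a'' * b' + \<pi> ^ ?n * a'' * b'' - cayley_inner x' x'' - \<pi> ^ ?n * cayley_norm x'',
        a' * c'' + a'' * c' + \<pi> ^ ?n * a'' * c'' - cayley_inner y' y'' - \<pi> ^ ?n * cayley_norm y'',
        x'', y'', a' *s z'' + a'' *s z' + (\<pi> ^ ?n * a'') *s z'' - (cayley_mult (cayley_conj x'') y'
          + cayley_mult (cayley_conj x') y'' + \<pi> ^ ?n *s cayley_mult (cayley_conj x'') y''))"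
      unfolding X *(2) block_chart.simps
      by (simp add: cayley_norm_add cayley_norm_scale cayley_inner_linear cayley_conj_linear
          cayley_mult_add_left cayley_mult_add_right cayley_mult_scale_left cayley_mult_scale_right
          vec_eq_iff algebra_simps power2_eq_square del: power_Suc)
    then show ?thesis unfolding jordan_box_eq_dvd jordan_dvd_iff by blast
  qed
  show ?thesis
  proof (rule antisym)
    show "vol ?S \<le> vol ?B"
    proof (rule vol_le[OF S B, of block_chart])
      show "block_chart X \<in> ?B" if "X \<in> ?S" for X
        using that red unit jordan_type_chart by blast
      show "X - Y \<in> jordan_box ?n ?n" if "X \<in> ?S" "block_chart X - block_chart Y \<in> jordan_box ?n ?n" for X Y
        using inj[OF that(2)] unit that(1) by blast
    qed
    show "vol ?B \<le> vol ?S"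
    proof (rule vol_le[OF B S, of \<Psi>])
      show "\<Psi> X \<in> ?S" if X: "X \<in> ?B" for X
      proof -
        have u: "\<not> \<pi> dvd fst X" using X unit by blast
        then have "\<not> \<pi> dvd fst (\<Psi> X)" using \<Psi>(2) by simp
        then show ?thesis using X red[of "\<Psi> X"] jordan_type_chart[of "\<Psi> X" j k] \<Psi>(1)[OF u] by simp
      qed
      show "X - Y \<in> jordan_box ?n ?n" if "X \<in> ?B" "Y \<in> ?B" "\<Psi> X - \<Psi> Y \<in> jordan_box ?n ?n" for X Y
      proof -
        have "\<not> \<pi> dvd fst X" "\<not> \<pi> dvd fst Y" using that unit by blast+
        then show ?thesis using lip[OF that(3)] \<Psi>(1) by simp
      qed
    qed
  qed
qed

text \<open>The residue class fixes the 17 coordinates of the first row modulo p, and the block is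
  p^j times a primitive one. So the set is a translate of a stretched set, of volume smaller by
  q^(17 + 10 j). The form gains the factor p^(2 j), which turns j + k into k - j.\<close>

lemma vol_block_type:
  assumes "1 \<le> j" "j \<le> k"
  shows "vol {X. block_type j k X \<and> jordan_red X = rank_1_point u}
    = vol {X. block_type 0 (k - j) X} / q ^ (17 + 10 * j)"
proof -
  obtain a0 :: "'p zp" where a0: "zp_red a0 = u" using zp_red_surj by blast
  let ?p = "\<lambda>X. rank_1_point a0 + jordan_stretch 1 j X"
  have mem: "block_type j k (?p X) \<longleftrightarrow> block_type 0 (k - j) X" for X
  proof -
    obtain a b c x y z where X: "X = (a, b, c, x, y, z)" by (cases X)
    have 1: "block_dvd (m + j) (?p X) \<longleftrightarrow> block_dvd m X" for m
      by (simp add: X rank_1_point_def power_add mult.commute[of "\<pi> ^ m"])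
    have "block_quad (?p X) = \<pi> ^ j * \<pi> ^ j * block_quad X"
      by (simp add: X rank_1_point_def block_quad_def block_norm_def cayley_norm_scale algebra_simps power2_eq_square)
    then have 2: "\<pi> ^ (m + (j + j)) dvd block_quad (?p X) \<longleftrightarrow> \<pi> ^ m dvd block_quad X" for m
      by (simp add: power_add mult.commute[of "\<pi> ^ m"])
    have e: "k - j + (j + j) = j + k" using assms by simp
    show ?thesis
      unfolding block_type_def
      using 1[of 0] 1[of "Suc 0"] 2[of "k - j"] 2[of "Suc (k - j)"] e by (simp del: power_Suc)
  qed
  have S: "{X. block_type j k X \<and> jordan_red X = rank_1_point u}
      = (+) (rank_1_point a0) ` (jordan_stretch 1 j ` {X. block_type 0 (k - j) X})" (is "?S = _")
  proof (intro equalityI subsetI)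
    fix X assume X: "X \<in> {X. block_type j k X \<and> jordan_red X = rank_1_point u}"
    obtain a b c x y z where X': "X = (a, b, c, x, y, z)" by (cases X)
    have "\<pi> ^ 1 dvd a - a0" "\<forall>i. \<pi> ^ 1 dvd x $ i" "\<forall>i. \<pi> ^ 1 dvd y $ i"
      using X a0 by (auto simp: X' red_rank_1_point_iff zp_red_eq_iff simp del: jordan_red.simps)
    moreover have "\<pi> ^ j dvd b" "\<pi> ^ j dvd c" "\<forall>i. \<pi> ^ j dvd z $ i"
      using X by (simp_all add: X' block_type_def)
    ultimately obtain a' b' c' x' y' z' where
      "a - a0 = \<pi> ^ 1 * a'" "b = \<pi> ^ j * b'" "c = \<pi> ^ j * c'" "x = \<pi> ^ 1 *s x'" "y = \<pi> ^ 1 *s y'" "z = \<pi> ^ j *s z'"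
      unfolding vec_dvd_iff by (elim dvdE exE) blast
    then have Y: "X = ?p (a', b', c', x', y', z')" by (simp add: X' rank_1_point_def algebra_simps)
    then have "block_type j k (?p (a', b', c', x', y', z'))" using X by blast
    then have "block_type 0 (k - j) (a', b', c', x', y', z')" by (simp only: mem)
    then show "X \<in> (+) (rank_1_point a0) ` (jordan_stretch 1 j ` {X. block_type 0 (k - j) X})"
      using Y by blast
  next
    fix X assume "X \<in> (+) (rank_1_point a0) ` (jordan_stretch 1 j ` {X. block_type 0 (k - j) X})"
    then obtain Y where Y: "X = ?p Y" "block_type 0 (k - j) Y" by blast
    obtain a b c x y z where Y': "Y = (a, b, c, x, y, z)" by (cases Y)
    have "\<pi> dvd (\<pi> :: 'p zp) ^ j" using assms(1) by (simp add: dvd_power)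
    then have "jordan_red X = rank_1_point u"
      using a0 unfolding Y(1) Y'
      by (simp add: rank_1_point_def zp_red_hom vec_red_hom zp_red_eq_0_iff[THEN iffD2])
    then show "X \<in> {X. block_type j k X \<and> jordan_red X = rank_1_point u}" using Y mem by simp
  qed
  have "jordan_level (Suc (j + k)) ?S"
    using jordan_level_Int[OF block_level[of j k "Suc (j + k)"] jordan_level_red[of "Suc (j + k)" "\<lambda>s. s = rank_1_point u"]]
    by (simp add: Int_def)
  then have "vol ?S = vol ((+) (- rank_1_point a0) ` ?S)" by (rule vol_translate[symmetric])
  also have "(+) (- rank_1_point a0) ` ?S = jordan_stretch 1 j ` {X. block_type 0 (k - j) X}"
    unfolding S image_image by simp
  also have "vol \<dots> = vol {X. block_type 0 (k - j) X} / q ^ (17 * 1 + 10 * j)"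
    by (rule vol_stretch[OF block_level[of 0 "k - j" "Suc (k - j)"]]) simp
  finally show ?thesis by simp
qed

end

section \<open>Evaluation of the counts\<close>

context
  fixes Q :: real
  assumes Q: "Q = real CARD('a::{finite, field})"
begin

lemma card_field_ge_1: "1 \<le> CARD('a) ^ n"
  by (simp add: Suc_le_eq)

lemma real_card_cayley_null: "real (card {z :: 'a cayley. cayley_norm z = 0}) = Q ^ 7 + Q ^ 4 - Q ^ 3"
  unfolding card_cayley_null of_nat_add of_nat_mult of_nat_diff[OF card_field_ge_1] of_nat_power Q[symmetric]
  by (simp add: algebra_simps flip: power_add)

lemma real_card_block_null: "real (card {(b, c, z :: 'a cayley). block_norm b c z = 0}) = Q ^ 9 + Q ^ 5 - Q ^ 4"
proof -
  have 1: "1 \<le> CARD('a)" using card_field_ge_1[of 1] by simp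
  show ?thesis
    unfolding card_block_null of_nat_add of_nat_mult of_nat_diff[OF 1] real_card_cayley_null of_nat_power Q[symmetric]
    by (simp add: algebra_simps eval_nat_numeral)
qed

lemma card_cayley_null_ge_1: "1 \<le> card {z :: 'a cayley. cayley_norm z = 0}"
  unfolding card_cayley_null using card_field_ge_1[of 4] by linarith

text \<open>The value equals (q - 1) |E6| / |F4| for the simply connected groups over the residue
  field, in agreement with F4 as the stabilizer of the unit matrix.\<close>

lemma real_card_jordan_det_nonzero:
  "real (card {X :: 'a jordan. jordan_det X \<noteq> 0}) = Q ^ 12 * (Q - 1) * (Q ^ 5 - 1) * (Q ^ 9 - 1)"
proof -
  let ?P = "{(x :: 'a cayley, y). cayley_norm x = 0 \<and> cayley_norm y = 0 \<and> cayley_mult (cayley_conj x) y = 0}"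
  let ?B = "{(b, c, z :: 'a cayley). block_norm b c z = 0}"
  have 1: "1 \<le> CARD('a)" using card_field_ge_1[of 1] by simp
  have P: "real (card ?P) = Q ^ 11 + Q ^ 8 - Q ^ 3"
    unfolding card_null_pairs Let_def of_nat_add of_nat_mult of_nat_diff[OF card_cayley_null_ge_1]
      real_card_cayley_null of_nat_power Q[symmetric]
    by (simp add: algebra_simps flip: power_add)
  have P16: "card ?P \<le> CARD('a) ^ 16"
    using card_mono[of "UNIV :: ('a cayley \<times> 'a cayley) set" ?P] by (simp add: CARD_vec flip: power_add)
  have B10: "card ?B \<le> CARD('a) ^ 10"
    using card_mono[of "UNIV :: ('a \<times> 'a \<times> 'a cayley) set" ?B] by (simp add: CARD_vec eval_nat_numeral)
  have le: "CARD('a) ^ 9 \<le> CARD('a) ^ 10" using 1 by (intro power_increasing) simp_all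
  show ?thesis
    unfolding card_jordan_det_nonzero of_nat_add of_nat_mult of_nat_diff[OF 1] of_nat_diff[OF P16]
      of_nat_diff[OF B10] of_nat_diff[OF le] P real_card_block_null of_nat_power Q[symmetric]
    by (simp add: algebra_simps eval_nat_numeral)
qed

lemma real_card_rank_le_1:
  "real (card {X :: 'a jordan. rank_le_1 X}) = Q ^ 17 + Q ^ 13 + Q ^ 9 - Q ^ 8 - Q ^ 4"
proof -
  have 1: "1 \<le> CARD('a)" using card_field_ge_1[of 1] by simp
  show ?thesis
    unfolding card_rank_le_1 of_nat_add of_nat_mult of_nat_diff[OF 1] of_nat_diff[OF card_cayley_null_ge_1]
      real_card_cayley_null real_card_block_null of_nat_power Q[symmetric]
    by (simp add: algebra_simps eval_nat_numeral)
qed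

lemma card_jordan_UNIV: "card (UNIV :: 'a jordan set) = CARD('a) ^ 27"
  by (simp add: CARD_vec eval_nat_numeral)

text \<open>The complement of the two sets already counted, which are disjoint because a zero
  adjoint forces the determinant to vanish.\<close>

lemma real_card_rank_2:
  "real (card {X :: 'a jordan. \<not> rank_le_1 X \<and> jordan_det X = 0})
    = Q ^ 27 - Q ^ 12 * (Q - 1) * (Q ^ 5 - 1) * (Q ^ 9 - 1) - (Q ^ 17 + Q ^ 13 + Q ^ 9 - Q ^ 8 - Q ^ 4)"
proof -
  let ?A = "{X :: 'a jordan. \<not> rank_le_1 X \<and> jordan_det X = 0}"
  have "UNIV = ?A \<union> ({X. jordan_det X \<noteq> 0} \<union> {X. rank_le_1 X})" by blast
  then have "CARD('a) ^ 27 = card (?A \<union> ({X. jordan_det X \<noteq> 0} \<union> {X. rank_le_1 X}))"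
    by (simp only: card_jordan_UNIV[symmetric])
  also have "\<dots> = card ?A + card ({X :: 'a jordan. jordan_det X \<noteq> 0} \<union> {X. rank_le_1 X})"
    by (rule card_Un_disjoint) auto
  also have "card ({X :: 'a jordan. jordan_det X \<noteq> 0} \<union> {X. rank_le_1 X})
      = card {X :: 'a jordan. jordan_det X \<noteq> 0} + card {X :: 'a jordan. rank_le_1 X}"
    by (rule card_Un_disjoint) (use rank_le_1_det in \<open>simp, simp, blast\<close>)
  finally have "real (CARD('a) ^ 27) = real (card ?A) + (real (card {X :: 'a jordan. jordan_det X \<noteq> 0})
      + real (card {X :: 'a jordan. rank_le_1 X}))"
    by (simp only: of_nat_add)
  then show ?thesis
    unfolding real_card_rank_le_1 real_card_jordan_det_nonzero of_nat_power Q[symmetric] by linarith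
qed

lemma card_block_set:
  "card ({(a, b, c, x, y, z). P b c z} :: 'a jordan set) = CARD('a) ^ 17 * card {(b, c, z). P b c z}"
  by (subst card_jordan_split) (simp add: CARD_vec eval_nat_numeral)

lemma real_card_block_quad_nonzero:
  "real (card {X :: 'a jordan. block_quad X \<noteq> 0}) = Q ^ 17 * (Q ^ 10 - (Q ^ 9 + Q ^ 5 - Q ^ 4))"
proof -
  let ?B = "{(b, c, z :: 'a cayley). block_norm b c z = 0}"
  have c3: "card (UNIV :: ('a \<times> 'a \<times> 'a cayley) set) = CARD('a) ^ 10"
    by (simp add: CARD_vec eval_nat_numeral)
  have B10: "card ?B \<le> CARD('a) ^ 10"
    unfolding c3[symmetric] by (rule card_mono) simp_all
  have "{(b, c, z :: 'a cayley). block_norm b c z \<noteq> 0} = UNIV - ?B" by auto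
  then have "card {(b, c, z :: 'a cayley). block_norm b c z \<noteq> 0} = CARD('a) ^ 10 - card ?B"
    by (simp only: card_Diff_subset finite subset_UNIV c3)
  moreover have "{X :: 'a jordan. block_quad X \<noteq> 0} = {(a, b, c, x, y, z). block_norm b c z \<noteq> 0}"
    by (auto simp: block_quad_def)
  ultimately have "card {X :: 'a jordan. block_quad X \<noteq> 0} = CARD('a) ^ 17 * (CARD('a) ^ 10 - card ?B)"
    by (simp only: card_block_set)
  then show ?thesis
    by (simp only: of_nat_mult of_nat_diff[OF B10] of_nat_power real_card_block_null Q[symmetric])
qed

lemma real_card_block_isotropic:
  "real (card {X :: 'a jordan. block_nonzero X \<and> block_quad X = 0}) = Q ^ 17 * (Q ^ 9 + Q ^ 5 - Q ^ 4 - 1)"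
proof -
  let ?B = "{(b, c, z :: 'a cayley). block_norm b c z = 0}"
  have 0: "0 \<in> ?B" by (simp add: zero_prod_def block_norm_def)
  then have B1: "1 \<le> card ?B" by (metis card_gt_0_iff empty_iff finite One_nat_def Suc_le_eq)
  have "{(b, c, z :: 'a cayley). (b, c, z) \<noteq> 0 \<and> block_norm b c z = 0} = ?B - {0}" by auto
  then have "card {(b, c, z :: 'a cayley). (b, c, z) \<noteq> 0 \<and> block_norm b c z = 0} = card ?B - 1"
    using 0 by (simp only: card_Diff_singleton)
  moreover have "{X :: 'a jordan. block_nonzero X \<and> block_quad X = 0}
      = {(a, b, c, x, y, z). (b, c, z) \<noteq> 0 \<and> block_norm b c z = 0}"
    by (auto simp: block_quad_def block_nonzero_def)
  ultimately have "card {X :: 'a jordan. block_nonzero X \<and> block_quad X = 0} = CARD('a) ^ 17 * (card ?B - 1)"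
    by (simp only: card_block_set)
  then show ?thesis
    by (simp only: of_nat_mult of_nat_diff[OF B1] of_nat_power real_card_block_null Q[symmetric] of_nat_1)
qed

end

lemma block_dvd_1_iff: "block_dvd 1 X \<longleftrightarrow> \<not> block_nonzero (jordan_red X)"
  by (cases X) (auto simp: block_nonzero_def zero_prod_def zp_red_eq_0_iff vec_eq_iff)

section \<open>Volume of each type of orbit\<close>

context jordan_haar
begin

lemma q_card: "q = real CARD('p mod_ring)"
  by (simp add: q)

lemma vol_type_000: "vol {X. jordan_type 0 0 0 X} = q ^ 12 * (q - 1) * (q ^ 5 - 1) * (q ^ 9 - 1) / q ^ 27"
  using vol_red[of "\<lambda>r. jordan_det r \<noteq> 0"]
  unfolding jordan_type_000_iff real_card_jordan_det_nonzero[OF q_card] .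

text \<open>Where the adjoint is nonzero modulo p, some direction gives the determinant a unit
  differential. That depends only on the reduction, so one direction serves the whole residue
  class.\<close>

lemma vol_type_00k:
  assumes "1 \<le> k"
  shows "vol {X. jordan_type 0 0 k X} = (1 - 1 / q) / q ^ (k - 1) *
    ((q ^ 27 - q ^ 12 * (q - 1) * (q ^ 5 - 1) * (q ^ 9 - 1) - (q ^ 17 + q ^ 13 + q ^ 9 - q ^ 8 - q ^ 4)) / q ^ 27)"
proof -
  let ?R = "{r :: 'p mod_ring jordan. \<not> rank_le_1 r}"
  have "{X. jordan_type 0 0 k X}
      = {X. jordan_red X \<in> ?R \<and> \<pi> ^ k dvd jordan_det X \<and> \<not> \<pi> ^ Suc k dvd jordan_det X}"
    using jordan_type_00k_iff[OF assms] by blast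
  also have "vol \<dots> = (1 - 1 / q) / q ^ (k - 1) * vol {X. jordan_red X \<in> ?R \<and> \<pi> dvd jordan_det X}"
  proof (rule vol_valuation[OF jordan_det_level _ assms])
    fix r assume r: "r \<in> ?R"
    obtain X0 where X0: "jordan_red X0 = r" using jordan_red_surj by blast
    then obtain Y where "\<not> \<pi> dvd jordan_lin X0 Y"
      using r rank_le_1_red[of X0] by (auto simp: jordan_lin_dvd_def)
    then have "jordan_lin r (jordan_red Y) \<noteq> 0"
      using jordan_lin_red[of X0 Y] X0 by (simp add: zp_red_eq_0_iff)
    then have "\<not> \<pi> dvd jordan_lin X Y" if "jordan_red X = r" for X
      using jordan_lin_red[of X Y] that by (simp add: zp_red_eq_0_iff)
    then show "\<exists>Y. \<forall>X. jordan_red X = r \<longrightarrow> unit_direction jordan_det Y X"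
      using unit_direction_det by blast
  qed
  also have "{X. jordan_red X \<in> ?R \<and> \<pi> dvd jordan_det X}
      = {X. \<not> rank_le_1 (jordan_red X) \<and> jordan_det (jordan_red X) = 0}"
    by (simp add: jordan_det_red zp_red_eq_0_iff)
  also have "vol \<dots> = real (card {r :: 'p mod_ring jordan. \<not> rank_le_1 r \<and> jordan_det r = 0}) / q ^ 27"
    by (rule vol_red)
  finally show ?thesis unfolding real_card_rank_2[OF q_card] .
qed

text \<open>For m = 0 the form takes unit values, a condition modulo p only. For m > 0 one starts
  from nonzero isotropic residues, and each power of p after the first costs q. The factor q^17
  stands for the free first row.\<close>

definition block_vol :: "nat \<Rightarrow> real" where
  "block_vol m = (if m = 0 then q ^ 17 * (q ^ 10 - (q ^ 9 + q ^ 5 - q ^ 4)) / q ^ 27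
     else (1 - 1 / q) / q ^ (m - 1) * (q ^ 17 * (q ^ 9 + q ^ 5 - q ^ 4 - 1) / q ^ 27))"

lemma vol_block_type_0: "vol {X. block_type 0 m X} = block_vol m"
proof (cases "m = 0")
  case True
  have "block_type 0 0 X \<longleftrightarrow> block_quad (jordan_red X) \<noteq> 0" for X :: "'p zp jordan"
  proof -
    have "block_nonzero (jordan_red X)" if "block_quad (jordan_red X) \<noteq> 0"
    proof (rule ccontr)
      assume "\<not> block_nonzero (jordan_red X)"
      then show False using that
        by (cases "jordan_red X") (auto simp: block_nonzero_def block_quad_def block_norm_def zero_prod_def)
    qed
    then show ?thesis
      using block_dvd_1_iff[of X] unfolding block_type_def block_quad_red zp_red_eq_0_iff
      by (cases X) auto
  qed
  then show ?thesis
    using vol_red[of "\<lambda>r. block_quad r \<noteq> 0"] True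
    by (simp add: real_card_block_quad_nonzero[OF q_card] block_vol_def)
next
  case False
  let ?R = "{r :: 'p mod_ring jordan. block_nonzero r}"
  have "block_dvd 0 X" for X :: "'p zp jordan" by (cases X) simp
  then have "{X. block_type 0 m X}
      = {X. jordan_red X \<in> ?R \<and> \<pi> ^ m dvd block_quad X \<and> \<not> \<pi> ^ Suc m dvd block_quad X}"
    by (simp add: block_type_def block_dvd_1_iff[unfolded One_nat_def] del: power_Suc block_dvd.simps)
  also have "vol \<dots> = (1 - 1 / q) / q ^ (m - 1) * vol {X. jordan_red X \<in> ?R \<and> \<pi> dvd block_quad X}"
  proof (rule vol_valuation[OF block_quad_level])
    show "1 \<le> m" using False by simp
    fix r assume "r \<in> ?R"
    then obtain s where s: "block_polar r s \<noteq> 0" using block_polar_nondegenerate by blast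
    obtain Y where Y: "jordan_red Y = s" using jordan_red_surj by blast
    have "\<not> \<pi> dvd block_polar X Y" if "jordan_red X = r" for X
      using block_polar_red[of X Y] that s Y by (simp add: zp_red_eq_0_iff)
    then show "\<exists>Y. \<forall>X. jordan_red X = r \<longrightarrow> unit_direction block_quad Y X"
      using unit_direction_block by blast
  qed
  also have "{X. jordan_red X \<in> ?R \<and> \<pi> dvd block_quad X}
      = {X. block_nonzero (jordan_red X) \<and> block_quad (jordan_red X) = 0}"
    by (simp add: block_quad_red zp_red_eq_0_iff)
  also have "vol \<dots> = real (card {r :: 'p mod_ring jordan. block_nonzero r \<and> block_quad r = 0}) / q ^ 27"
    by (rule vol_red)
  finally show ?thesis using False by (simp add: real_card_block_isotropic[OF q_card] block_vol_def)
qed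

text \<open>The matrices of this type reduce to nonzero residues of rank 1. The group moves each
  such class to one at \<open>rank_1_point u\<close>, where the volume does not depend on u; hence
  the total is the number of residues times a single volume.\<close>

lemma vol_type_0jk:
  assumes j: "1 \<le> j" "j \<le> k"
  shows "vol {X. jordan_type 0 j k X}
    = (q ^ 17 + q ^ 13 + q ^ 9 - q ^ 8 - q ^ 4 - 1) * (block_vol (k - j) / q ^ (17 + 10 * j))"
proof -
  let ?R = "{r :: 'p mod_ring jordan. rank_le_1 r} - {0}"
  let ?n = "Suc (0 + j + k)"
  have "vol {X. jordan_type 0 j k X} = (\<Sum>r\<in>?R. vol {X \<in> {X. jordan_type 0 j k X}. jordan_red X = r})"
  proof (rule vol_sum_residues[of ?n])
    show "jordan_level ?n {X :: 'p zp jordan. jordan_type 0 j k X}" by (rule jordan_level_type) simp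
    fix X :: "'p zp jordan" assume X: "X \<in> {X. jordan_type 0 j k X}"
    then have "jordan_lin_dvd j X" by (simp add: jordan_type_def)
    then have "jordan_lin_dvd 1 X"
      unfolding jordan_lin_dvd_def using dvd_trans[OF le_imp_power_dvd[OF j(1)]] by blast
    moreover have "jordan_red X \<noteq> 0"
    proof
      assume "jordan_red X = 0"
      then have "jordan_red X = jordan_red 0" by (simp add: zero_prod_def zp_red_hom vec_red_hom)
      then have "jordan_dvd 1 X" using jordan_red_eq_iff[of X 0] by (simp only: diff_zero jordan_box_eq_dvd)
      then show False using X by (simp add: jordan_type_def)
    qed
    ultimately show "jordan_red X \<in> ?R" by (simp add: rank_le_1_red)
  qed simp
  also have "\<dots> = (\<Sum>r\<in>?R. block_vol (k - j) / q ^ (17 + 10 * j))"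
  proof (rule sum.cong[OF refl])
    fix r assume r: "r \<in> ?R"
    obtain X where X: "jordan_red X = r" using jordan_red_surj by blast
    obtain g u where g: "g \<in> jordan_group" "u \<noteq> 0" "jordan_red (g X) = rank_1_point u"
      using equiv_rank_1_point[of X] r X by blast
    have "vol {X. jordan_type 0 j k X \<and> jordan_red X = r} = vol {X. jordan_type 0 j k X \<and> jordan_red X = rank_1_point u}"
      using vol_type_residue[OF g(1), of 0 j k X] by (simp only: X g(3))
    also have "\<dots> = block_vol (k - j) / q ^ (17 + 10 * j)"
      by (simp only: vol_type_chart[OF g(2)] vol_block_type[OF j] vol_block_type_0)
    finally show "vol {X \<in> {X. jordan_type 0 j k X}. jordan_red X = r} = block_vol (k - j) / q ^ (17 + 10 * j)"
      by (simp only: mem_Collect_eq)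
  qed
  also have "\<dots> = real (card ?R) * (block_vol (k - j) / q ^ (17 + 10 * j))" by simp
  also have "real (card ?R) = q ^ 17 + q ^ 13 + q ^ 9 - q ^ 8 - q ^ 4 - 1"
  proof -
    have 0: "0 \<in> {r :: 'p mod_ring jordan. rank_le_1 r}" by (simp add: zero_prod_def rank_le_1_def)
    then have "1 \<le> card {r :: 'p mod_ring jordan. rank_le_1 r}"
      by (metis card_gt_0_iff empty_iff finite One_nat_def Suc_le_eq)
    then show ?thesis
      using 0 by (simp only: card_Diff_singleton of_nat_diff real_card_rank_le_1[OF q_card] of_nat_1)
  qed
  finally show ?thesis .
qed

lemma vol_type_scale:
  assumes "i \<le> j" "j \<le> k"
  shows "vol {X. jordan_type i j k X} = vol {X. jordan_type 0 (j - i) (k - i) X} / q ^ (27 * i)"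
proof -
  have "jordan_scale (\<pi> ^ i) = (jordan_stretch i i :: 'p zp jordan \<Rightarrow> _)"
  proof
    show "jordan_scale (\<pi> ^ i) X = jordan_stretch i i X" for X :: "'p zp jordan" by (cases X) simp
  qed
  moreover have "jordan_level (Suc (0 + (j - i) + (k - i))) {X :: 'p zp jordan. jordan_type 0 (j - i) (k - i) X}"
    by (rule jordan_level_type) simp
  ultimately show ?thesis
    unfolding jordan_type_scale[OF assms] using vol_stretch[of _ _ i i] by simp
qed

end

section \<open>Closed formulas for volumes and local densities\<close>

context jordan_haar
begin

lemma one_minus_inverse_power: "q ^ n - 1 = q ^ n * (1 - 1 / q ^ n)" "0 < n \<Longrightarrow> 1 - 1 / q ^ n \<noteq> 0"
  using q_gt_1 less_imp_neq[OF one_less_power[OF q_gt_1, of n], symmetric] by (simp_all add: field_simps)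

text \<open>The polynomial is q - 1 times the number of points of the projective Cayley plane over
  the residue field. It equals (q^9 - 1)(q^12 - 1) / (q^4 - 1), which is how 1 - q^-4 enters the
  denominators.\<close>

lemma rank_1_count: "(q ^ 17 + q ^ 13 + q ^ 9 - q ^ 8 - q ^ 4 - 1)
    = q ^ 17 * (1 - 1 / q ^ 9) * (1 - 1 / q ^ 12) / (1 - 1 / q ^ 4)"
proof -
  have "(q ^ 17 + q ^ 13 + q ^ 9 - q ^ 8 - q ^ 4 - 1) * (q ^ 4 - 1) = (q ^ 9 - 1) * (q ^ 12 - 1)"
    by (simp add: algebra_simps flip: power_add)
  then have "(q ^ 17 + q ^ 13 + q ^ 9 - q ^ 8 - q ^ 4 - 1) * (1 - 1 / q ^ 4) * q ^ 4
      = q ^ 17 * (1 - 1 / q ^ 9) * (1 - 1 / q ^ 12) * q ^ 4"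
    unfolding one_minus_inverse_power(1)[of 4] one_minus_inverse_power(1)[of 9] one_minus_inverse_power(1)[of 12]
    by (simp add: ac_simps flip: power_add)
  then show ?thesis using one_minus_inverse_power(2)[of 4] q_gt_1 by (simp add: eq_divide_eq)
qed

lemma vol_type_eq:
  shows "vol {X. jordan_type 0 0 0 X} = (1 - 1 / q) * (1 - 1 / q ^ 5) * (1 - 1 / q ^ 9)"
    and "1 \<le> k \<Longrightarrow> vol {X. jordan_type 0 0 k X}
      = (1 - 1 / q) * (1 - 1 / q ^ 5) * (1 - 1 / q ^ 9) * (1 - 1 / q ^ 12) / ((1 - 1 / q ^ 4) * q ^ k)"
    and "1 \<le> k \<Longrightarrow> vol {X. jordan_type 0 k k X}
      = (1 - 1 / q) * (1 - 1 / q ^ 5) * (1 - 1 / q ^ 9) * (1 - 1 / q ^ 12) / ((1 - 1 / q ^ 4) * q ^ (10 * k))"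
    and "1 \<le> j \<Longrightarrow> j < k \<Longrightarrow> vol {X. jordan_type 0 j k X}
      = (1 - 1 / q) * (1 - 1 / q ^ 5) * (1 - 1 / q ^ 9) * (1 - 1 / q ^ 12) * (1 + 1 / q ^ 4)
        / ((1 - 1 / q ^ 4) * (q ^ (9 * j) * q ^ k))"
proof -
  have q0: "q \<noteq> 0" "q > 0" using q_gt_1 by simp_all
  have 4: "1 - 1 / q ^ 4 \<noteq> 0" by (rule one_minus_inverse_power(2)) simp
  show "vol {X. jordan_type 0 0 0 X} = (1 - 1 / q) * (1 - 1 / q ^ 5) * (1 - 1 / q ^ 9)"
  proof -
    have "q ^ 12 * (q - 1) * (q ^ 5 - 1) * (q ^ 9 - 1)
        = q ^ 27 * ((1 - 1 / q) * (1 - 1 / q ^ 5) * (1 - 1 / q ^ 9))"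
      using one_minus_inverse_power(1)[of 1]
      unfolding one_minus_inverse_power(1)[of 5] one_minus_inverse_power(1)[of 9]
      by (simp add: ac_simps eval_nat_numeral)
    then show ?thesis unfolding vol_type_000 using q0 by simp
  qed
  show "vol {X. jordan_type 0 0 k X}
      = (1 - 1 / q) * (1 - 1 / q ^ 5) * (1 - 1 / q ^ 9) * (1 - 1 / q ^ 12) / ((1 - 1 / q ^ 4) * q ^ k)" if k: "1 \<le> k"
  proof -
    let ?C = "(1 - 1 / q ^ 5) * (1 - 1 / q ^ 9) * (1 - 1 / q ^ 12) / (1 - 1 / q ^ 4)"
    \<comment> \<open>The rank 2 count is a multiple of the count of nonzero elements of rank 1, so
      the same factors come out.\<close>
    have "q ^ 27 - q ^ 12 * (q - 1) * (q ^ 5 - 1) * (q ^ 9 - 1) - (q ^ 17 + q ^ 13 + q ^ 9 - q ^ 8 - q ^ 4)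
        = q ^ 4 * (q ^ 5 - 1) * (q ^ 17 + q ^ 13 + q ^ 9 - q ^ 8 - q ^ 4 - 1)"
      by (simp add: algebra_simps eval_nat_numeral)
    also have "\<dots> = q ^ 26 * ?C"
      unfolding rank_1_count one_minus_inverse_power(1)[of 5] by (simp add: ac_simps eval_nat_numeral)
    finally have 1: "vol {X. jordan_type 0 0 k X} = (1 - 1 / q) / q ^ (k - 1) *
        (q ^ 26 * ?C / q ^ 27)"
      unfolding vol_type_00k[OF k] by (simp only:)
    have k': "q ^ k = q ^ (k - 1) * q" using k by (metis power_minus_mult less_eq_Suc_le One_nat_def)
    have 2: "q ^ 27 = q ^ 26 * q" by (simp add: eval_nat_numeral)
    have "D / q ^ (k - 1) * (q ^ 26 * C / q ^ 27) = D * C / q ^ k" for C D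
      unfolding k' 2 using q0 by (simp add: field_simps)
    then have "vol {X. jordan_type 0 0 k X} = (1 - 1 / q) * ?C / q ^ k" unfolding 1 .
    then show ?thesis by (simp only: times_divide_eq_right divide_divide_eq_left mult.assoc)
  qed
  show "vol {X. jordan_type 0 k k X}
      = (1 - 1 / q) * (1 - 1 / q ^ 5) * (1 - 1 / q ^ 9) * (1 - 1 / q ^ 12) / ((1 - 1 / q ^ 4) * q ^ (10 * k))" if k: "1 \<le> k"
  proof -
    have "q ^ 10 - (q ^ 9 + q ^ 5 - q ^ 4) = q ^ 10 * ((1 - 1 / q) * (1 - 1 / q ^ 5))"
      using q0 by (simp add: field_simps eval_nat_numeral)
    moreover have "q ^ 27 = q ^ 17 * q ^ 10" by (simp flip: power_add)
    ultimately have "block_vol (k - k) = (1 - 1 / q) * (1 - 1 / q ^ 5)"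
      unfolding block_vol_def using q0 by simp
    then show ?thesis
      unfolding vol_type_0jk[OF k order_refl] rank_1_count power_add
      using q0 by simp
  qed
  show "vol {X. jordan_type 0 j k X}
      = (1 - 1 / q) * (1 - 1 / q ^ 5) * (1 - 1 / q ^ 9) * (1 - 1 / q ^ 12) * (1 + 1 / q ^ 4)
        / ((1 - 1 / q ^ 4) * (q ^ (9 * j) * q ^ k))" if j: "1 \<le> j" "j < k"
  proof -
    \<comment> \<open>The isotropic count is (q^5 - 1)(q^4 + 1); its second factor is the source of
      1 + q^-4.\<close>
    have "q ^ 9 + q ^ 5 - q ^ 4 - 1 = q ^ 9 * ((1 - 1 / q ^ 5) * (1 + 1 / q ^ 4))"
      using q0 by (simp add: field_simps eval_nat_numeral)
    moreover have "q ^ 27 = q ^ 17 * (q ^ 9 * q)" by (simp add: eval_nat_numeral)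
    moreover have e: "q ^ (k - j) = q ^ (k - j - 1) * q" using j by (metis power_minus_mult zero_less_diff)
    ultimately have 1: "block_vol (k - j) = (1 - 1 / q) * (1 - 1 / q ^ 5) * (1 + 1 / q ^ 4) / q ^ (k - j)"
      unfolding block_vol_def using q0 j by simp
    \<comment> \<open>The content of the block gives 10 j and the remaining valuation k - j, hence
      the weights 9 and 1 of the last two exponents.\<close>
    have "10 * j + (k - j) = 9 * j + k" using j by simp
    then have 2: "q ^ (10 * j) * q ^ (k - j) = q ^ (9 * j) * q ^ k" by (simp flip: power_add)
    show ?thesis
      unfolding vol_type_0jk[OF j(1) less_imp_le[OF j(2)]] rank_1_count 1 power_add 2[symmetric]
      using q0 by (simp add: ac_simps)
  qed
qed

lemma beta_eq:
  assumes "i \<le> j" "j \<le> k"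
  shows "beta \<sigma> (jordan_diag (\<pi> ^ i) (\<pi> ^ j) (\<pi> ^ k))
    = (1 - 1 / q) * delta CARD('p) * q ^ (27 * i) / vol {X. jordan_type 0 (j - i) (k - i) X}"
  unfolding beta_def jordan_orbit_eq[OF assms] vol_def[symmetric] vol_type_scale[OF assms] q[symmetric] by simp

lemma delta_eq: "delta CARD('p) = (1 - 1 / q ^ 2) * (1 - 1 / q ^ 5) * (1 - 1 / q ^ 6) *
     (1 - 1 / q ^ 8) * (1 - 1 / q ^ 9) * (1 - 1 / q ^ 12)"
  by (simp add: delta_def q)

lemma beta_cases:
  shows "beta \<sigma> (jordan_diag (\<pi> ^ i) (\<pi> ^ i) (\<pi> ^ i))
      = q ^ (27 * i) * (1 - 1 / q ^ 2) * (1 - 1 / q ^ 6) * (1 - 1 / q ^ 8) * (1 - 1 / q ^ 12)"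
    and "i < k \<Longrightarrow> beta \<sigma> (jordan_diag (\<pi> ^ i) (\<pi> ^ i) (\<pi> ^ k))
      = q ^ (26 * i + k) * (1 - 1 / q ^ 2) * (1 - 1 / q ^ 4) * (1 - 1 / q ^ 6) * (1 - 1 / q ^ 8)"
    and "i < k \<Longrightarrow> beta \<sigma> (jordan_diag (\<pi> ^ i) (\<pi> ^ k) (\<pi> ^ k))
      = q ^ (17 * i + 10 * k) * (1 - 1 / q ^ 2) * (1 - 1 / q ^ 4) * (1 - 1 / q ^ 6) * (1 - 1 / q ^ 8)"
    and "i < j \<Longrightarrow> j < k \<Longrightarrow> beta \<sigma> (jordan_diag (\<pi> ^ i) (\<pi> ^ j) (\<pi> ^ k))
      = q ^ (17 * i + 9 * j + k) * (1 - 1 / q ^ 2) * (1 - 1 / q ^ 4) ^ 2 * (1 - 1 / q ^ 6)"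
proof -
  define A1 A2 A4 A5 A6 A8 A9 A12 where A: "A1 = 1 - 1 / q" "A2 = 1 - 1 / q ^ 2" "A4 = 1 - 1 / q ^ 4"
    "A5 = 1 - 1 / q ^ 5" "A6 = 1 - 1 / q ^ 6" "A8 = 1 - 1 / q ^ 8" "A9 = 1 - 1 / q ^ 9" "A12 = 1 - 1 / q ^ 12"
  have nz: "A1 \<noteq> 0" "A4 \<noteq> 0" "A5 \<noteq> 0" "A9 \<noteq> 0" "A12 \<noteq> 0" "q \<noteq> 0"
    using one_minus_inverse_power(2)[of 1] one_minus_inverse_power(2)[of 4] one_minus_inverse_power(2)[of 5]
      one_minus_inverse_power(2)[of 9] one_minus_inverse_power(2)[of 12] q_gt_1 by (simp_all add: A)
  define A4' where "A4' = 1 + 1 / q ^ 4"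
  \<comment> \<open>In the last case 1 + q^-4 from the isotropic count cancels half of 1 - q^-8; the
    surviving 1 - q^-4 meets the one from the rank 1 count and produces the square.\<close>
  have A8: "A8 = A4 * A4'" using nz(6) by (simp add: A A4'_def field_simps flip: power_add)
  have nz': "A4' \<noteq> 0" using q_gt_1 by (simp add: A4'_def add_pos_pos less_imp_neq[symmetric])
  show "beta \<sigma> (jordan_diag (\<pi> ^ i) (\<pi> ^ i) (\<pi> ^ i))
      = q ^ (27 * i) * (1 - 1 / q ^ 2) * (1 - 1 / q ^ 6) * (1 - 1 / q ^ 8) * (1 - 1 / q ^ 12)"
    unfolding beta_eq[OF order_refl order_refl] diff_self_eq_0 vol_type_eq(1) delta_eq A[symmetric]
    using nz by (simp add: field_simps)
  show "beta \<sigma> (jordan_diag (\<pi> ^ i) (\<pi> ^ i) (\<pi> ^ k))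
      = q ^ (26 * i + k) * (1 - 1 / q ^ 2) * (1 - 1 / q ^ 4) * (1 - 1 / q ^ 6) * (1 - 1 / q ^ 8)" if "i < k"
  proof -
    have k: "1 \<le> k - i" "i \<le> k" using that by simp_all
    have x: "27 * i + (k - i) = 26 * i + k" using that by simp
    have e: "q ^ (26 * i + k) = q ^ (27 * i) * q ^ (k - i)" by (simp only: power_add[symmetric] x)
    show ?thesis
      unfolding beta_eq[OF order_refl k(2)] diff_self_eq_0 vol_type_eq(2)[OF k(1)] delta_eq A[symmetric] e
      using nz by (simp add: field_simps)
  qed
  show "beta \<sigma> (jordan_diag (\<pi> ^ i) (\<pi> ^ k) (\<pi> ^ k))
      = q ^ (17 * i + 10 * k) * (1 - 1 / q ^ 2) * (1 - 1 / q ^ 4) * (1 - 1 / q ^ 6) * (1 - 1 / q ^ 8)" if "i < k"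
  proof -
    have k: "1 \<le> k - i" "i \<le> k" using that by simp_all
    have x: "27 * i + 10 * (k - i) = 17 * i + 10 * k" using that by simp
    have e: "q ^ (17 * i + 10 * k) = q ^ (27 * i) * q ^ (10 * (k - i))" by (simp only: power_add[symmetric] x)
    show ?thesis
      unfolding beta_eq[OF k(2) order_refl] vol_type_eq(3)[OF k(1)] delta_eq A[symmetric] e
      using nz by (simp add: field_simps)
  qed
  show "beta \<sigma> (jordan_diag (\<pi> ^ i) (\<pi> ^ j) (\<pi> ^ k))
      = q ^ (17 * i + 9 * j + k) * (1 - 1 / q ^ 2) * (1 - 1 / q ^ 4) ^ 2 * (1 - 1 / q ^ 6)" if "i < j" "j < k"
  proof -
    have k: "1 \<le> j - i" "j - i < k - i" "i \<le> j" "j \<le> k" using that by simp_all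
    have x: "27 * i + (9 * (j - i) + (k - i)) = 17 * i + 9 * j + k" using that by simp
    have e: "q ^ (17 * i + 9 * j + k) = q ^ (27 * i) * (q ^ (9 * (j - i)) * q ^ (k - i))" by (simp only: power_add[symmetric] x)
    show ?thesis
      unfolding beta_eq[OF k(3,4)] vol_type_eq(4)[OF k(1,2)] delta_eq A[symmetric] A4'_def[symmetric] e A8
      using nz nz' by (simp add: field_simps power2_eq_square)
  qed
qed

end

theorem theorem6p5:
  fixes p a1 a2 a3 :: nat
    and \<sigma> :: "'p::prime_card qp jordan measure"
    and T :: "'p zp jordan"
  assumes p: "p = CARD('p)"
    and haar: "haar_measure \<sigma>"
    and vol: "emeasure \<sigma> (range jordan_of_zp) = 1"
    and a12: "a1 \<le> a2" and a23: "a2 \<le> a3"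
    and T: "T = jordan_diag (of_nat p ^ a1) (of_nat p ^ a2) (of_nat p ^ a3)"
  shows
    "(a1 = a2 \<and> a2 = a3 \<longrightarrow> beta \<sigma> T =
       real p ^ (27 * a1) *
         (1 - 1 / real p ^ 2) * (1 - 1 / real p ^ 6) * (1 - 1 / real p ^ 8) * (1 - 1 / real p ^ 12)) \<and>
     (a1 = a2 \<and> a2 < a3 \<longrightarrow> beta \<sigma> T =
       real p ^ (26 * a1 + a3) *
         (1 - 1 / real p ^ 2) * (1 - 1 / real p ^ 4) * (1 - 1 / real p ^ 6) * (1 - 1 / real p ^ 8)) \<and>
     (a1 < a2 \<and> a2 = a3 \<longrightarrow> beta \<sigma> T =
       real p ^ (17 * a1 + 10 * a3) *
         (1 - 1 / real p ^ 2) * (1 - 1 / real p ^ 4) * (1 - 1 / real p ^ 6) * (1 - 1 / real p ^ 8)) \<and>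
     (a1 < a2 \<and> a2 < a3 \<longrightarrow> beta \<sigma> T =
       real p ^ (17 * a1 + 9 * a2 + a3) *
         (1 - 1 / real p ^ 2) * (1 - 1 / real p ^ 4) ^ 2 * (1 - 1 / real p ^ 6))"
proof -
  interpret jordan_haar \<sigma> "real CARD('p)"
    by unfold_locales (use haar vol in simp_all)
  show ?thesis
    unfolding T p using beta_cases by blast
qed

end
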